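(* Let $\Gamma$ be a group generated by the finite symmetric set $S$ and let $\varphi:\Gamma\to\mathrm{Aut}(X,\mu)$ be a p.m.p. action of $\Gamma$ on a standard Borel probability space $(X,\mathcal{B},\mu)$. Then for every subgroup $H$ of $\Gamma$ with $$\rho(\Gamma,H,\lambda_{S})>\rho^{+}(\varphi(\lambda_{S}))$$ there exists a finitely generated subgroup $H'$ of $H$ such that $H'$ has finitely many ergodic components on $X$ and $H'$ acts on each component with spectral gap.
   Context: $\mathrm{Aut}(X,\mu)$ is the Polish group of $\mu$-preserving Borel isomorphisms of $(X,\mathcal{B},\mu)$, acting on $X$ from the right. A p.m.p. action of $\Gamma$ on $(X,\mathcal{B},\mu)$ is a homomorphism $\varphi:\Gamma\to\mathrm{Aut}(X,\mu)$. $L^2(X)$ is the space of real square integrable functions, $L_0^2(X)$ the subspace of functions with zero integral. For a Borel probability measure $\lambda$ on $\mathrm{Aut}(X,\mu)$, $M_\lambda$ is the averaging operator $(fM_\lambda)(x)=\int f(xa)\,d\lambda(a)$ on $L^2(X)$, and $$\rho^+(\lambda)=\rho^+(X,\mathcal{B},\mu,\lambda)=\sup_{0\ne f\in L_0^2(X)}\frac{\langle fM_\lambda,f\rangle}{\langle f,f\rangle}.$$ A finite set $S\subseteq\Gamma$ is symmetric if $S=S^{-1}$; $\lambda_S$ is the uniform probability measure on $S$, and $\varphi(\lambda_S)$ is its push-forward to $\mathrm{Aut}(X,\mu)$. For a subgroup $H\le\Gamma$ and a symmetric probability measure $\lambda$ on $\Gamma$, let $H\backslash\Gamma$ be the set of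 right cosets $Hg$, let $M_\lambda$ act on $l^2(H\backslash\Gamma)$ by $(fM_\lambda)(Hg)=\sum_{s\in\Gamma}\lambda(s)f(Hgs)$, and define the relative spectral radius $$\rho(\Gamma,H,\lambda)=\sup_{0\neq f\in l^{2}(H\backslash\Gamma)}\frac{\langle fM_{\lambda},f\rangle}{\langle f,f\rangle}$$ (which equals $\|M_\lambda\|$ and $\lim_{n}\sqrt[2n]{p_{e,H,2n}}$, where $p_{e,H,n}$ is the probability that the $\lambda$-random walk on $\Gamma$ of length $n$ starting at $e$ ends in $H$). "$H'$ has finitely many ergodic components and acts on each with spectral gap" means: up to a null set, $X$ is a finite disjoint union of $H'$-invariant Borel sets $X_1,\dots,X_n$ of positive measure, each $X_i$ is ergodic for $H'$ (every $H'$-invariant Borel subset of $X_i$ is null or conull in $X_i$), and for a finite symmetric generating set $T$ of $H'$, the restriction of $\varphi(\lambda_T)$ to $(X_i,\mu/\mu(X_i))$ satisfies $\rho^+(X_i,\mathcal{B}|_{X_i},\mu/\mu(X_i),\varphi(\lambda_T))<1$ (this does not depend on the choice of $T$). *)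

theory Defs
  imports "HOL-Probability.Probability" "HOL-Algebra.Generated_Groups"
begin

definition standard_borel :: "'x measure \<Rightarrow> bool" where
  "standard_borel M \<longleftrightarrow>
     (\<exists>T. completely_metrizable_space T \<and> second_countable T \<and>
          topspace T = space M \<and> sets M = sigma_sets (topspace T) {U. openin T U})"

(* Automorphisms are represented by functions on the underlying type, of which only the
   values on the space matter. *)
definition Aut :: "'x measure \<Rightarrow> ('x \<Rightarrow> 'x) set" where
  "Aut M = {a. bij_betw a (space M) (space M) \<and> a \<in> measurable M M \<and>
               inv_into (space M) a \<in> measurable M M \<and> distr M M a = M}"

(* The automorphism group acts from the right: x(ab) = (xa)b.  As a Polish group it consists of
   automorphisms up to almost everywhere equality, so multiplicativity is required almost
   everywhere; actions by everywhere defined homomorphisms are included. *)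
definition pmp_action :: "('g, 'r) monoid_scheme \<Rightarrow> 'x measure \<Rightarrow> ('g \<Rightarrow> 'x \<Rightarrow> 'x) \<Rightarrow> bool" where
  "pmp_action G M \<phi> \<longleftrightarrow>
     (\<forall>g\<in>carrier G. \<phi> g \<in> Aut M) \<and>
     (\<forall>g\<in>carrier G. \<forall>h\<in>carrier G. AE x in M. \<phi> (g \<otimes>\<^bsub>G\<^esub> h) x = \<phi> h (\<phi> g x))"

definition L2 :: "'x measure \<Rightarrow> ('x \<Rightarrow> real) set" where
  "L2 M = {f \<in> borel_measurable M. integrable M (\<lambda>x. (f x)\<^sup>2)}"

definition L2_0 :: "'x measure \<Rightarrow> ('x \<Rightarrow> real) set" where
  "L2_0 M = {f \<in> L2 M. (LINT x|M. f x) = 0}"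

definition L2_inner :: "'x measure \<Rightarrow> ('x \<Rightarrow> real) \<Rightarrow> ('x \<Rightarrow> real) \<Rightarrow> real" where
  "L2_inner M f g = (LINT x|M. f x * g x)"

definition averaging :: "('x \<Rightarrow> 'x) measure \<Rightarrow> ('x \<Rightarrow> real) \<Rightarrow> 'x \<Rightarrow> real" where
  "averaging \<Lambda> f x = (LINT a|\<Lambda>. f (a x))"

(* Extended real valued, so that the supremum is -\<infinity> when L2_0 M is trivial, i.e. when
   the probability space M is a single atom. *)
definition rho_plus :: "'x measure \<Rightarrow> ('x \<Rightarrow> 'x) measure \<Rightarrow> ereal" where
  "rho_plus M \<Lambda> =
     (SUP f \<in> {f \<in> L2_0 M. \<not> (AE x in M. f x = 0)}.
        ereal (L2_inner M (averaging \<Lambda> f) f / L2_inner M f f))"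

definition l2_cosets :: "('g, 'r) monoid_scheme \<Rightarrow> 'g set \<Rightarrow> ('g set \<Rightarrow> real) set" where
  "l2_cosets G H = {f. (\<lambda>C. (f C)\<^sup>2) summable_on (rcosets\<^bsub>G\<^esub> H)}"

definition l2_inner :: "('g, 'r) monoid_scheme \<Rightarrow> 'g set \<Rightarrow> ('g set \<Rightarrow> real) \<Rightarrow> ('g set \<Rightarrow> real) \<Rightarrow> real"
  where "l2_inner G H f f' = (\<Sum>\<^sub>\<infinity>C\<in>rcosets\<^bsub>G\<^esub> H. f C * f' C)"

definition coset_averaging ::
    "('g, 'r) monoid_scheme \<Rightarrow> 'g pmf \<Rightarrow> ('g set \<Rightarrow> real) \<Rightarrow> 'g set \<Rightarrow> real" where
  "coset_averaging G \<Lambda> f C = (\<Sum>\<^sub>\<infinity>s\<in>carrier G. pmf \<Lambda> s * f (C #>\<^bsub>G\<^esub> s))"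

definition rel_spectral_radius :: "('g, 'r) monoid_scheme \<Rightarrow> 'g set \<Rightarrow> 'g pmf \<Rightarrow> ereal" where
  "rel_spectral_radius G H \<Lambda> =
     (SUP f \<in> {f \<in> l2_cosets G H. \<exists>C\<in>rcosets\<^bsub>G\<^esub> H. f C \<noteq> 0}.
        ereal (l2_inner G H (coset_averaging G \<Lambda> f) f / l2_inner G H f f))"

(* Nonemptiness is needed for the uniform probability measure on T to exist; it only rules out
   T = {} as a generating set of the trivial group. *)
definition sym_gen_set :: "('g, 'r) monoid_scheme \<Rightarrow> 'g set \<Rightarrow> 'g set \<Rightarrow> bool" where
  "sym_gen_set G K T \<longleftrightarrow>
     finite T \<and> T \<noteq> {} \<and> T \<subseteq> carrier G \<and> m_inv G ` T = T \<and> generate G T = K"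

definition fin_gen :: "('g, 'r) monoid_scheme \<Rightarrow> 'g set \<Rightarrow> bool" where
  "fin_gen G K \<longleftrightarrow> (\<exists>T. finite T \<and> T \<subseteq> carrier G \<and> generate G T = K)"

definition pushed_uniform :: "('g \<Rightarrow> 'x \<Rightarrow> 'x) \<Rightarrow> 'g set \<Rightarrow> ('x \<Rightarrow> 'x) measure" where
  "pushed_uniform \<phi> S = measure_pmf (map_pmf \<phi> (pmf_of_set S))"

(* Exact invariance under the chosen representatives, so that they restrict to A.  For a countable
   group K, a set that is invariant up to null sets differs from such a set by a null set only. *)
definition invariant_set :: "('g \<Rightarrow> 'x \<Rightarrow> 'x) \<Rightarrow> 'g set \<Rightarrow> 'x set \<Rightarrow> bool" where
  "invariant_set \<phi> K A \<longleftrightarrow> (\<forall>h\<in>K. \<phi> h ` A = A)"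

definition ergodic_on :: "'x measure \<Rightarrow> ('g \<Rightarrow> 'x \<Rightarrow> 'x) \<Rightarrow> 'g set \<Rightarrow> 'x set \<Rightarrow> bool" where
  "ergodic_on M \<phi> K Y \<longleftrightarrow>
     (\<forall>A\<in>sets M. A \<subseteq> Y \<and> invariant_set \<phi> K A \<longrightarrow> emeasure M A = 0 \<or> emeasure M (Y - A) = 0)"

definition normalized_restriction :: "'x measure \<Rightarrow> 'x set \<Rightarrow> 'x measure" where
  "normalized_restriction M Y = scale_measure (1 / emeasure M Y) (restrict_space M Y)"

(* Not depending on the finite symmetric generating set T, the condition is imposed for all of
   them; for finitely generated K such T exist. *)
definition spectral_gap_on ::
    "('g, 'r) monoid_scheme \<Rightarrow> 'x measure \<Rightarrow> ('g \<Rightarrow> 'x \<Rightarrow> 'x) \<Rightarrow> 'g set \<Rightarrow> 'x set \<Rightarrow> bool" where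
  "spectral_gap_on G M \<phi> K Y \<longleftrightarrow>
     (\<forall>T. sym_gen_set G K T \<longrightarrow> rho_plus (normalized_restriction M Y) (pushed_uniform \<phi> T) < 1)"

definition finitely_many_components_with_gap ::
    "('g, 'r) monoid_scheme \<Rightarrow> 'x measure \<Rightarrow> ('g \<Rightarrow> 'x \<Rightarrow> 'x) \<Rightarrow> 'g set \<Rightarrow> bool" where
  "finitely_many_components_with_gap G M \<phi> K \<longleftrightarrow>
     (\<exists>\<X>. finite \<X> \<and> \<X> \<subseteq> sets M \<and> disjoint \<X> \<and> space M - \<Union>\<X> \<in> null_sets M \<and>
          (\<forall>Y\<in>\<X>. emeasure M Y > 0 \<and> invariant_set \<phi> K Y \<and>
                  ergodic_on M \<phi> K Y \<and> spectral_gap_on G M \<phi> K Y))"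

end

theory Submission
  imports Defs
begin

text \<open>Fix a finitely supported nonnegative function \<open>F\<close> on the cosets of \<open>H\<close> whose Rayleigh quotient
  exceeds \<open>\<rho>\<^sup>+\<close>.  If \<open>f \<ge> 0\<close> on \<open>X\<close> is invariant under \<open>H\<close>, then \<open>G = \<Sum>\<^sub>C F(C) f(x C\<^sup>-\<^sup>1)\<close> is well
  defined and \<open>F \<mapsto> G\<close> intertwines the random walks on cosets and on \<open>X\<close>.  Return
  probabilities on the coset side bound \<open>\<langle>G M\<^sup>n, G\<rangle>\<close> from below exponentially faster than \<open>\<rho>\<^sup>+\<close> bounds
  its mean-zero part from above, so \<open>(\<integral>f)\<^sup>2 \<ge> d \<parallel>f\<parallel>\<^sup>2\<close>.  For a fixed \<open>n\<close> only finitely many elements of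
  \<open>H\<close> are involved and invariance up to a small error suffices; let \<open>H'\<close> be generated by them.
  Indicator functions then show that \<open>H'\<close>-invariant sets have measure at least \<open>d\<close>, so there are finitely
  many ergodic components.  Without spectral gap on a component, the mean ergodic theorem yields
  arbitrarily many almost invariant, almost orthonormal functions.  A suitable combination of them,
  cut off at a large height, violates the inequality.\<close>

section \<open>Square integrable functions\<close>

text \<open>\<open>rho_plus\<close> is a one-sided supremum and says nothing about spectrum near -1,
  so both walks are replaced by their lazy versions (I + M)/2. These are positive operators, t -> (1
  + t)/2 keeps the strict inequality between the two radii, and Cauchy-Schwarz arguments can stand
  in for the spectral theorem. As the action is multiplicative only almost everywhere, invariance is
  measured by the L2 norm of f(xg) - f(x). The obstacle in the spectral gap part: failure of the gap
  yields mean-zero almost invariant functions, while the inequality concerns nonnegative ones.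
  Absolute values alone do not help, since a function with values 1 and -1 becomes constant and
  satisfies the inequality. A function with a high peak is needed. The squares of N almost
  orthonormal functions have a sum with integral N, hence bounded combinations of them reach height
  about the square root of N while their L2 norms stay bounded. What sticks out above a fixed
  fraction of that height has squared integral at most 24/N times its squared norm, which is too
  little once N > 24/d.\<close>

definition L2_norm :: "'x measure \<Rightarrow> ('x \<Rightarrow> real) \<Rightarrow> real" where
  "L2_norm M f = sqrt (L2_inner M f f)"

lemma L2_measurable: "f \<in> L2 M \<Longrightarrow> f \<in> borel_measurable M"
  by (simp add: L2_def)

lemma L2_integrable_mult:
  assumes "f \<in> L2 M" "g \<in> L2 M"
  shows "integrable M (\<lambda>x. f x * g x)"
proof (rule Bochner_Integration.integrable_bound)
  show "integrable M (\<lambda>x. (f x)\<^sup>2 + (g x)\<^sup>2)"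
    using assms by (auto simp: L2_def)
  show "(\<lambda>x. f x * g x) \<in> borel_measurable M"
    using assms by (auto simp: L2_def)
  have "\<bar>a * b\<bar> \<le> a\<^sup>2 + b\<^sup>2" for a b :: real
  proof -
    have "2 * (\<bar>a\<bar> * \<bar>b\<bar>) \<le> a\<^sup>2 + b\<^sup>2"
      using sum_squares_bound[of "\<bar>a\<bar>" "\<bar>b\<bar>"] by (simp add: mult.assoc)
    moreover have "\<bar>a\<bar> * \<bar>b\<bar> \<ge> 0" by simp
    ultimately show ?thesis unfolding abs_mult by linarith
  qed
  then show "AE x in M. norm (f x * g x) \<le> norm ((f x)\<^sup>2 + (g x)\<^sup>2)"
    by auto
qed

lemma L2I:
  assumes "f \<in> borel_measurable M" "integrable M (\<lambda>x. f x * f x)"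
  shows "f \<in> L2 M"
  using assms by (simp add: L2_def power2_eq_square)

lemma L2_bound:
  assumes "g \<in> L2 M" "f \<in> borel_measurable M" "\<And>x. \<bar>f x\<bar> \<le> \<bar>g x\<bar>"
  shows "f \<in> L2 M"
proof -
  have "integrable M (\<lambda>x. (f x)\<^sup>2)"
  proof (rule Bochner_Integration.integrable_bound)
    show "integrable M (\<lambda>x. (g x)\<^sup>2)" using assms by (simp add: L2_def)
    show "(\<lambda>x. (f x)\<^sup>2) \<in> borel_measurable M" using assms by auto
    show "AE x in M. norm ((f x)\<^sup>2) \<le> norm ((g x)\<^sup>2)"
      using assms(3) by (auto simp: abs_le_square_iff)
  qed
  then show ?thesis using assms by (simp add: L2_def)
qed

lemma L2_zero [simp]: "(\<lambda>x. 0) \<in> L2 M"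
  by (simp add: L2_def)

lemma L2_add:
  assumes "f \<in> L2 M" "g \<in> L2 M"
  shows "(\<lambda>x. f x + g x) \<in> L2 M"
proof (rule L2I)
  have "integrable M (\<lambda>x. (f x * f x + f x * g x) + (g x * f x + g x * g x))"
    using assms by (intro Bochner_Integration.integrable_add L2_integrable_mult)
  then show "integrable M (\<lambda>x. (f x + g x) * (f x + g x))"
    by (simp add: algebra_simps)
qed (use assms in \<open>auto simp: L2_def\<close>)

lemma L2_scale:
  assumes "f \<in> L2 M"
  shows "(\<lambda>x. c * f x) \<in> L2 M"
  using assms by (auto simp: L2_def power_mult_distrib)

lemma L2_diff:
  assumes "f \<in> L2 M" "g \<in> L2 M"
  shows "(\<lambda>x. f x - g x) \<in> L2 M"
  using L2_add[OF assms(1) L2_scale[OF assms(2), of "-1"]] by simp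

lemma L2_sum:
  assumes "\<And>i. i \<in> I \<Longrightarrow> f i \<in> L2 M"
  shows "(\<lambda>x. \<Sum>i\<in>I. f i x) \<in> L2 M"
  using assms by (induction I rule: infinite_finite_induct) (auto intro!: L2_add)

lemma L2_abs: "f \<in> L2 M \<Longrightarrow> (\<lambda>x. \<bar>f x\<bar>) \<in> L2 M"
  by (rule L2_bound) (auto simp: L2_def)

lemma L2_inner_commute: "L2_inner M f g = L2_inner M g f"
  by (simp add: L2_inner_def mult.commute)

lemma L2_inner_add_left:
  assumes "f \<in> L2 M" "g \<in> L2 M" "h \<in> L2 M"
  shows "L2_inner M (\<lambda>x. f x + g x) h = L2_inner M f h + L2_inner M g h"
  using L2_integrable_mult[OF assms(1,3)] L2_integrable_mult[OF assms(2,3)]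
  by (simp add: L2_inner_def distrib_right)

lemma L2_inner_scale_left: "L2_inner M (\<lambda>x. c * f x) h = c * L2_inner M f h"
  by (simp add: L2_inner_def mult.assoc)

lemma L2_inner_diff_left:
  assumes "f \<in> L2 M" "g \<in> L2 M" "h \<in> L2 M"
  shows "L2_inner M (\<lambda>x. f x - g x) h = L2_inner M f h - L2_inner M g h"
  using L2_integrable_mult[OF assms(1,3)] L2_integrable_mult[OF assms(2,3)]
  by (simp add: L2_inner_def left_diff_distrib)

lemma L2_inner_sum_left:
  assumes "\<And>i. i \<in> I \<Longrightarrow> f i \<in> L2 M" "h \<in> L2 M"
  shows "L2_inner M (\<lambda>x. \<Sum>i\<in>I. f i x) h = (\<Sum>i\<in>I. L2_inner M (f i) h)"
  unfolding L2_inner_def sum_distrib_right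
  by (rule Bochner_Integration.integral_sum) (use assms L2_integrable_mult in auto)

lemma L2_inner_scale_right: "L2_inner M f (\<lambda>x. c * h x) = c * L2_inner M f h"
  by (metis L2_inner_commute L2_inner_scale_left)

lemma L2_inner_add_right:
  assumes "f \<in> L2 M" "g \<in> L2 M" "h \<in> L2 M"
  shows "L2_inner M h (\<lambda>x. f x + g x) = L2_inner M h f + L2_inner M h g"
  using L2_inner_add_left[OF assms] by (simp add: L2_inner_commute)

lemma L2_inner_diff_right:
  assumes "f \<in> L2 M" "g \<in> L2 M" "h \<in> L2 M"
  shows "L2_inner M h (\<lambda>x. f x - g x) = L2_inner M h f - L2_inner M h g"
  using L2_inner_diff_left[OF assms] by (simp add: L2_inner_commute)

lemma L2_inner_sum_right:
  assumes "\<And>i. i \<in> I \<Longrightarrow> f i \<in> L2 M" "h \<in> L2 M"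
  shows "L2_inner M h (\<lambda>x. \<Sum>i\<in>I. f i x) = (\<Sum>i\<in>I. L2_inner M h (f i))"
  using L2_inner_sum_left[of I f M h] assms by (simp add: L2_inner_commute)

lemma L2_inner_cong_AE:
  assumes "AE x in M. f x = f' x" "AE x in M. g x = g' x"
    and "f \<in> borel_measurable M" "f' \<in> borel_measurable M"
    and "g \<in> borel_measurable M" "g' \<in> borel_measurable M"
  shows "L2_inner M f g = L2_inner M f' g'"
  unfolding L2_inner_def using assms by (intro integral_cong_AE) auto

lemma L2_inner_nonneg: "L2_inner M f f \<ge> 0"
  by (simp add: L2_inner_def)

lemma L2_norm_power2: "(L2_norm M f)\<^sup>2 = L2_inner M f f"
  by (simp add: L2_norm_def L2_inner_nonneg)

lemma L2_norm_nonneg [simp]: "L2_norm M f \<ge> 0"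
  by (simp add: L2_norm_def L2_inner_nonneg)

lemma L2_inner_eq_0_iff:
  assumes "f \<in> L2 M"
  shows "L2_inner M f f = 0 \<longleftrightarrow> (AE x in M. f x = 0)"
  unfolding L2_inner_def using L2_integrable_mult[OF assms assms]
  by (subst integral_nonneg_eq_0_iff_AE) auto

lemma L2_Cauchy_Schwarz:
  assumes f: "f \<in> L2 M" and g: "g \<in> L2 M"
  shows "\<bar>L2_inner M f g\<bar> \<le> L2_norm M f * L2_norm M g"
proof -
  define a b c where "a = L2_inner M f f" "b = L2_inner M f g" "c = L2_inner M g g"
  have q: "0 \<le> s\<^sup>2 * a - 2 * s * t * b + t\<^sup>2 * c" for s t
  proof -
    have "0 \<le> L2_inner M (\<lambda>x. s * f x - t * g x) (\<lambda>x. s * f x - t * g x)"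
      by (rule L2_inner_nonneg)
    also have "\<dots> = s\<^sup>2 * a - 2 * s * t * b + t\<^sup>2 * c"
      using f g by (simp add: L2_inner_diff_left L2_inner_diff_right L2_inner_scale_left
        L2_inner_scale_right L2_scale L2_diff a_b_c_def L2_inner_commute[of M g f]
        algebra_simps power2_eq_square)
    finally show ?thesis .
  qed
  have a0: "a \<ge> 0" and c0: "c \<ge> 0" by (simp_all add: a_b_c_def L2_inner_nonneg)
  have "b\<^sup>2 \<le> a * c"
  proof (cases "c = 0")
    case True
    show ?thesis
    proof (rule ccontr)
      assume "\<not> b\<^sup>2 \<le> a * c"
      then have "b \<noteq> 0" using True by auto
      \<comment> \<open>With c = 0 and s = 1 the form is a - 2 t b, and this t makes it equal to
        -1.\<close>
      have "0 \<le> a - 2 * ((a + 1) / (2 * b)) * b"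
        using q[of 1 "(a + 1) / (2 * b)"] True by simp
      then show False using \<open>b \<noteq> 0\<close> by simp
    qed
  next
    case False
    then have "c > 0" using c0 by simp
    have "0 \<le> c * (a * c - b\<^sup>2)"
      using q[of c b] by (simp add: algebra_simps power2_eq_square)
    then show ?thesis using \<open>c > 0\<close> by (simp add: zero_le_mult_iff)
  qed
  then have "\<bar>b\<bar> \<le> sqrt (a * c)"
    by (simp add: real_le_rsqrt)
  then show ?thesis by (simp add: a_b_c_def L2_norm_def real_sqrt_mult)
qed

lemma L2_norm_triangle:
  assumes f: "f \<in> L2 M" and g: "g \<in> L2 M"
  shows "L2_norm M (\<lambda>x. f x + g x) \<le> L2_norm M f + L2_norm M g"
proof (rule power2_le_imp_le)
  have "(L2_norm M (\<lambda>x. f x + g x))\<^sup>2 =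
      (L2_norm M f)\<^sup>2 + 2 * L2_inner M f g + (L2_norm M g)\<^sup>2"
    using f g by (simp add: L2_norm_power2 L2_inner_add_left L2_inner_add_right L2_add
      L2_inner_commute[of M g f])
  also have "\<dots> \<le> (L2_norm M f + L2_norm M g)\<^sup>2"
    using L2_Cauchy_Schwarz[OF f g] by (simp add: power2_sum)
  finally show "(L2_norm M (\<lambda>x. f x + g x))\<^sup>2 \<le> (L2_norm M f + L2_norm M g)\<^sup>2" .
qed simp

lemma L2_norm_scale: "L2_norm M (\<lambda>x. c * f x) = \<bar>c\<bar> * L2_norm M f"
  by (simp add: L2_norm_def L2_inner_scale_left L2_inner_scale_right real_sqrt_mult
      flip: mult.assoc power2_eq_square)

lemma L2_norm_zero [simp]: "L2_norm M (\<lambda>x. 0) = 0"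
  by (simp add: L2_norm_def L2_inner_def)

lemma L2_norm_minus_commute: "L2_norm M (\<lambda>x. f x - g x) = L2_norm M (\<lambda>x. g x - f x)"
  using L2_norm_scale[of M "-1" "\<lambda>x. f x - g x"] by simp

lemma L2_norm_triangle_diff:
  assumes "f \<in> L2 M" "g \<in> L2 M" "h \<in> L2 M"
  shows "L2_norm M (\<lambda>x. f x - h x) \<le> L2_norm M (\<lambda>x. f x - g x) + L2_norm M (\<lambda>x. g x - h x)"
  using L2_norm_triangle[OF L2_diff[OF assms(1,2)] L2_diff[OF assms(2,3)]] by simp

lemma L2_norm_sum:
  assumes "\<And>i. i \<in> I \<Longrightarrow> f i \<in> L2 M"
  shows "L2_norm M (\<lambda>x. \<Sum>i\<in>I. f i x) \<le> (\<Sum>i\<in>I. L2_norm M (f i))"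
  using assms
proof (induction I rule: infinite_finite_induct)
  case (insert i I)
  have "L2_norm M (\<lambda>x. f i x + (\<Sum>i\<in>I. f i x)) \<le> L2_norm M (f i) + L2_norm M (\<lambda>x. \<Sum>i\<in>I. f i x)"
    using insert by (intro L2_norm_triangle L2_sum) auto
  then show ?case using insert by simp
qed auto

lemma L2_norm_mono:
  assumes "g \<in> L2 M" "f \<in> L2 M" "\<And>x. x \<in> space M \<Longrightarrow> \<bar>f x\<bar> \<le> \<bar>g x\<bar>"
  shows "L2_norm M f \<le> L2_norm M g"
  unfolding L2_norm_def L2_inner_def
proof (intro real_sqrt_le_mono integral_mono L2_integrable_mult assms)
  fix x assume "x \<in> space M"
  then have "(f x)\<^sup>2 \<le> (g x)\<^sup>2" using assms(3) by (simp add: abs_le_square_iff)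
  then show "f x * f x \<le> g x * g x" by (simp add: power2_eq_square)
qed

lemma L2_norm_cong_AE:
  assumes "AE x in M. f x = g x" "f \<in> borel_measurable M" "g \<in> borel_measurable M"
  shows "L2_norm M f = L2_norm M g"
  unfolding L2_norm_def using assms L2_inner_cong_AE by metis

section \<open>Composition with measure-preserving maps\<close>

definition measure_preserving :: "'x measure \<Rightarrow> ('x \<Rightarrow> 'x) \<Rightarrow> bool" where
  "measure_preserving M t \<longleftrightarrow> t \<in> measurable M M \<and> distr M M t = M"

lemma measure_preserving_integral:
  fixes f :: "'x \<Rightarrow> real"
  assumes "measure_preserving M t" "f \<in> borel_measurable M"
  shows "(LINT x|M. f (t x)) = (LINT x|M. f x)"
  using integral_distr[of t M M f] assms by (simp add: measure_preserving_def)

lemma measure_preserving_integrable: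
  fixes f :: "'x \<Rightarrow> real"
  assumes "measure_preserving M t" "f \<in> borel_measurable M"
  shows "integrable M (\<lambda>x. f (t x)) = integrable M f"
  using integrable_distr_eq[of t M M f] assms by (simp add: measure_preserving_def)

lemma measure_preserving_borel:
  fixes f :: "'x \<Rightarrow> real"
  assumes "measure_preserving M t" "f \<in> borel_measurable M"
  shows "(\<lambda>x. f (t x)) \<in> borel_measurable M"
  using assms by (auto simp: measure_preserving_def)

lemma L2_compose:
  assumes "measure_preserving M t" "f \<in> L2 M"
  shows "(\<lambda>x. f (t x)) \<in> L2 M"
proof -
  have "(\<lambda>x. (f x)\<^sup>2) \<in> borel_measurable M"
    using assms(2) by (auto simp: L2_def)
  from measure_preserving_integrable[OF assms(1) this] show ?thesis
    using assms(2) measure_preserving_borel[OF assms(1), of f] by (simp add: L2_def)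
qed

lemma L2_inner_compose:
  assumes "measure_preserving M t" "f \<in> L2 M" "g \<in> L2 M"
  shows "L2_inner M (\<lambda>x. f (t x)) (\<lambda>x. g (t x)) = L2_inner M f g"
  unfolding L2_inner_def
  by (rule measure_preserving_integral[OF assms(1)]) (use assms in \<open>auto simp: L2_def\<close>)

lemma L2_norm_compose:
  assumes "measure_preserving M t" "f \<in> L2 M"
  shows "L2_norm M (\<lambda>x. f (t x)) = L2_norm M f"
  using L2_inner_compose[OF assms(1,2,2)] by (simp add: L2_norm_def)

section \<open>Lazy averages over a symmetric family of maps\<close>

text \<open>Common frame for three walks: S acting on X, S translating cosets with counting measure,
  and generators T of a subgroup acting on X. The family is indexed, since distinct group elements
  may act by the same map, and inverses are demanded only almost everywhere, as for the
  action.\<close>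

locale symmetric_family =
  fixes M :: "'x measure" and I :: "'i set" and \<tau> :: "'i \<Rightarrow> 'x \<Rightarrow> 'x" and \<iota> :: "'i \<Rightarrow> 'i"
  assumes finite_I: "finite I" and I_nonempty: "I \<noteq> {}"
    and mp: "i \<in> I \<Longrightarrow> measure_preserving M (\<tau> i)"
    and \<iota>_bij: "bij_betw \<iota> I I"
    and \<iota>_inverse: "i \<in> I \<Longrightarrow> AE x in M. \<tau> (\<iota> i) (\<tau> i x) = x"
begin

definition avg :: "('x \<Rightarrow> real) \<Rightarrow> 'x \<Rightarrow> real" where
  "avg f x = (\<Sum>i\<in>I. f (\<tau> i x)) / card I"

definition lazy :: "('x \<Rightarrow> real) \<Rightarrow> 'x \<Rightarrow> real" where
  "lazy f x = (f x + avg f x) / 2"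

lemma card_I: "real (card I) > 0"
  using finite_I I_nonempty by (simp add: card_gt_0_iff)

lemma compose_L2: "i \<in> I \<Longrightarrow> f \<in> L2 M \<Longrightarrow> (\<lambda>x. f (\<tau> i x)) \<in> L2 M"
  by (rule L2_compose[OF mp])

lemma avg_L2: "f \<in> L2 M \<Longrightarrow> avg f \<in> L2 M"
  using L2_scale[of "\<lambda>x. \<Sum>i\<in>I. f (\<tau> i x)" M "1 / card I"]
  by (simp add: avg_def[abs_def] L2_sum compose_L2)

lemma lazy_eq: "lazy f = (\<lambda>x. (1/2) * f x + (1/2) * avg f x)"
  by (simp add: lazy_def[abs_def] field_simps)

lemma lazy_L2: "f \<in> L2 M \<Longrightarrow> lazy f \<in> L2 M"
  unfolding lazy_eq by (intro L2_add L2_scale avg_L2)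

lemma lazy_pow_L2: "f \<in> L2 M \<Longrightarrow> (lazy ^^ n) f \<in> L2 M"
  by (induction n) (auto intro: lazy_L2)

lemma avg_inner:
  assumes "f \<in> L2 M" "g \<in> L2 M"
  shows "L2_inner M (avg f) g = (\<Sum>i\<in>I. L2_inner M (\<lambda>x. f (\<tau> i x)) g) / card I"
proof -
  have "L2_inner M (avg f) g = L2_inner M (\<lambda>x. (1 / card I) * (\<Sum>i\<in>I. f (\<tau> i x))) g"
    by (simp add: avg_def[abs_def])
  also have "\<dots> = (1 / card I) * (\<Sum>i\<in>I. L2_inner M (\<lambda>x. f (\<tau> i x)) g)"
    using assms by (subst L2_inner_scale_left, subst L2_inner_sum_left) (auto intro: compose_L2)
  finally show ?thesis by simp
qed

text \<open>Writing g as its composition with \<open>\<tau> (\<iota> i)\<close> after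
  \<open>\<tau> i\<close> exhibits \<open>\<tau> i\<close> in both factors, and invariance of the
  measure removes it.\<close>

lemma inner_adjoint:
  assumes "f \<in> L2 M" "g \<in> L2 M" "i \<in> I"
  shows "L2_inner M (\<lambda>x. f (\<tau> i x)) g = L2_inner M f (\<lambda>x. g (\<tau> (\<iota> i) x))"
proof -
  have i: "\<iota> i \<in> I" using \<iota>_bij assms(3) by (auto simp: bij_betw_def)
  have L: "(\<lambda>x. g (\<tau> (\<iota> i) x)) \<in> L2 M" by (rule compose_L2[OF i assms(2)])
  have "L2_inner M (\<lambda>x. f (\<tau> i x)) g = L2_inner M (\<lambda>x. f (\<tau> i x)) (\<lambda>x. g (\<tau> (\<iota> i) (\<tau> i x)))"
  proof (rule L2_inner_cong_AE)
    show "AE x in M. g x = g (\<tau> (\<iota> i) (\<tau> i x))"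
      using \<iota>_inverse[OF assms(3)] by eventually_elim simp
    show "(\<lambda>x. g (\<tau> (\<iota> i) (\<tau> i x))) \<in> borel_measurable M"
      by (rule L2_measurable[OF L2_compose[OF mp[OF assms(3)] L]])
  qed (use assms L in \<open>auto intro: L2_measurable compose_L2\<close>)
  also have "\<dots> = L2_inner M f (\<lambda>x. g (\<tau> (\<iota> i) x))"
    using L2_inner_compose[OF mp[OF assms(3)] assms(1) L] .
  finally show ?thesis .
qed

text \<open>The adjoint of the term of index i is the term of index \<open>\<iota> i\<close>, and
  \<open>\<iota>\<close> only permutes the sum.\<close>

lemma avg_adjoint:
  assumes "f \<in> L2 M" "g \<in> L2 M"
  shows "L2_inner M (avg f) g = L2_inner M f (avg g)"
proof -
  have "(\<Sum>i\<in>I. L2_inner M (\<lambda>x. f (\<tau> i x)) g) = (\<Sum>i\<in>I. L2_inner M (\<lambda>x. g (\<tau> (\<iota> i) x)) f)"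
    using assms by (intro sum.cong refl) (subst inner_adjoint, auto intro: L2_inner_commute)
  also have "\<dots> = (\<Sum>i\<in>I. L2_inner M (\<lambda>x. g (\<tau> i x)) f)"
    using sum.reindex_bij_betw[OF \<iota>_bij, of "\<lambda>i. L2_inner M (\<lambda>x. g (\<tau> i x)) f"] .
  finally show ?thesis
    using assms by (simp add: avg_inner L2_inner_commute[of M f])
qed

lemma lazy_inner:
  assumes "f \<in> L2 M" "g \<in> L2 M"
  shows "L2_inner M (lazy f) g = (L2_inner M f g + L2_inner M (avg f) g) / 2"
proof -
  have "L2_inner M (lazy f) g = 1/2 * L2_inner M f g + 1/2 * L2_inner M (avg f) g"
    unfolding lazy_eq L2_inner_scale_left[symmetric]
    using assms by (intro L2_inner_add_left L2_scale avg_L2)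
  then show ?thesis by simp
qed

lemma lazy_adjoint:
  assumes "f \<in> L2 M" "g \<in> L2 M"
  shows "L2_inner M (lazy f) g = L2_inner M f (lazy g)"
proof -
  have "L2_inner M f (lazy g) = (L2_inner M g f + L2_inner M (avg g) f) / 2"
    using assms by (subst L2_inner_commute, subst lazy_inner) auto
  also have "\<dots> = (L2_inner M f g + L2_inner M (avg f) g) / 2"
    using avg_adjoint[OF assms] L2_inner_commute[of M f g] L2_inner_commute[of M f "avg g"]
    by simp
  finally show ?thesis using assms by (simp add: lazy_inner)
qed

lemma lazy_pow_adjoint:
  assumes "f \<in> L2 M" "g \<in> L2 M"
  shows "L2_inner M ((lazy ^^ n) f) g = L2_inner M f ((lazy ^^ n) g)"
  using assms
proof (induction n arbitrary: g)
  case (Suc n)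
  have "L2_inner M ((lazy ^^ Suc n) f) g = L2_inner M ((lazy ^^ n) f) (lazy g)"
    using Suc by (simp add: lazy_adjoint lazy_pow_L2)
  also have "\<dots> = L2_inner M f ((lazy ^^ n) (lazy g))"
    using Suc by (simp add: lazy_L2)
  finally show ?case by (simp add: funpow_swap1)
qed simp

lemma avg_contraction:
  assumes "f \<in> L2 M"
  shows "L2_norm M (avg f) \<le> L2_norm M f"
proof -
  have "L2_norm M (avg f) = L2_norm M (\<lambda>x. \<Sum>i\<in>I. f (\<tau> i x)) / card I"
    using L2_norm_scale[of M "1 / card I" "\<lambda>x. \<Sum>i\<in>I. f (\<tau> i x)"]
    by (simp add: avg_def[abs_def])
  also have "\<dots> \<le> (\<Sum>i\<in>I. L2_norm M (\<lambda>x. f (\<tau> i x))) / card I"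
    using assms by (intro divide_right_mono L2_norm_sum) (auto intro: compose_L2)
  also have "\<dots> = L2_norm M f"
    using assms card_I by (simp add: L2_norm_compose mp)
  finally show ?thesis .
qed

text \<open>With A = avg and L = lazy, L - L^2 = (I - A^2)/4, which is positive because A is a
  self-adjoint contraction. Positivity, contraction and the displacement bounds for L all come from
  this inequality.\<close>

lemma lazy_norm_le_inner:
  assumes "f \<in> L2 M"
  shows "(L2_norm M (lazy f))\<^sup>2 \<le> L2_inner M (lazy f) f"
proof -
  have a: "L2_inner M (avg f) (avg f) \<le> L2_inner M f f"
    using avg_contraction[OF assms] unfolding L2_norm_def by (simp only: real_sqrt_le_iff)
  have "L2_inner M (lazy f) (lazy f) = (L2_inner M (lazy f) f + L2_inner M (lazy f) (avg f)) / 2"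
    using lazy_inner[OF assms lazy_L2[OF assms]]
    by (simp add: L2_inner_commute[of M f "lazy f"] L2_inner_commute[of M "avg f" "lazy f"])
  moreover have "L2_inner M (lazy f) (avg f) = (L2_inner M (avg f) f + L2_inner M (avg f) (avg f)) / 2"
    using lazy_inner[OF assms avg_L2[OF assms]] by (simp add: L2_inner_commute[of M f "avg f"])
  ultimately show ?thesis
    using a lazy_inner[OF assms assms] unfolding L2_norm_power2 by argo
qed

lemma lazy_inner_nonneg: "f \<in> L2 M \<Longrightarrow> L2_inner M (lazy f) f \<ge> 0"
  using lazy_norm_le_inner[of f] by (meson order_trans zero_le_power2)

lemma lazy_contraction:
  assumes "f \<in> L2 M"
  shows "L2_norm M (lazy f) \<le> L2_norm M f"
proof (cases "L2_norm M (lazy f) = 0")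
  case False
  have "L2_norm M (lazy f) * L2_norm M (lazy f) \<le> L2_norm M (lazy f) * L2_norm M f"
    using lazy_norm_le_inner[OF assms] L2_Cauchy_Schwarz[OF lazy_L2[OF assms] assms]
    by (simp add: power2_eq_square)
  then show ?thesis using False by (simp add: mult_le_cancel_left less_le)
qed simp

lemma lazy_pow_contraction:
  assumes "f \<in> L2 M"
  shows "L2_norm M ((lazy ^^ n) f) \<le> L2_norm M f"
proof (induction n)
  case (Suc n)
  then show ?case
    using lazy_contraction[OF lazy_pow_L2[OF assms, of n]] by simp
qed simp

text \<open>The squared displacements under all j in I add up to 2 card I <f - avg f, f>, and I -
  avg = 2 (I - lazy). A quadratic form close to its maximum thus forces almost invariance under
  every single map.\<close>

lemma displacement_le:
  assumes f: "f \<in> L2 M" and i: "i \<in> I"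
  shows "(L2_norm M (\<lambda>x. f (\<tau> i x) - f x))\<^sup>2
    \<le> 4 * card I * ((L2_norm M f)\<^sup>2 - L2_inner M (lazy f) f)"
proof -
  have d: "(L2_norm M (\<lambda>x. f (\<tau> j x) - f x))\<^sup>2
      = 2 * (L2_inner M f f - L2_inner M (\<lambda>x. f (\<tau> j x)) f)" if "j \<in> I" for j
    using f L2_compose[OF mp[OF that] f] L2_inner_compose[OF mp[OF that] f f]
    by (simp add: L2_norm_power2 L2_inner_diff_left L2_inner_diff_right L2_diff
        L2_inner_commute[of M f "\<lambda>x. f (\<tau> j x)"])
  have "(L2_norm M (\<lambda>x. f (\<tau> i x) - f x))\<^sup>2 \<le> (\<Sum>j\<in>I. (L2_norm M (\<lambda>x. f (\<tau> j x) - f x))\<^sup>2)"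
    using i finite_I by (intro member_le_sum) auto
  also have "\<dots> = 2 * (card I * L2_inner M f f - card I * L2_inner M (avg f) f)"
    using f card_I by (simp add: d avg_inner sum_subtractf flip: sum_distrib_left)
  also have "\<dots> = 4 * card I * ((L2_norm M f)\<^sup>2 - L2_inner M (lazy f) f)"
    using f by (simp add: L2_norm_power2 lazy_inner field_simps)
  finally show ?thesis .
qed

text \<open>After expanding the square, the term |lazy f|^2 is absorbed by
  \<open>lazy_norm_le_inner\<close>.\<close>

lemma lazy_displacement:
  assumes f: "f \<in> L2 M"
  shows "(L2_norm M (\<lambda>x. lazy f x - f x))\<^sup>2 \<le> (L2_norm M f)\<^sup>2 - L2_inner M (lazy f) f"
proof -
  have "(L2_norm M (\<lambda>x. lazy f x - f x))\<^sup>2 =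
      (L2_norm M (lazy f))\<^sup>2 - 2 * L2_inner M (lazy f) f + (L2_norm M f)\<^sup>2"
    using f by (simp add: L2_norm_power2 L2_inner_diff_left L2_inner_diff_right L2_diff lazy_L2
        L2_inner_commute[of M f "lazy f"])
  then show ?thesis using lazy_norm_le_inner[OF f] by simp
qed

lemma avg_diff: "avg (\<lambda>x. f x - g x) = (\<lambda>x. avg f x - avg g x)"
  by (auto simp: avg_def[abs_def] sum_subtractf diff_divide_distrib)

lemma lazy_diff: "lazy (\<lambda>x. f x - g x) = (\<lambda>x. lazy f x - lazy g x)"
  by (auto simp: lazy_def[abs_def] avg_diff field_simps)

lemma lazy_scale: "lazy (\<lambda>x. c * f x) = (\<lambda>x. c * lazy f x)"
  by (auto simp: lazy_def[abs_def] avg_def field_simps sum_distrib_left)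

lemma lazy_const: "lazy (\<lambda>x. c) = (\<lambda>x. c)"
  using card_I by (auto simp: lazy_def[abs_def] avg_def)

lemma lazy_pow_const: "(lazy ^^ n) (\<lambda>x. c) = (\<lambda>x. c)"
  by (induction n) (simp_all add: lazy_const)

text \<open>Pairing with the constant 1, which the self-adjoint operator fixes, shows that the
  integral does not change.\<close>

lemma lazy_L2_0:
  assumes "finite_measure M" "f \<in> L2_0 M"
  shows "lazy f \<in> L2_0 M"
proof -
  interpret finite_measure M by fact
  have f: "f \<in> L2 M" "(LINT x|M. f x) = 0" using assms by (auto simp: L2_0_def)
  have "L2_inner M (lazy f) (\<lambda>x. 1) = L2_inner M f (lazy (\<lambda>x. 1))"
    by (rule lazy_adjoint[OF f(1)]) (simp add: L2_def)
  then have "(LINT x|M. lazy f x) = 0" using f by (simp add: lazy_const L2_inner_def)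
  then show ?thesis using lazy_L2[OF f(1)] by (simp add: L2_0_def)
qed

lemma lazy_pow_diff: "(lazy ^^ n) (\<lambda>x. f x - g x) = (\<lambda>x. (lazy ^^ n) f x - (lazy ^^ n) g x)"
  by (induction n) (auto simp: lazy_diff)

text \<open>Telescoping over the powers; each increment is at most the first one since
  \<open>lazy\<close> contracts. The factor n does not depend on f, so n can be fixed before the
  displacement is made small.\<close>

lemma lazy_pow_displacement:
  assumes f: "f \<in> L2 M"
  shows "L2_norm M (\<lambda>x. (lazy ^^ n) f x - f x) \<le> n * L2_norm M (\<lambda>x. lazy f x - f x)"
proof (induction n)
  case (Suc n)
  have "L2_norm M (\<lambda>x. (lazy ^^ Suc n) f x - f x) \<le>
      L2_norm M (\<lambda>x. (lazy ^^ n) (lazy f) x - (lazy ^^ n) f x) + L2_norm M (\<lambda>x. (lazy ^^ n) f x - f x)"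
    unfolding funpow_Suc_right o_apply
    using f by (intro L2_norm_triangle_diff lazy_pow_L2 lazy_L2)
  also have "L2_norm M (\<lambda>x. (lazy ^^ n) (lazy f) x - (lazy ^^ n) f x)
      \<le> L2_norm M (\<lambda>x. lazy f x - f x)"
    using lazy_pow_contraction[of "\<lambda>x. lazy f x - f x" n] f
    by (simp add: lazy_pow_diff L2_diff lazy_L2)
  finally show ?case using Suc by (simp add: algebra_simps)
qed (simp add: )

text \<open>Cauchy--Schwarz for the positive form \<^term>\<open>\<lambda>f g. L2_inner M (lazy f) g\<close> turns a bound of
  the quadratic form into a bound of the operator norm; this is why the walk is made lazy.\<close>

lemma lazy_norm_le:
  assumes f: "f \<in> L2 M" and q: "q \<ge> 0"
    and 1: "L2_inner M (lazy f) f \<le> q * (L2_norm M f)\<^sup>2"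
    and 2: "L2_inner M (lazy (lazy f)) (lazy f) \<le> q * (L2_norm M (lazy f))\<^sup>2"
  shows "L2_norm M (lazy f) \<le> q * L2_norm M f"
proof -
  define a b c where "a = L2_inner M (lazy f) f" "b = L2_inner M (lazy f) (lazy f)"
    "c = L2_inner M (lazy (lazy f)) (lazy f)"
  have quad: "0 \<le> s\<^sup>2 * a - 2 * s * t * b + t\<^sup>2 * c" for s t
  proof -
    let ?h = "\<lambda>x. s * f x - t * lazy f x"
    have h: "?h \<in> L2 M" using f by (intro L2_diff L2_scale lazy_L2)
    have "0 \<le> L2_inner M (lazy ?h) ?h" by (rule lazy_inner_nonneg[OF h])
    also have "\<dots> = s\<^sup>2 * a - s * t * L2_inner M (lazy f) (lazy f)
        - s * t * L2_inner M (lazy (lazy f)) f + t\<^sup>2 * c"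
      using f by (simp add: lazy_diff lazy_scale L2_inner_diff_left L2_inner_diff_right L2_inner_scale_left
        L2_inner_scale_right L2_scale L2_diff lazy_L2 a_b_c_def algebra_simps power2_eq_square)
    also have "L2_inner M (lazy (lazy f)) f = b"
      using f by (simp add: a_b_c_def lazy_adjoint[of "lazy f" f] lazy_L2)
    finally show ?thesis by (simp add: a_b_c_def algebra_simps)
  qed
  have b0: "b \<ge> 0" and n0: "(L2_norm M f)\<^sup>2 \<ge> 0" by (simp_all add: a_b_c_def L2_inner_nonneg)
  have "b \<le> q\<^sup>2 * (L2_norm M f)\<^sup>2"
  proof (cases "q = 0")
    \<comment> \<open>The other case divides by q; for q = 0 the bound of the form already makes
      \<open>lazy f\<close> vanish in L2.\<close>
    case True
    have "(L2_norm M (lazy f))\<^sup>2 \<le> 0"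
      using lazy_norm_le_inner[OF f] 1 unfolding True by linarith
    then have "b \<le> 0" unfolding a_b_c_def L2_norm_power2 .
    then show ?thesis using True by simp
  next
    case False
    then have "q > 0" using q by simp
    \<comment> \<open>At s = q, t = 1 the hypotheses bound a by q |f|^2 and c by q b, so one of the
      two terms q b cancels.\<close>
    have "0 \<le> q\<^sup>2 * a - 2 * q * b + c" using quad[of q 1] by simp
    also have "\<dots> \<le> q\<^sup>2 * (q * (L2_norm M f)\<^sup>2) - 2 * q * b + q * b"
      using mult_left_mono[OF 1, of "q\<^sup>2"] 2[unfolded L2_norm_power2[of M "lazy f"]]
      by (simp add: a_b_c_def)
    finally have "q * b \<le> q * (q\<^sup>2 * (L2_norm M f)\<^sup>2)"
      by (simp add: algebra_simps)
    then show ?thesis using \<open>q > 0\<close> by simp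
  qed
  then have "(L2_norm M (lazy f))\<^sup>2 \<le> (q * L2_norm M f)\<^sup>2"
    by (simp add: a_b_c_def L2_norm_power2 power_mult_distrib)
  then show ?thesis by (rule power2_le_imp_le) (use q in auto)
qed

text \<open>Doubling replaces the spectral theorem: <L^(2k) f, f> = |L^k f|^2, and Cauchy-Schwarz
  bounds this below by <L^k f, f>^2 / |f|^2. Hence only exponents that are powers of two
  occur.\<close>

lemma lazy_pow_inner_lower:
  assumes f: "f \<in> L2 M" and q: "q \<ge> 0" and 1: "L2_inner M (lazy f) f \<ge> q * (L2_norm M f)\<^sup>2"
  shows "L2_inner M ((lazy ^^ (2 ^ m)) f) f \<ge> q ^ (2 ^ m) * (L2_norm M f)\<^sup>2"
proof (induction m)
  case 0
  then show ?case using 1 by simp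
next
  case (Suc m)
  let ?k = "2 ^ m :: nat"
  let ?g = "(lazy ^^ ?k) f"
  have g: "?g \<in> L2 M" by (rule lazy_pow_L2[OF f])
  have e: "L2_inner M ((lazy ^^ (2 ^ Suc m)) f) f = (L2_norm M ?g)\<^sup>2"
  proof -
    have "(lazy ^^ (2 ^ Suc m)) f = (lazy ^^ ?k) ?g"
      by (simp add: mult_2 funpow_add)
    then show ?thesis using lazy_pow_adjoint[OF g f, of ?k] by (simp add: L2_norm_power2)
  qed
  show ?case
  proof (cases "L2_norm M f = 0")
    case True
    then show ?thesis unfolding e by simp
  next
    case False
    then have n: "L2_norm M f > 0" by (simp add: less_le)
    have "q ^ ?k * (L2_norm M f)\<^sup>2 \<le> L2_norm M ?g * L2_norm M f"
      using Suc L2_Cauchy_Schwarz[OF g f] by linarith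
    then have "q ^ ?k * L2_norm M f \<le> L2_norm M ?g"
      using n by (simp add: power2_eq_square)
    then have "(q ^ ?k * L2_norm M f)\<^sup>2 \<le> (L2_norm M ?g)\<^sup>2"
      using q n by (intro power_mono) auto
    then show ?thesis unfolding e
      by (simp add: power_mult_distrib flip: power_mult)  (simp add: mult.commute)
  qed
qed

end

section \<open>Measure-preserving group actions\<close>

text \<open>Every element is the product of a word in T and the inverses of T. Countability serves
  to discard null sets for a whole subgroup at once and to enumerate cosets.\<close>

lemma (in group) countable_generate:
  assumes "countable T" "T \<subseteq> carrier G"
  shows "countable (generate G T)"
proof -
  have "generate G T \<subseteq> (\<lambda>l. foldr (\<otimes>) l \<one>) ` lists (T \<union> m_inv G ` T)"
  proof
    fix h assume "h \<in> generate G T"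
    then show "h \<in> (\<lambda>l. foldr (\<otimes>) l \<one>) ` lists (T \<union> m_inv G ` T)"
    proof induction
      case one
      show ?case by (rule image_eqI[of _ _ "[]"]) auto
    next
      case (incl h)
      then show ?case using assms by (intro image_eqI[of _ _ "[h]"]) auto
    next
      case (inv h)
      then show ?case using assms by (intro image_eqI[of _ _ "[inv h]"]) auto
    next
      case (eng h1 h2)
      then obtain l1 l2 where l: "l1 \<in> lists (T \<union> m_inv G ` T)" "h1 = foldr (\<otimes>) l1 \<one>"
        "l2 \<in> lists (T \<union> m_inv G ` T)" "h2 = foldr (\<otimes>) l2 \<one>" by auto
      have c: "foldr (\<otimes>) l \<one> \<in> carrier G" if "l \<in> lists (T \<union> m_inv G ` T)" for l
        using that by (induction l) (use assms in auto)
      have "foldr (\<otimes>) (l1 @ l2) \<one> = h1 \<otimes> h2"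
        unfolding l(2) using l(1)
      proof (induction l1)
        case Nil
        then show ?case using l c by auto
      next
        case (Cons a l1)
        then show ?case using assms c[of l1] c[OF l(3)] l(4) by (auto simp: m_assoc)
      qed
      then show ?case using l by (intro image_eqI[of _ _ "l1 @ l2"]) auto
    qed
  qed
  moreover have "countable (lists (T \<union> m_inv G ` T))"
    using assms by auto
  ultimately show ?thesis by (meson countable_image countable_subset)
qed

locale pmp_group_action = group G + prob_space M
  for G :: "('g, 'r) monoid_scheme" (structure) and M :: "'x measure" +
  fixes \<phi> :: "'g \<Rightarrow> 'x \<Rightarrow> 'x"
  assumes action: "pmp_action G M \<phi>"
begin

lemma action_bij: "g \<in> carrier G \<Longrightarrow> bij_betw (\<phi> g) (space M) (space M)"
  using action by (auto simp: pmp_action_def Aut_def)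

lemma action_space: "g \<in> carrier G \<Longrightarrow> x \<in> space M \<Longrightarrow> \<phi> g x \<in> space M"
  using action_bij by (auto simp: bij_betw_def)

lemma action_mp: "g \<in> carrier G \<Longrightarrow> measure_preserving M (\<phi> g)"
  using action by (auto simp: pmp_action_def Aut_def measure_preserving_def)

lemma action_mult:
  "g \<in> carrier G \<Longrightarrow> h \<in> carrier G \<Longrightarrow> AE x in M. \<phi> (g \<otimes> h) x = \<phi> h (\<phi> g x)"
  using action by (auto simp: pmp_action_def)

text \<open>Almost everywhere, applying \<open>\<phi> \<one>\<close> to
  \<open>\<phi> \<one> x\<close> changes nothing; injectivity cancels one application.\<close>

lemma action_one: "AE x in M. \<phi> \<one> x = x"
  using action_mult[OF one_closed one_closed] AE_space
proof eventually_elim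
  case (elim x)
  have "inj_on (\<phi> \<one>) (space M)" using action_bij[OF one_closed] by (simp add: bij_betw_def)
  from inj_onD[OF this] show ?case
    using elim action_space[OF one_closed elim(2)] by simp
qed

lemma action_inv:
  assumes "g \<in> carrier G"
  shows "AE x in M. \<phi> (inv g) (\<phi> g x) = x"
  using action_mult[OF assms inv_closed[OF assms]] action_one
  by eventually_elim (simp add: assms)

lemma const_L2: "(\<lambda>x. c) \<in> L2 M"
  by (simp add: L2_def)

lemma integral_square_le:
  assumes "f \<in> L2 M"
  shows "(LINT x|M. f x)\<^sup>2 \<le> (L2_norm M f)\<^sup>2"
proof -
  have "\<bar>LINT x|M. f x\<bar> \<le> L2_norm M f"
    using L2_Cauchy_Schwarz[OF assms const_L2, of 1]
    by (simp add: L2_norm_def L2_inner_def prob_space)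
  then show ?thesis using abs_le_square_iff by force
qed

lemma L2_integrable: "f \<in> L2 M \<Longrightarrow> integrable M f"
  using L2_integrable_mult[OF _ const_L2[of 1]] by simp

lemma compose_L2: "g \<in> carrier G \<Longrightarrow> f \<in> L2 M \<Longrightarrow> (\<lambda>x. f (\<phi> g x)) \<in> L2 M"
  by (rule L2_compose[OF action_mp])

text \<open>Measures the failure of f to be invariant under g. For square integrable f it ignores
  null sets, is unchanged under inversion of g and subadditive under products, like a length on the
  group.\<close>

definition disp :: "'g \<Rightarrow> ('x \<Rightarrow> real) \<Rightarrow> real" where
  "disp g f = L2_norm M (\<lambda>x. f (\<phi> g x) - f x)"

lemma disp_nonneg: "disp g f \<ge> 0"
  by (simp add: disp_def)

lemma disp_compose:
  assumes g: "g \<in> carrier G" and t: "measure_preserving M t" and f: "f \<in> L2 M"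
  shows "L2_norm M (\<lambda>x. f (\<phi> g (t x)) - f (t x)) = disp g f"
  using L2_norm_compose[OF t L2_diff[OF compose_L2[OF g f] f]] by (simp add: disp_def)

lemma disp_one:
  assumes "f \<in> L2 M"
  shows "disp \<one> f = 0"
proof -
  have "disp \<one> f = L2_norm M (\<lambda>x. 0)"
    unfolding disp_def
  proof (rule L2_norm_cong_AE)
    show "AE x in M. f (\<phi> \<one> x) - f x = 0" using action_one by eventually_elim simp
  qed (use assms in \<open>auto intro!: L2_measurable L2_diff compose_L2\<close>)
  then show ?thesis by simp
qed

lemma disp_mult:
  assumes g: "g \<in> carrier G" and h: "h \<in> carrier G" and f: "f \<in> L2 M"
  shows "disp (g \<otimes> h) f \<le> disp g f + disp h f"
proof -
  have hg: "(\<lambda>x. f (\<phi> h (\<phi> g x))) \<in> L2 M"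
    using compose_L2[OF g compose_L2[OF h f]] .
  have "disp (g \<otimes> h) f = L2_norm M (\<lambda>x. f (\<phi> h (\<phi> g x)) - f x)"
    unfolding disp_def
  proof (rule L2_norm_cong_AE)
    show "AE x in M. f (\<phi> (g \<otimes> h) x) - f x = f (\<phi> h (\<phi> g x)) - f x"
      using action_mult[OF g h] by eventually_elim simp
  qed (use g h f hg in \<open>auto intro!: L2_measurable L2_diff compose_L2\<close>)
  also have "\<dots> \<le> L2_norm M (\<lambda>x. f (\<phi> h (\<phi> g x)) - f (\<phi> g x)) + disp g f"
    unfolding disp_def by (rule L2_norm_triangle_diff[OF hg compose_L2[OF g f] f])
  also have "\<dots> = disp h f + disp g f"
    using disp_compose[OF h action_mp[OF g] f] by simp
  finally show ?thesis by simp
qed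

lemma disp_inv:
  assumes g: "g \<in> carrier G" and f: "f \<in> L2 M"
  shows "disp (inv g) f = disp g f"
proof -
  have L: "(\<lambda>x. f (\<phi> (inv g) (\<phi> g x))) \<in> L2 M"
    using compose_L2[OF g compose_L2[OF inv_closed[OF g] f]] .
  have "disp (inv g) f = L2_norm M (\<lambda>x. f (\<phi> (inv g) (\<phi> g x)) - f (\<phi> g x))"
    using disp_compose[OF inv_closed[OF g] action_mp[OF g] f] by simp
  also have "\<dots> = L2_norm M (\<lambda>x. f x - f (\<phi> g x))"
  proof (rule L2_norm_cong_AE)
    show "AE x in M. f (\<phi> (inv g) (\<phi> g x)) - f (\<phi> g x) = f x - f (\<phi> g x)"
      using action_inv[OF g] by eventually_elim simp
  qed (use g f L in \<open>auto intro!: L2_measurable L2_diff compose_L2\<close>)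
  finally show ?thesis by (simp add: disp_def L2_norm_minus_commute)
qed

text \<open>C counts the letters of a word for h. It does not depend on f or e, so a tolerance on T
  can be fixed before the function is chosen; e = 0 passes exact invariance from generators to the
  generated group.\<close>

lemma disp_generate:
  assumes T: "T \<subseteq> carrier G" and h: "h \<in> generate G T"
  shows "\<exists>C\<ge>0. \<forall>f\<in>L2 M. \<forall>e\<ge>0. (\<forall>t\<in>T. disp t f \<le> e) \<longrightarrow> disp h f \<le> C * e"
  using h
proof induction
  case one
  show ?case by (intro exI[of _ 0]) (simp add: disp_one)
next
  case (incl h)
  then show ?case by (intro exI[of _ 1]) auto
next
  case (inv h)
  then show ?case using T by (intro exI[of _ 1]) (auto simp: disp_inv)
next
  case (eng h1 h2)
  then obtain C1 C2 where C: "C1 \<ge> 0" "C2 \<ge> 0"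
    "\<And>f e. f \<in> L2 M \<Longrightarrow> e \<ge> 0 \<Longrightarrow> \<forall>t\<in>T. disp t f \<le> e \<Longrightarrow> disp h1 f \<le> C1 * e"
    "\<And>f e. f \<in> L2 M \<Longrightarrow> e \<ge> 0 \<Longrightarrow> \<forall>t\<in>T. disp t f \<le> e \<Longrightarrow> disp h2 f \<le> C2 * e"
    by blast
  have c: "h1 \<in> carrier G" "h2 \<in> carrier G"
    using eng generate_in_carrier[OF T] by auto
  show ?case
  proof (intro exI[of _ "C1 + C2"] conjI ballI allI impI)
    fix f e assume "f \<in> L2 M" "(0::real) \<le> e" "\<forall>t\<in>T. disp t f \<le> e"
    then show "disp (h1 \<otimes> h2) f \<le> (C1 + C2) * e"
      using disp_mult[OF c, of f] C(3)[of f e] C(4)[of f e] by (simp add: algebra_simps)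
  qed (use C in auto)
qed

lemma action_family:
  assumes "finite T" "T \<noteq> {}" "T \<subseteq> carrier G" "m_inv G ` T = T"
  shows "symmetric_family M T \<phi> (m_inv G)"
proof
  show "bij_betw (m_inv G) T T"
    using assms by (auto simp: bij_betw_def inj_on_def) (metis inv_inv subsetD)
qed (use assms action_mp action_inv in auto)

lemma averaging_pushed_uniform:
  assumes "finite T" "T \<noteq> {}"
  shows "averaging (pushed_uniform \<phi> T) f x = (\<Sum>t\<in>T. f (\<phi> t x)) / card T"
proof -
  have "averaging (pushed_uniform \<phi> T) f x = (LINT t|measure_pmf (pmf_of_set T). f (\<phi> t x))"
    by (simp add: averaging_def pushed_uniform_def integral_map_pmf)
  also have "\<dots> = (\<Sum>t\<in>T. f (\<phi> t x)) / card T"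
    using assms by (simp add: integral_pmf_of_set)
  finally show ?thesis .
qed

end

section \<open>Functions on cosets\<close>

text \<open>Right translation permutes the cosets, hence preserves counting measure, and translation
  by the inverse undoes it. The walk on cosets thereby obeys the same lemmas as the walk on
  X.\<close>

lemma (in group) coset_family:
  assumes H: "subgroup H G" and "finite S" "S \<noteq> {}" "S \<subseteq> carrier G" "m_inv G ` S = S"
  shows "symmetric_family (count_space (rcosets H)) S (\<lambda>s C. C #> s) (m_inv G)"
proof
  have HG: "H \<subseteq> carrier G" using H subgroup.subset by blast
  have cl: "C #> s \<in> rcosets H" if "C \<in> rcosets H" "s \<in> carrier G" for C s
    using that HG by (auto simp: RCOSETS_def coset_mult_assoc)
  have undo: "(C #> s) #> inv s = C" if "C \<in> rcosets H" "s \<in> carrier G" for C s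
  proof -
    have "C \<subseteq> carrier G" using that rcosets_part_G[OF H] by blast
    then show ?thesis using that by (simp add: coset_mult_assoc coset_mult_one)
  qed
  fix s assume s: "s \<in> S"
  then have sc: "s \<in> carrier G" using assms by auto
  have bij: "bij_betw (\<lambda>C. C #> s) (rcosets H) (rcosets H)"
  proof (rule bij_betwI[where g = "\<lambda>C. C #> inv s"])
    show "C #> inv s #> s = C" if "C \<in> rcosets H" for C
      using undo[OF that inv_closed[OF sc]] sc by simp
  qed (use cl sc undo in auto)
  show "measure_preserving (count_space (rcosets H)) (\<lambda>C. C #> s)"
    unfolding measure_preserving_def
    using distr_bij_count_space[OF bij] cl[OF _ sc] by (auto simp: measurable_count_space_eq1)
  show "AE C in count_space (rcosets H). C #> s #> inv s = C"
    using undo sc by (auto simp: AE_count_space)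
next
  show "bij_betw (m_inv G) S S"
    using assms by (auto simp: bij_betw_def inj_on_def) (metis inv_inv subsetD)
qed (use assms in auto)

section \<open>Transfer from functions on cosets to functions on the space\<close>

locale coset_transfer = pmp_group_action G M \<phi>
  for G :: "('g, 'r) monoid_scheme" (structure) and M :: "'x measure"
    and \<phi> :: "'g \<Rightarrow> 'x \<Rightarrow> 'x" +
  fixes H S :: "'g set"
  assumes H: "subgroup H G" and S: "finite S" "S \<noteq> {}" "S \<subseteq> carrier G" "m_inv G ` S = S"
begin

sublocale X: symmetric_family M S \<phi> "m_inv G"
  by (rule action_family[OF S])

sublocale C: symmetric_family "count_space (rcosets H)" S "\<lambda>s C. C #> s" "m_inv G"
  by (rule coset_family[OF H S])

abbreviation \<C> :: "'g set measure" where "\<C> \<equiv> count_space (rcosets H)"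

definition rep :: "'g set \<Rightarrow> 'g" where
  "rep C = (SOME g. g \<in> C)"

lemma rep_in: "C \<in> rcosets H \<Longrightarrow> rep C \<in> C"
  using subgroup.rcosets_non_empty[OF H, of C] by (auto simp: rep_def intro: someI)

lemma rep_carrier: "C \<in> rcosets H \<Longrightarrow> rep C \<in> carrier G"
  using rep_in rcosets_part_G[OF H] by blast

lemma coset_rep: "C \<in> rcosets H \<Longrightarrow> C = H #> rep C"
proof -
  assume C: "C \<in> rcosets H"
  then obtain x where x: "x \<in> carrier G" "C = H #> x" by (auto simp: RCOSETS_def)
  then show "C = H #> rep C"
    using repr_independence[OF _ x(1) H, of "rep C"] rep_in[OF C] by simp
qed

lemma coset_closed: "C \<in> rcosets H \<Longrightarrow> s \<in> carrier G \<Longrightarrow> C #> s \<in> rcosets H"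
  using subgroup.subset[OF H] by (auto simp: RCOSETS_def coset_mult_assoc)

lemma coset_undo:
  assumes "C \<in> rcosets H" "s \<in> carrier G"
  shows "C #> s #> inv s = C" "C #> inv s #> s = C"
proof -
  have "C \<subseteq> carrier G" using assms rcosets_part_G[OF H] by blast
  then show "C #> s #> inv s = C" "C #> inv s #> s = C"
    using assms by (simp_all add: coset_mult_assoc coset_mult_one)
qed

text \<open>F takes values on all sets of group elements; those outside \<open>rcosets H\<close>
  carry no meaning and are left out.\<close>

definition supp :: "('g set \<Rightarrow> real) \<Rightarrow> 'g set set" where
  "supp F = {C \<in> rcosets H. F C \<noteq> 0}"

text \<open>For f invariant under H the value f(x g^-1) depends only on the coset Hg, up to null
  sets, so the choice of \<open>rep\<close> is immaterial. For almost invariant f a representative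
  has to be fixed.\<close>

definition transfer :: "('g set \<Rightarrow> real) \<Rightarrow> ('x \<Rightarrow> real) \<Rightarrow> 'x \<Rightarrow> real" where
  "transfer F f x = (\<Sum>C\<in>supp F. F C * f (\<phi> (inv (rep C)) x))"

lemma transfer_superset:
  assumes "finite A" "supp F \<subseteq> A" "A \<subseteq> rcosets H"
  shows "transfer F f x = (\<Sum>C\<in>A. F C * f (\<phi> (inv (rep C)) x))"
  unfolding transfer_def using assms by (intro sum.mono_neutral_left) (auto simp: supp_def)

lemma supp_sub: "supp F \<subseteq> rcosets H"
  by (auto simp: supp_def)

lemma transfer_term_L2:
  assumes "C \<in> rcosets H" "f \<in> L2 M"
  shows "(\<lambda>x. F C * f (\<phi> (inv (rep C)) x)) \<in> L2 M"
  by (rule L2_scale[OF compose_L2[OF inv_closed[OF rep_carrier[OF assms(1)]] assms(2)]])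

lemma transfer_L2: "f \<in> L2 M \<Longrightarrow> transfer F f \<in> L2 M"
  unfolding transfer_def[abs_def]
  by (rule L2_sum, rule transfer_term_L2) (use supp_sub in auto)

lemma transfer_norm:
  assumes f: "f \<in> L2 M"
  shows "L2_norm M (transfer F f) \<le> (\<Sum>C\<in>supp F. \<bar>F C\<bar>) * L2_norm M f"
proof -
  have "L2_norm M (transfer F f) \<le> (\<Sum>C\<in>supp F. L2_norm M (\<lambda>x. F C * f (\<phi> (inv (rep C)) x)))"
    unfolding transfer_def[abs_def]
    by (rule L2_norm_sum, rule transfer_term_L2) (use supp_sub f in auto)
  also have "\<dots> = (\<Sum>C\<in>supp F. \<bar>F C\<bar> * L2_norm M f)"
  proof (intro sum.cong refl)
    fix C assume "C \<in> supp F"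
    then have "inv (rep C) \<in> carrier G" using supp_sub rep_carrier by blast
    from L2_norm_compose[OF action_mp[OF this] f]
    show "L2_norm M (\<lambda>x. F C * f (\<phi> (inv (rep C)) x)) = \<bar>F C\<bar> * L2_norm M f"
      by (simp add: L2_norm_scale)
  qed
  finally show ?thesis by (simp add: sum_distrib_right)
qed

text \<open>Each translate of f has the integral of f. Through this the squared integral of f enters
  the spread inequality.\<close>

lemma transfer_integral:
  assumes f: "f \<in> L2 M"
  shows "(LINT x|M. transfer F f x) = (\<Sum>C\<in>supp F. F C) * (LINT x|M. f x)"
proof -
  have "(LINT x|M. transfer F f x) = (\<Sum>C\<in>supp F. LINT x|M. F C * f (\<phi> (inv (rep C)) x))"
    unfolding transfer_def
    by (rule Bochner_Integration.integral_sum)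
      (use transfer_term_L2[OF _ f] supp_sub L2_integrable in blast)
  also have "\<dots> = (\<Sum>C\<in>supp F. F C * (LINT x|M. f x))"
  proof (intro sum.cong refl)
    fix C assume "C \<in> supp F"
    then have "inv (rep C) \<in> carrier G" using supp_sub rep_carrier by blast
    from measure_preserving_integral[OF action_mp[OF this] L2_measurable[OF f]]
    show "(LINT x|M. F C * f (\<phi> (inv (rep C)) x)) = F C * (LINT x|M. f x)"
      by simp
  qed
  finally show ?thesis by (simp add: sum_distrib_right)
qed

text \<open>For a coset D, F(D s) is nonzero exactly if D lies in the support translated by s^-1,
  hence the inverses.\<close>

definition translates :: "'g set set \<Rightarrow> 'g set set" where
  "translates A = A \<union> (\<Union>s\<in>S. (\<lambda>C. C #> inv s) ` A)"

lemma translates: "finite A \<Longrightarrow> finite (translates A)"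
  "A \<subseteq> rcosets H \<Longrightarrow> translates A \<subseteq> rcosets H"
  using S(1) coset_closed[OF _ inv_closed] S(3) by (auto simp: translates_def subset_iff)

lemma supp_lazy: "supp (C.lazy F) \<subseteq> translates (supp F)"
proof
  fix D assume D: "D \<in> supp (C.lazy F)"
  then have DC: "D \<in> rcosets H" by (simp add: supp_def)
  show "D \<in> translates (supp F)"
  proof (cases "F D = 0")
    case False
    then show ?thesis using DC by (simp add: translates_def supp_def)
  next
    case True
    then have "(\<Sum>s\<in>S. F (D #> s)) \<noteq> 0"
      using D by (auto simp: supp_def C.lazy_def C.avg_def)
    then obtain s where s: "s \<in> S" "F (D #> s) \<noteq> 0"
      by (meson sum.neutral)
    then have "D #> s \<in> supp F" "D = (D #> s) #> inv s"
      using DC coset_closed coset_undo S by (auto simp: supp_def)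
    then show ?thesis using s by (auto simp: translates_def)
  qed
qed

lemma finite_supp_lazy: "finite (supp F) \<Longrightarrow> finite (supp (C.lazy F))"
  using supp_lazy translates(1) finite_subset by blast

lemma finite_supp_lazy_pow: "finite (supp F) \<Longrightarrow> finite (supp ((C.lazy ^^ n) F))"
  by (induction n) (auto intro: finite_supp_lazy)

lemma sum_translate:
  assumes A: "finite (supp F)" and s: "s \<in> S"
  shows "(\<Sum>D\<in>translates (supp F). F (D #> s) * u D) = (\<Sum>C\<in>supp F. F C * u (C #> inv s))"
proof -
  have sc: "s \<in> carrier G" using s S by auto
  let ?B = "(\<lambda>C. C #> inv s) ` supp F"
  have inj: "inj_on (\<lambda>C. C #> inv s) (supp F)"
    by (rule inj_on_inverseI[where g="\<lambda>C. C #> s"]) (use coset_undo sc supp_sub in blast)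
  have "(\<Sum>C\<in>supp F. F C * u (C #> inv s)) = (\<Sum>C\<in>supp F. F (C #> inv s #> s) * u (C #> inv s))"
    by (intro sum.cong refl) (use coset_undo sc supp_sub in \<open>auto simp: subset_iff\<close>)
  also have "\<dots> = (\<Sum>D\<in>?B. F (D #> s) * u D)"
    by (subst sum.reindex[OF inj]) simp
  also have "\<dots> = (\<Sum>D\<in>translates (supp F). F (D #> s) * u D)"
  proof (rule sum.mono_neutral_left)
    show "finite (translates (supp F))" using A translates by blast
    show "?B \<subseteq> translates (supp F)" using s by (auto simp: translates_def)
    show "\<forall>D\<in>translates (supp F) - ?B. F (D #> s) * u D = 0"
    proof
      fix D assume D: "D \<in> translates (supp F) - ?B"
      then have DC: "D \<in> rcosets H" using translates(2)[OF supp_sub] by blast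
      have "D #> s \<notin> supp F"
        using D coset_undo(1)[OF DC sc] by (auto simp: image_iff)
      then show "F (D #> s) * u D = 0"
        using coset_closed[OF DC sc] by (auto simp: supp_def)
    qed
  qed
  finally show ?thesis by simp
qed

text \<open>The identity halves of the two lazy steps cancel, and the substitution D = C s^-1 turns
  both averaging halves into sums over the same pairs (s, C). What remains compares f at x s r^-1
  and at x r'^-1, where r and r' represent C and C s^-1; for H-invariant f it vanishes almost
  everywhere.\<close>

lemma lazy_transfer_diff:
  assumes A: "finite (supp F)"
  shows "X.lazy (transfer F f) x - transfer (C.lazy F) f x =
    (\<Sum>s\<in>S. \<Sum>C\<in>supp F. F C * (f (\<phi> (inv (rep C)) (\<phi> s x)) - f (\<phi> (inv (rep (C #> inv s))) x)))
      / (2 * card S)"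
proof -
  define u where "u D = f (\<phi> (inv (rep D)) x)" for D
  let ?T = "translates (supp F)"
  have T: "finite ?T" "?T \<subseteq> rcosets H" "supp F \<subseteq> ?T"
    using A translates supp_sub by (auto simp: translates_def)
  have "transfer (C.lazy F) f x = (\<Sum>D\<in>?T. C.lazy F D * u D)"
    unfolding u_def using T supp_lazy by (intro transfer_superset) auto
  also have "\<dots> = (\<Sum>D\<in>?T. F D * u D) / 2 + (\<Sum>D\<in>?T. \<Sum>s\<in>S. F (D #> s) * u D) / (2 * card S)"
  proof -
    have "C.lazy F D * u D = F D * u D / 2 + (\<Sum>s\<in>S. F (D #> s) * u D) / (2 * card S)" for D
      by (simp add: C.lazy_def C.avg_def add_divide_distrib distrib_right sum_distrib_right)
    then show ?thesis by (simp add: sum.distrib sum_divide_distrib)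
  qed
  also have "(\<Sum>D\<in>?T. F D * u D) = transfer F f x"
    unfolding u_def using T by (intro transfer_superset[symmetric]) auto
  also have "(\<Sum>D\<in>?T. \<Sum>s\<in>S. F (D #> s) * u D) = (\<Sum>s\<in>S. \<Sum>D\<in>?T. F (D #> s) * u D)"
    by (rule sum.swap)
  also have "\<dots> = (\<Sum>s\<in>S. \<Sum>C\<in>supp F. F C * u (C #> inv s))"
    by (intro sum.cong refl sum_translate A)
  finally have 1: "transfer (C.lazy F) f x = transfer F f x / 2 +
    (\<Sum>s\<in>S. \<Sum>C\<in>supp F. F C * u (C #> inv s)) / (2 * card S)" .
  have 2: "X.lazy (transfer F f) x = transfer F f x / 2 +
    (\<Sum>s\<in>S. \<Sum>C\<in>supp F. F C * f (\<phi> (inv (rep C)) (\<phi> s x))) / (2 * card S)"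
    unfolding X.lazy_def X.avg_def by (simp add: transfer_def field_simps)
  show ?thesis
    unfolding 1 2 u_def by (simp add: right_diff_distrib sum_subtractf diff_divide_distrib)
qed

text \<open>The Schreier element of the section \<open>rep\<close>:
  \<open>rep (C #> inv s) \<otimes> s\<close> and \<open>rep C\<close> both lie in C, so their
  quotient lies in H. It records how far the section is from being equivariant.\<close>

definition cocycle :: "'g set \<Rightarrow> 'g \<Rightarrow> 'g" where
  "cocycle C s = rep (C #> inv s) \<otimes> s \<otimes> inv (rep C)"

lemma cocycle_in:
  assumes C: "C \<in> rcosets H" and s: "s \<in> S"
  shows "cocycle C s \<in> H"
proof -
  have sc: "s \<in> carrier G" using s S by auto
  have D: "C #> inv s \<in> rcosets H" using coset_closed[OF C] sc by simp
  have r: "rep C \<in> carrier G" using rep_carrier[OF C] .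
  have "rep (C #> inv s) \<in> (H #> rep C) #> inv s"
    using rep_in[OF D] coset_rep[OF C] by metis
  then obtain k where k: "k \<in> H" "rep (C #> inv s) = k \<otimes> rep C \<otimes> inv s"
    by (auto simp: r_coset_def)
  then have "k \<in> carrier G" using subgroup.subset[OF H] by auto
  then have "cocycle C s = k"
    unfolding cocycle_def k(2) using r sc by (simp add: m_assoc inv_solve_right')
  then show ?thesis using k by simp
qed

text \<open>Up to null sets the second point is the first one moved by the inverse of the cocycle,
  and the map from x to the first point preserves the measure, so it drops out of the norm.\<close>

lemma displacement_cocycle:
  assumes C: "C \<in> rcosets H" and s: "s \<in> S" and f: "f \<in> L2 M"
  shows "L2_norm M (\<lambda>x. f (\<phi> (inv (rep C)) (\<phi> s x)) - f (\<phi> (inv (rep (C #> inv s))) x))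
    = disp (cocycle C s) f"
proof -
  define r where "r = inv (rep C)"
  define h where "h = cocycle C s"
  have sc: "s \<in> carrier G" using s S by auto
  have D: "C #> inv s \<in> rcosets H" using coset_closed[OF C] sc by simp
  have c: "r \<in> carrier G" "h \<in> carrier G" "rep (C #> inv s) \<in> carrier G" "rep C \<in> carrier G"
    using rep_carrier[OF C] rep_carrier[OF D] cocycle_in[OF C s] subgroup.subset[OF H]
    by (auto simp: r_def h_def)
  have e: "inv (rep (C #> inv s)) = (s \<otimes> r) \<otimes> inv h"
    unfolding h_def cocycle_def r_def using c sc
    by (simp add: inv_mult_group m_assoc) (simp add: inv_solve_left' flip: m_assoc)
  have fr: "(\<lambda>x. f (\<phi> r (\<phi> s x))) \<in> L2 M"
    using compose_L2[OF sc compose_L2[OF c(1) f]] .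
  have fh: "(\<lambda>x. f (\<phi> (inv h) (\<phi> r (\<phi> s x)))) \<in> L2 M"
    using compose_L2[OF sc compose_L2[OF c(1) compose_L2[OF inv_closed[OF c(2)] f]]] .
  have m: "measure_preserving M (\<lambda>x. \<phi> r (\<phi> s x))"
    using action_mp[OF sc] action_mp[OF c(1)] distr_distr[of "\<phi> r" M M "\<phi> s" M]
    by (auto simp: measure_preserving_def comp_def)
  have "L2_norm M (\<lambda>x. f (\<phi> r (\<phi> s x)) - f (\<phi> (inv (rep (C #> inv s))) x))
     = L2_norm M (\<lambda>x. f (\<phi> r (\<phi> s x)) - f (\<phi> (inv h) (\<phi> r (\<phi> s x))))"
  proof (rule L2_norm_cong_AE)
    show "AE x in M. f (\<phi> r (\<phi> s x)) - f (\<phi> (inv (rep (C #> inv s))) x)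
       = f (\<phi> r (\<phi> s x)) - f (\<phi> (inv h) (\<phi> r (\<phi> s x)))"
      using action_mult[OF m_closed[OF sc c(1)] inv_closed[OF c(2)]] action_mult[OF sc c(1)]
      by eventually_elim (simp add: e)
    show "(\<lambda>x. f (\<phi> r (\<phi> s x)) - f (\<phi> (inv (rep (C #> inv s))) x)) \<in> borel_measurable M"
      by (rule L2_measurable[OF L2_diff[OF fr compose_L2[OF inv_closed[OF c(3)] f]]])
    show "(\<lambda>x. f (\<phi> r (\<phi> s x)) - f (\<phi> (inv h) (\<phi> r (\<phi> s x)))) \<in> borel_measurable M"
      by (rule L2_measurable[OF L2_diff[OF fr fh]])
  qed
  also have "\<dots> = disp (inv h) f"
    using disp_compose[OF inv_closed[OF c(2)] m f] by (simp add: L2_norm_minus_commute)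
  finally show ?thesis using disp_inv[OF c(2) f] by (simp add: h_def r_def)
qed

text \<open>The error is a combination of displacements under the finitely many cocycles that belong
  to the support of F. Q and K depend on F but not on f, which allows Q to generate the subgroup
  later.\<close>

lemma lazy_transfer:
  assumes A: "finite (supp F)"
  shows "\<exists>Q K. finite Q \<and> Q \<subseteq> H \<and> K \<ge> 0 \<and> (\<forall>f\<in>L2 M. \<forall>e\<ge>0. (\<forall>h\<in>Q. disp h f \<le> e) \<longrightarrow>
    L2_norm M (\<lambda>x. X.lazy (transfer F f) x - transfer (C.lazy F) f x) \<le> K * e)"
proof (intro exI conjI ballI allI impI)
  let ?Q = "(\<lambda>(C, s). cocycle C s) ` (supp F \<times> S)"
  let ?K = "(\<Sum>s\<in>S. \<Sum>C\<in>supp F. \<bar>F C\<bar>) / (2 * card S)"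
  show "finite ?Q" using A S by auto
  show "?Q \<subseteq> H" using cocycle_in supp_sub by auto
  show "0 \<le> ?K" by (intro divide_nonneg_nonneg sum_nonneg) auto
  fix f and e :: real assume f: "f \<in> L2 M" and e: "0 \<le> e" and Q: "\<forall>h\<in>?Q. disp h f \<le> e"
  define D where "D s C x = f (\<phi> (inv (rep C)) (\<phi> s x)) - f (\<phi> (inv (rep (C #> inv s))) x)"
    for s C x
  have DL: "D s C \<in> L2 M" if "s \<in> S" "C \<in> supp F" for s C
  proof -
    have sc: "s \<in> carrier G" and C: "C \<in> rcosets H" using that S supp_sub by auto
    then have D: "C #> inv s \<in> rcosets H" using coset_closed by simp
    show ?thesis unfolding D_def[abs_def]
      by (rule L2_diff[OF compose_L2[OF sc compose_L2[OF inv_closed[OF rep_carrier[OF C]] f]]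
            compose_L2[OF inv_closed[OF rep_carrier[OF D]] f]])
  qed
  have DN: "L2_norm M (D s C) \<le> e" if "s \<in> S" "C \<in> supp F" for s C
  proof -
    have "C \<in> rcosets H" using that supp_sub by auto
    from displacement_cocycle[OF this that(1) f] show ?thesis
      using Q that by (auto simp: D_def[abs_def])
  qed
  have "L2_norm M (\<lambda>x. X.lazy (transfer F f) x - transfer (C.lazy F) f x) =
      L2_norm M (\<lambda>x. (1 / (2 * card S)) * (\<Sum>s\<in>S. \<Sum>C\<in>supp F. F C * D s C x))"
    by (simp add: lazy_transfer_diff[OF A] D_def)
  also have "\<dots> = L2_norm M (\<lambda>x. \<Sum>s\<in>S. \<Sum>C\<in>supp F. F C * D s C x) / (2 * card S)"
    by (subst L2_norm_scale) simp
  also have "\<dots> \<le> (\<Sum>s\<in>S. L2_norm M (\<lambda>x. \<Sum>C\<in>supp F. F C * D s C x)) / (2 * card S)"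
    by (intro divide_right_mono L2_norm_sum L2_sum L2_scale DL) auto
  also have "\<dots> \<le> (\<Sum>s\<in>S. \<Sum>C\<in>supp F. L2_norm M (\<lambda>x. F C * D s C x)) / (2 * card S)"
    by (intro divide_right_mono sum_mono L2_norm_sum L2_scale DL) auto
  also have "\<dots> \<le> (\<Sum>s\<in>S. \<Sum>C\<in>supp F. \<bar>F C\<bar> * e) / (2 * card S)"
    unfolding L2_norm_scale by (intro divide_right_mono sum_mono mult_left_mono DN) auto
  also have "\<dots> = ?K * e"
    by (simp add: sum_distrib_right)
  finally show "L2_norm M (\<lambda>x. X.lazy (transfer F f) x - transfer (C.lazy F) f x) \<le> ?K * e" .
qed

text \<open>Supports grow with n but stay finite. The error of one step is not enlarged by the
  following ones because \<open>lazy\<close> contracts, so the constants just add up. F varies in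
  the induction since the first step replaces it by \<open>C.lazy F\<close>.\<close>

lemma lazy_pow_transfer:
  assumes "finite (supp F)"
  shows "\<exists>Q K. finite Q \<and> Q \<subseteq> H \<and> K \<ge> 0 \<and> (\<forall>f\<in>L2 M. \<forall>e\<ge>0. (\<forall>h\<in>Q. disp h f \<le> e) \<longrightarrow>
    L2_norm M (\<lambda>x. (X.lazy ^^ n) (transfer F f) x - transfer ((C.lazy ^^ n) F) f x) \<le> K * e)"
  using assms
proof (induction n arbitrary: F)
  case 0
  show ?case by (intro exI[of _ "{}"] exI[of _ 0]) simp
next
  case (Suc n)
  obtain Q1 K1 where 1: "finite Q1" "Q1 \<subseteq> H" "K1 \<ge> 0"
    "\<And>f e. f \<in> L2 M \<Longrightarrow> e \<ge> 0 \<Longrightarrow> \<forall>h\<in>Q1. disp h f \<le> e \<Longrightarrow>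
    L2_norm M (\<lambda>x. X.lazy (transfer F f) x - transfer (C.lazy F) f x) \<le> K1 * e"
    using lazy_transfer[OF Suc.prems] by blast
  obtain Q2 K2 where 2: "finite Q2" "Q2 \<subseteq> H" "K2 \<ge> 0"
    "\<And>f e. f \<in> L2 M \<Longrightarrow> e \<ge> 0 \<Longrightarrow> \<forall>h\<in>Q2. disp h f \<le> e \<Longrightarrow>
    L2_norm M (\<lambda>x. (X.lazy ^^ n) (transfer (C.lazy F) f) x
      - transfer ((C.lazy ^^ n) (C.lazy F)) f x) \<le> K2 * e"
    using Suc.IH[OF finite_supp_lazy[OF Suc.prems]] by blast
  show ?case
  proof (intro exI conjI ballI allI impI)
    show "finite (Q1 \<union> Q2)" "Q1 \<union> Q2 \<subseteq> H" "0 \<le> K1 + K2" using 1 2 by auto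
    fix f and e :: real
    assume f: "f \<in> L2 M" and e: "0 \<le> e" and Q: "\<forall>h\<in>Q1 \<union> Q2. disp h f \<le> e"
    have L: "X.lazy (transfer F f) \<in> L2 M" "transfer (C.lazy F) f \<in> L2 M"
      using f transfer_L2 X.lazy_L2 by auto
    have "L2_norm M (\<lambda>x. (X.lazy ^^ n) (X.lazy (transfer F f)) x
        - transfer ((C.lazy ^^ n) (C.lazy F)) f x)
      \<le> L2_norm M (\<lambda>x. (X.lazy ^^ n) (X.lazy (transfer F f)) x - (X.lazy ^^ n) (transfer (C.lazy F) f) x)
      + L2_norm M (\<lambda>x. (X.lazy ^^ n) (transfer (C.lazy F) f) x
        - transfer ((C.lazy ^^ n) (C.lazy F)) f x)"
      using L transfer_L2[OF f] by (intro L2_norm_triangle_diff X.lazy_pow_L2)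
    also have "L2_norm M (\<lambda>x. (X.lazy ^^ n) (X.lazy (transfer F f)) x - (X.lazy ^^ n) (transfer (C.lazy F) f) x)
      \<le> L2_norm M (\<lambda>x. X.lazy (transfer F f) x - transfer (C.lazy F) f x)"
      using X.lazy_pow_contraction[OF L2_diff[OF L], of n] by (simp add: X.lazy_pow_diff)
    also have "\<dots> \<le> K1 * e" using 1(4)[OF f e] Q by auto
    also have "L2_norm M (\<lambda>x. (X.lazy ^^ n) (transfer (C.lazy F) f) x
        - transfer ((C.lazy ^^ n) (C.lazy F)) f x) \<le> K2 * e"
      using 2(4)[OF f e] Q by auto
    finally show "L2_norm M (\<lambda>x. (X.lazy ^^ Suc n) (transfer F f) x - transfer ((C.lazy ^^ Suc n) F) f x)
      \<le> (K1 + K2) * e"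
      by (simp add: funpow_Suc_right distrib_right del: funpow.simps)
  qed
qed

lemma inner_finite_supp:
  assumes "finite A" "supp F \<subseteq> A" "A \<subseteq> rcosets H"
  shows "L2_inner \<C> F' F = (\<Sum>C\<in>A. F' C * F C)"
proof -
  have "L2_inner \<C> F' F = (\<Sum>C | C \<in> rcosets H \<and> F' C * F C \<noteq> 0. F' C * F C)"
    unfolding L2_inner_def
    by (rule lebesgue_integral_count_space_finite_support)
      (rule finite_subset[OF _ assms(1)], use assms in \<open>auto simp: supp_def\<close>)
  also have "\<dots> = (\<Sum>C\<in>A. F' C * F C)"
    using assms by (intro sum.mono_neutral_left) (auto simp: supp_def)
  finally show ?thesis .
qed

lemma finite_supp_L2: "finite (supp F) \<Longrightarrow> F \<in> L2 \<C>"
proof -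
  assume "finite (supp F)"
  then have "integrable \<C> (\<lambda>C. (F C)\<^sup>2)"
    unfolding abs_summable_on_def[symmetric]
    by (subst abs_summable_on_cong_neutral[where B="supp F" and g="\<lambda>C. (F C)\<^sup>2"])
      (auto simp: supp_def)
  then show ?thesis by (simp add: L2_def)
qed

text \<open>In the expanded double sum the diagonal terms give exactly the left-hand side, as
  translates of f have the norm of f. The off-diagonal terms are dropped; they are nonnegative
  because F, F' and f are.\<close>

lemma transfer_inner_lower:
  assumes A: "finite (supp F)" "finite (supp F')" and f: "f \<in> L2 M" "\<And>x. f x \<ge> 0"
    and F: "\<And>C. F C \<ge> 0" "\<And>C. F' C \<ge> 0"
  shows "L2_inner \<C> F' F * (L2_norm M f)\<^sup>2 \<le> L2_inner M (transfer F' f) (transfer F f)"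
proof -
  define u where "u C x = f (\<phi> (inv (rep C)) x)" for C x
  define A where "A = supp F \<union> supp F'"
  have AA: "finite A" "A \<subseteq> rcosets H" "supp F \<subseteq> A" "supp F' \<subseteq> A"
    using A supp_sub by (auto simp: A_def)
  have g: "inv (rep C) \<in> carrier G" if "C \<in> A" for C
    using that AA rep_carrier by blast
  have uL: "u C \<in> L2 M" if "C \<in> A" for C
    unfolding u_def[abs_def] by (rule compose_L2[OF g[OF that] f(1)])
  have uN: "L2_inner M (u C) (u C) = (L2_norm M f)\<^sup>2" if "C \<in> A" for C
    using L2_inner_compose[OF action_mp[OF g[OF that]] f(1) f(1)]
    by (simp add: u_def[abs_def] L2_norm_power2)
  have up: "L2_inner M (u C) (u D) \<ge> 0" for C D
    unfolding L2_inner_def u_def by (intro Bochner_Integration.integral_nonneg) (simp add: f)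
  have t: "transfer F' f = (\<lambda>x. \<Sum>C\<in>A. F' C * u C x)" "transfer F f = (\<lambda>x. \<Sum>C\<in>A. F C * u C x)"
    using AA by (auto simp: transfer_superset u_def)
  have "L2_inner M (transfer F' f) (transfer F f)
      = (\<Sum>C\<in>A. \<Sum>D\<in>A. F' C * (F D * L2_inner M (u C) (u D)))"
  proof -
    have "L2_inner M (transfer F' f) (transfer F f)
        = (\<Sum>C\<in>A. L2_inner M (\<lambda>x. F' C * u C x) (\<lambda>x. \<Sum>D\<in>A. F D * u D x))"
      unfolding t by (rule L2_inner_sum_left) (intro L2_scale L2_sum uL; assumption)+
    also have "\<dots> = (\<Sum>C\<in>A. F' C * (\<Sum>D\<in>A. L2_inner M (u C) (\<lambda>x. F D * u D x)))"
      unfolding L2_inner_scale_left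
      by (intro sum.cong refl arg_cong2[where f="(*)"] L2_inner_sum_right L2_scale uL)
    finally show ?thesis by (simp add: L2_inner_scale_right sum_distrib_left)
  qed
  also have "\<dots> \<ge> (\<Sum>C\<in>A. F' C * (F C * L2_inner M (u C) (u C)))"
  proof (rule sum_mono)
    fix C assume "C \<in> A"
    then show "F' C * (F C * L2_inner M (u C) (u C)) \<le> (\<Sum>D\<in>A. F' C * (F D * L2_inner M (u C) (u D)))"
      using AA(1) F up by (intro member_le_sum[where f="\<lambda>D. F' C * (F D * L2_inner M (u C) (u D))"]) auto
  qed
  also have "(\<Sum>C\<in>A. F' C * (F C * L2_inner M (u C) (u C))) = L2_inner \<C> F' F * (L2_norm M f)\<^sup>2"
    using uN AA by (simp add: inner_finite_supp[of A] sum_distrib_right mult.assoc)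
  finally show ?thesis .
qed

lemma lazy_coset_nonneg:
  assumes "\<And>C. F C \<ge> 0"
  shows "C.lazy F C \<ge> 0"
  using assms by (auto simp: C.lazy_def C.avg_def intro!: divide_nonneg_nonneg add_nonneg_nonneg sum_nonneg)

lemma lazy_pow_coset_nonneg:
  assumes "\<And>C. F C \<ge> 0"
  shows "(C.lazy ^^ n) F C \<ge> 0"
  by (induction n arbitrary: C) (auto intro: lazy_coset_nonneg assms)

end

section \<open>Growth on the cosets against decay on the space\<close>

context coset_transfer
begin

lemma inner_add_const:
  assumes "f \<in> L2_0 M" "g \<in> L2_0 M"
  shows "L2_inner M (\<lambda>x. f x + c) (\<lambda>x. g x + c) = L2_inner M f g + c\<^sup>2"
proof -
  have L: "f \<in> L2 M" "g \<in> L2 M" and z: "(LINT x|M. f x) = 0" "(LINT x|M. g x) = 0"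
    using assms by (auto simp: L2_0_def)
  have "L2_inner M (\<lambda>x. f x + c) (\<lambda>x. g x + c) =
      L2_inner M f g + L2_inner M f (\<lambda>x. c) + (L2_inner M (\<lambda>x. c) g + L2_inner M (\<lambda>x. c) (\<lambda>x. c))"
    using L by (simp add: L2_inner_add_left L2_inner_add_right L2_add const_L2)
  also have "\<dots> = L2_inner M f g + c\<^sup>2"
    using z by (simp add: L2_inner_def prob_space power2_eq_square)
  finally show ?thesis .
qed

text \<open>Constants are fixed and orthogonal to the mean-zero functions, which \<open>lazy\<close>
  preserves. On the latter \<open>lazy_norm_le\<close> turns the form bound q into a norm bound, so
  powers decay like q^n, while the constant part contributes the squared mean.\<close>

lemma lazy_pow_inner_upper:
  assumes q: "q \<ge> 0" "\<And>f. f \<in> L2_0 M \<Longrightarrow> L2_inner M (X.lazy f) f \<le> q * (L2_norm M f)\<^sup>2"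
    and g: "g \<in> L2 M"
  shows "L2_inner M ((X.lazy ^^ n) g) g \<le> q ^ n * (L2_norm M g)\<^sup>2 + (LINT x|M. g x)\<^sup>2"
proof -
  define m where "m = (LINT x|M. g x)"
  define g0 where "g0 x = g x - m" for x
  have g0: "g0 \<in> L2_0 M"
    using L2_diff[OF g const_L2[of m]] L2_integrable[OF g]
    by (simp add: L2_0_def g0_def[abs_def] m_def prob_space)
  have pow0: "(X.lazy ^^ n) g0 \<in> L2_0 M" for n
    by (induction n) (auto intro: X.lazy_L2_0 finite_measure_axioms g0)
  have L: "g0 \<in> L2 M" "(X.lazy ^^ n) g0 \<in> L2 M" for n
    using g0 pow0 by (auto simp: L2_0_def)
  have pown: "L2_norm M ((X.lazy ^^ n) g0) \<le> q ^ n * L2_norm M g0" for n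
  proof (induction n)
    case (Suc n)
    have "L2_norm M ((X.lazy ^^ Suc n) g0) \<le> q * L2_norm M ((X.lazy ^^ n) g0)"
      using X.lazy_norm_le[OF L(2) q(1) q(2)[OF pow0] q(2)[OF X.lazy_L2_0[OF finite_measure_axioms pow0]]] by simp
    also have "\<dots> \<le> q * (q ^ n * L2_norm M g0)"
      using Suc q by (intro mult_left_mono)
    finally show ?case by (simp add: mult.assoc)
  qed simp
  have ge: "g = (\<lambda>x. g0 x + m)" by (simp add: g0_def)
  have pge: "(X.lazy ^^ n) g = (\<lambda>x. (X.lazy ^^ n) g0 x + m)"
  proof -
    have "(X.lazy ^^ n) g0 = (\<lambda>x. (X.lazy ^^ n) g x - m)"
      using X.lazy_pow_diff[of n g "\<lambda>x. m"] by (simp add: g0_def[abs_def] X.lazy_pow_const)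
    then show ?thesis by simp
  qed
  have "L2_inner M ((X.lazy ^^ n) g) g = L2_inner M ((X.lazy ^^ n) g0) g0 + m\<^sup>2"
    unfolding pge using inner_add_const[OF pow0 g0, of n m] by (simp flip: ge)
  also have "L2_inner M ((X.lazy ^^ n) g0) g0 \<le> L2_norm M ((X.lazy ^^ n) g0) * L2_norm M g0"
    using L2_Cauchy_Schwarz[OF L(2,1), of n] by linarith
  also have "\<dots> \<le> q ^ n * L2_norm M g0 * L2_norm M g0"
    using pown by (intro mult_right_mono) auto
  also have "\<dots> \<le> q ^ n * (L2_norm M g)\<^sup>2"
  proof -
    have "(L2_norm M g)\<^sup>2 = (L2_norm M g0)\<^sup>2 + m\<^sup>2"
      unfolding L2_norm_power2 using inner_add_const[OF g0 g0, of m] by (simp flip: ge)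
    then have "(L2_norm M g0)\<^sup>2 \<le> (L2_norm M g)\<^sup>2" by simp
    then show ?thesis using q(1) by (simp add: mult.assoc mult_left_mono flip: power2_eq_square)
  qed
  finally show ?thesis by (simp add: m_def)
qed

text \<open>Square summability is integrability for counting measure, which makes the L2 lemmas
  available on cosets.\<close>

lemma l2_cosets_L2:
  assumes "F \<in> l2_cosets G H"
  shows "F \<in> L2 \<C>"
proof -
  have "(\<lambda>C. norm ((F C)\<^sup>2)) summable_on rcosets H"
    using assms by (simp add: l2_cosets_def)
  then have "integrable \<C> (\<lambda>C. (F C)\<^sup>2)"
    using abs_summable_equivalent[of "\<lambda>C. (F C)\<^sup>2" "rcosets H"]
    by (simp add: Infinite_Set_Sum.abs_summable_on_def)
  then show ?thesis by (simp add: L2_def)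
qed

lemma l2_inner_eq:
  assumes "F \<in> L2 \<C>" "F' \<in> L2 \<C>"
  shows "l2_inner G H F F' = L2_inner \<C> F F'"
  using infsetsum_infsum[of "\<lambda>C. F C * F' C" "rcosets H"] L2_integrable_mult[OF assms]
  by (simp add: l2_inner_def L2_inner_def infsetsum_def Infinite_Set_Sum.abs_summable_on_def)

lemma coset_averaging_eq: "coset_averaging G (pmf_of_set S) F C = C.avg F C"
proof -
  have "coset_averaging G (pmf_of_set S) F C = (\<Sum>\<^sub>\<infinity>s\<in>S. F (C #> s) / card S)"
    unfolding coset_averaging_def using S
    by (intro infsum_cong_neutral) (auto simp: indicator_def)
  then show ?thesis using S(1) by (simp add: C.avg_def sum_divide_distrib)
qed

text \<open>Supplies the dominating function when a nonnegative function on cosets is approximated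
  by truncations.\<close>

lemma avg_mult_mono:
  assumes "\<And>C. 0 \<le> F C" "\<And>C. F C \<le> F' C"
  shows "\<bar>C.avg F C * F C\<bar> \<le> C.avg F' C * F' C"
proof -
  have "0 \<le> C.avg F C" using assms(1) by (auto simp: C.avg_def intro!: divide_nonneg_nonneg sum_nonneg)
  moreover have "C.avg F C \<le> C.avg F' C"
    unfolding C.avg_def using assms(2) by (intro divide_right_mono sum_mono) auto
  ultimately show ?thesis
    using assms[of C] by (simp add: abs_mult mult_mono)
qed

text \<open>Absolute values keep the norm and cannot lower the numerator, so a test function may be
  taken nonnegative. When it is cut to growing finite sets of cosets, both forms converge by
  dominated convergence, and the strict inequality survives at some stage.\<close>

lemma exists_finite_supp:
  assumes ctbl: "countable (carrier G)"
    and r: "rel_spectral_radius G H (pmf_of_set S) > ereal r"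
  shows "\<exists>F. finite (supp F) \<and> (\<forall>C. F C \<ge> 0) \<and> L2_norm \<C> F > 0 \<and>
    L2_inner \<C> (C.avg F) F > r * (L2_norm \<C> F)\<^sup>2"
proof -
  obtain F0 where F0: "F0 \<in> l2_cosets G H" "\<exists>C\<in>rcosets H. F0 C \<noteq> 0"
    "r < l2_inner G H (coset_averaging G (pmf_of_set S) F0) F0 / l2_inner G H F0 F0"
    using r unfolding rel_spectral_radius_def less_SUP_iff by auto
  have L0: "F0 \<in> L2 \<C>" using l2_cosets_L2 F0 by simp
  define F1 where "F1 C = \<bar>F0 C\<bar>" for C
  have L1: "F1 \<in> L2 \<C>" using L2_abs[OF L0] by (simp add: F1_def[abs_def])
  have n1: "L2_inner \<C> F1 F1 = L2_inner \<C> F0 F0" by (simp add: L2_inner_def F1_def)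
  have "L2_inner \<C> F0 F0 \<noteq> 0"
    using F0(2) by (simp add: L2_inner_eq_0_iff[OF L0] AE_count_space)
  then have n0: "L2_inner \<C> F0 F0 > 0" using L2_inner_nonneg[of \<C> F0] by linarith
  have "r * L2_inner \<C> F0 F0 < L2_inner \<C> (C.avg F0) F0"
    using F0(3) n0 L0 C.avg_L2[OF L0]
    by (simp add: coset_averaging_eq[abs_def] l2_inner_eq pos_less_divide_eq)
  also have "\<dots> \<le> L2_inner \<C> (C.avg F1) F1"
    unfolding L2_inner_def
  proof (rule integral_mono[OF L2_integrable_mult[OF C.avg_L2[OF L0] L0] L2_integrable_mult[OF C.avg_L2[OF L1] L1]])
    fix C
    have "C.avg F0 C * F0 C \<le> \<bar>C.avg F0 C\<bar> * \<bar>F0 C\<bar>" by (metis abs_ge_self abs_mult)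
    also have "\<dots> \<le> C.avg F1 C * \<bar>F0 C\<bar>"
    proof (rule mult_right_mono)
      have "\<bar>C.avg F0 C\<bar> = \<bar>\<Sum>s\<in>S. F0 (C #> s)\<bar> / card S" by (simp add: C.avg_def)
      also have "\<dots> \<le> C.avg F1 C"
        unfolding C.avg_def F1_def by (intro divide_right_mono sum_abs) auto
      finally show "\<bar>C.avg F0 C\<bar> \<le> C.avg F1 C" .
    qed simp
    finally show "C.avg F0 C * F0 C \<le> C.avg F1 C * F1 C" by (simp add: F1_def)
  qed
  finally have r1: "r * L2_inner \<C> F1 F1 < L2_inner \<C> (C.avg F1) F1" by (simp add: n1)
  have R: "countable (rcosets H)" "rcosets H \<noteq> {}"
    using ctbl one_closed unfolding RCOSETS_def by auto
  \<comment> \<open>Initial segments of an enumeration that may repeat, so a finite coset space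
    needs no separate treatment.\<close>
  define A where "A i = from_nat_into (rcosets H) ` {..i}" for i :: nat
  define Fi where "Fi i C = (if C \<in> A i then F1 C else 0)" for i C
  have AR: "finite (A i)" "A i \<subseteq> rcosets H" for i
    using from_nat_into[OF R(2)] by (auto simp: A_def)
  have sF: "finite (supp (Fi i))" for i
    by (rule finite_subset[OF _ AR(1)[of i]]) (auto simp: supp_def Fi_def)
  have F1p: "F1 C \<ge> 0" for C by (simp add: F1_def)
  have Fip: "Fi i C \<ge> 0" "Fi i C \<le> F1 C" for i C by (auto simp: Fi_def F1p)
  have lim: "(\<lambda>i. Fi i C) \<longlonglongrightarrow> F1 C" if CR: "C \<in> rcosets H" for C
  proof (rule tendsto_eventually)
    obtain k where k: "from_nat_into (rcosets H) k = C"
      using from_nat_into_surj[OF R(1) CR] by metis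
    show "eventually (\<lambda>i. Fi i C = F1 C) sequentially"
      using eventually_ge_at_top[of k] by eventually_elim (use k in \<open>auto simp: Fi_def A_def\<close>)
  qed
  have l1: "(\<lambda>i. L2_inner \<C> (Fi i) (Fi i)) \<longlonglongrightarrow> L2_inner \<C> F1 F1"
    unfolding L2_inner_def
  proof (rule integral_dominated_convergence[where w="\<lambda>C. F1 C * F1 C"])
    show "integrable \<C> (\<lambda>C. F1 C * F1 C)" by (rule L2_integrable_mult[OF L1 L1])
    show "AE C in \<C>. (\<lambda>i. Fi i C * Fi i C) \<longlonglongrightarrow> F1 C * F1 C"
      by (auto simp: AE_count_space intro!: tendsto_mult lim)
    show "AE C in \<C>. norm (Fi i C * Fi i C) \<le> F1 C * F1 C" for i
      using Fip F1p by (auto simp: abs_mult intro!: mult_mono)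
  qed auto
  have l2: "(\<lambda>i. L2_inner \<C> (C.avg (Fi i)) (Fi i)) \<longlonglongrightarrow> L2_inner \<C> (C.avg F1) F1"
    unfolding L2_inner_def
  proof (rule integral_dominated_convergence[where w="\<lambda>C. C.avg F1 C * F1 C"])
    show "integrable \<C> (\<lambda>C. C.avg F1 C * F1 C)" by (rule L2_integrable_mult[OF C.avg_L2[OF L1] L1])
    show "AE C in \<C>. (\<lambda>i. C.avg (Fi i) C * Fi i C) \<longlonglongrightarrow> C.avg F1 C * F1 C"
      unfolding AE_count_space C.avg_def
      using S(3) C.card_I by (intro ballI tendsto_mult tendsto_divide tendsto_sum lim tendsto_const)
        (auto intro: coset_closed)
    show "AE C in \<C>. norm (C.avg (Fi i) C * Fi i C) \<le> C.avg F1 C * F1 C" for i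
      using avg_mult_mono[of "Fi i" F1] Fip by auto
  qed auto
  \<comment> \<open>The difference has a positive limit and so has the squared norm, which gives one
    index for both requirements.\<close>
  have "(\<lambda>i. L2_inner \<C> (C.avg (Fi i)) (Fi i) - r * L2_inner \<C> (Fi i) (Fi i))
      \<longlonglongrightarrow> L2_inner \<C> (C.avg F1) F1 - r * L2_inner \<C> F1 F1"
    by (intro tendsto_diff tendsto_mult l1 l2 tendsto_const)
  from order_tendstoD(1)[OF this, of 0] order_tendstoD(1)[OF l1, of 0]
  have "eventually (\<lambda>i. 0 < L2_inner \<C> (C.avg (Fi i)) (Fi i) - r * L2_inner \<C> (Fi i) (Fi i) \<and>
      0 < L2_inner \<C> (Fi i) (Fi i)) sequentially"
    using r1 n0 n1 by (simp add: eventually_conj_iff)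
  from eventually_happens'[OF sequentially_bot this]
  obtain i where i: "0 < L2_inner \<C> (C.avg (Fi i)) (Fi i) - r * L2_inner \<C> (Fi i) (Fi i)"
      "0 < L2_inner \<C> (Fi i) (Fi i)"
    by blast
  have "L2_norm \<C> (Fi i) > 0" using i(2) by (simp add: L2_norm_def)
  moreover have "r * (L2_norm \<C> (Fi i))\<^sup>2 < L2_inner \<C> (C.avg (Fi i)) (Fi i)"
    using i(1) by (simp add: L2_norm_power2)
  ultimately show ?thesis using sF Fip(1) by blast
qed

text \<open>With N the norm and J the integral of f, the comparison reads p^k |F|^2 N^2 <= q^k s^2
  N^2 + s^2 J^2 + K s e N^2, where s is the total mass of F. The order of choices is F, then k with
  p^k |F|^2 > q^k s^2, then Q and K from F and k, and last e so small that the error is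
  absorbed.\<close>

theorem almost_invariant_spread:
  assumes ctbl: "countable (carrier G)"
    and r: "rel_spectral_radius G H (pmf_of_set S) > rho_plus M (pushed_uniform \<phi> S)"
  shows "\<exists>Q e d. finite Q \<and> Q \<subseteq> H \<and> e > 0 \<and> d > 0 \<and>
    (\<forall>f\<in>L2 M. (\<forall>x. f x \<ge> 0) \<longrightarrow> (\<forall>h\<in>Q. disp h f \<le> e * L2_norm M f) \<longrightarrow>
      d * (L2_norm M f)\<^sup>2 \<le> (LINT x|M. f x)\<^sup>2)"
proof -
  \<comment> \<open>Both radii are extended reals and \<open>rho_plus\<close> may be minus infinity,
    so a real threshold is inserted between them.\<close>
  obtain r0 where r0: "rho_plus M (pushed_uniform \<phi> S) < ereal r0"
    "ereal r0 < rel_spectral_radius G H (pmf_of_set S)"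
    using ereal_dense2[OF r] by auto
  obtain F where F: "finite (supp F)" "\<And>C. F C \<ge> 0" "L2_norm \<C> F > 0"
    "L2_inner \<C> (C.avg F) F > r0 * (L2_norm \<C> F)\<^sup>2"
    using exists_finite_supp[OF ctbl r0(2)] by blast
  have FL: "F \<in> L2 \<C>" by (rule finite_supp_L2[OF F(1)])
  define r1 where "r1 = L2_inner \<C> (C.avg F) F / (L2_norm \<C> F)\<^sup>2"
  have r1: "r0 < r1" "r1 * (L2_norm \<C> F)\<^sup>2 = L2_inner \<C> (C.avg F) F"
    using F(3,4) by (auto simp: r1_def pos_less_divide_eq)
  have "r1 \<ge> 0"
    unfolding r1_def L2_inner_def C.avg_def
    by (intro divide_nonneg_nonneg Bochner_Integration.integral_nonneg mult_nonneg_nonneg sum_nonneg F) auto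
  \<comment> \<open>Images of r0 and r1 under t -> (1 + t)/2, the effect of laziness on the
    spectrum. r0 may lie below -1, hence the maximum with 0; p is at least 1/2 because r1 is
    nonnegative.\<close>
  define q p where "q = max 0 ((1 + r0) / 2)" "p = (1 + r1) / 2"
  have qp: "0 \<le> q" "q < p" "0 < p" using r1(1) \<open>r1 \<ge> 0\<close> by (auto simp: q_p_def max_def)
  have upper: "L2_inner M (X.lazy f) f \<le> q * (L2_norm M f)\<^sup>2" if f0: "f \<in> L2_0 M" for f
  proof -
    have f: "f \<in> L2 M" using f0 by (simp add: L2_0_def)
    have "L2_inner M (X.avg f) f \<le> r0 * L2_inner M f f"
    proof (cases "AE x in M. f x = 0")
      case True
      then have "L2_inner M f f = 0" by (simp add: L2_inner_eq_0_iff[OF f])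
      then have "L2_norm M f = 0" by (simp add: L2_norm_def)
      then have "L2_inner M (X.avg f) f = 0"
        using L2_Cauchy_Schwarz[OF X.avg_L2[OF f] f] by simp
      then show ?thesis using \<open>L2_inner M f f = 0\<close> by simp
    next
      case False
      then have "L2_inner M f f \<noteq> 0" by (simp add: L2_inner_eq_0_iff[OF f])
      then have pos: "L2_inner M f f > 0" using L2_inner_nonneg[of M f] by linarith
      have "averaging (pushed_uniform \<phi> S) f = X.avg f"
        using averaging_pushed_uniform[OF S(1,2)] by (auto simp: X.avg_def)
      then have "ereal (L2_inner M (X.avg f) f / L2_inner M f f) \<le> rho_plus M (pushed_uniform \<phi> S)"
        unfolding rho_plus_def using f0 False by (intro SUP_upper2[of f]) auto
      also note r0(1)
      finally show ?thesis using pos by (simp add: pos_divide_less_eq)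
    qed
    then have "L2_inner M (X.lazy f) f \<le> (1 + r0) / 2 * (L2_norm M f)\<^sup>2"
      using X.lazy_inner[OF f f] by (simp add: L2_norm_power2 field_simps)
    also have "\<dots> \<le> q * (L2_norm M f)\<^sup>2"
      by (intro mult_right_mono) (auto simp: q_p_def)
    finally show ?thesis .
  qed
  have lower: "L2_inner \<C> ((C.lazy ^^ (2 ^ m)) F) F \<ge> p ^ (2 ^ m) * (L2_norm \<C> F)\<^sup>2" for m
  proof (rule C.lazy_pow_inner_lower[OF FL])
    show "0 \<le> p" using qp by simp
    have "L2_inner \<C> (C.lazy F) F = p * (L2_norm \<C> F)\<^sup>2"
      using C.lazy_inner[OF FL FL] r1(2) by (simp add: q_p_def L2_norm_power2 field_simps)
    then show "p * (L2_norm \<C> F)\<^sup>2 \<le> L2_inner \<C> (C.lazy F) F" by simp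
  qed
  define s where "s = (\<Sum>C\<in>supp F. F C)"
  have s0: "s \<ge> 0" using F(2) by (auto simp: s_def intro: sum_nonneg)
  \<comment> \<open>k is a power of two because the lower bound is available only there. Using s^2 +
    1 instead of s^2 keeps the divisor positive.\<close>
  obtain k :: nat where k: "q ^ k * (s\<^sup>2 + 1) < p ^ k * (L2_norm \<C> F)\<^sup>2" and kl:
    "L2_inner \<C> ((C.lazy ^^ k) F) F \<ge> p ^ k * (L2_norm \<C> F)\<^sup>2"
  proof -
    have "0 < (L2_norm \<C> F)\<^sup>2 / (s\<^sup>2 + 1)"
      using F(3) by (intro divide_pos_pos) (auto intro: add_nonneg_pos)
    then obtain n where n: "(q / p) ^ n < (L2_norm \<C> F)\<^sup>2 / (s\<^sup>2 + 1)"
      using real_arch_pow_inv[of "(L2_norm \<C> F)\<^sup>2 / (s\<^sup>2 + 1)" "q / p"] qp by auto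
    have "(q / p) ^ (2 ^ n) \<le> (q / p) ^ n"
      using qp by (intro power_decreasing) (auto simp: less_imp_le)
    with n have "(q / p) ^ (2 ^ n) < (L2_norm \<C> F)\<^sup>2 / (s\<^sup>2 + 1)" by simp
    moreover have "s\<^sup>2 + 1 > 0" by (auto intro: add_nonneg_pos)
    ultimately have "q ^ (2 ^ n) * (s\<^sup>2 + 1) < p ^ (2 ^ n) * (L2_norm \<C> F)\<^sup>2"
      using qp by (simp add: power_divide field_simps)
    then show ?thesis using that lower by blast
  qed
  \<comment> \<open>The surplus of growth over decay: one half pays for the error of the
    intertwining, the other half yields d.\<close>
  define D where "D = p ^ k * (L2_norm \<C> F)\<^sup>2 - q ^ k * s\<^sup>2"
  have D: "D > 0" using k qp(1) by (simp add: D_def distrib_left) (smt (verit) zero_le_power)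
  obtain Q K where Q: "finite Q" "Q \<subseteq> H" "K \<ge> 0"
    "\<And>f e. f \<in> L2 M \<Longrightarrow> e \<ge> 0 \<Longrightarrow> \<forall>h\<in>Q. disp h f \<le> e \<Longrightarrow>
    L2_norm M (\<lambda>x. (X.lazy ^^ k) (transfer F f) x - transfer ((C.lazy ^^ k) F) f x) \<le> K * e"
    using lazy_pow_transfer[OF F(1), of k] by blast
  \<comment> \<open>Chosen to make K s e at most D/2; the summand 1 guards against K s = 0.\<close>
  define e where "e = D / (2 * (K * s + 1))"
  have Ks: "K * s \<ge> 0" using Q(3) s0 by simp
  have e: "e > 0" using D Ks by (auto simp: e_def)
  have eK: "K * s * e \<le> D / 2"
  proof -
    have "K * s * e \<le> (K * s + 1) * e" using e by simp
    also have "\<dots> = D / 2" using Ks by (simp add: e_def field_simps)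
    finally show ?thesis .
  qed
  define d where "d = D / (2 * (s\<^sup>2 + 1))"
  have sp: "s\<^sup>2 + 1 > 0" by (auto intro: add_nonneg_pos)
  have d: "d > 0" using D sp by (simp add: d_def)
  show ?thesis
  proof (rule exI[of _ Q], rule exI[of _ e], rule exI[of _ d], intro conjI ballI impI)
    fix f assume f: "f \<in> L2 M" "\<forall>x. f x \<ge> 0" and inv: "\<forall>h\<in>Q. disp h f \<le> e * L2_norm M f"
    define N where "N = L2_norm M f"
    define J where "J = (LINT x|M. f x)"
    let ?T = "transfer F f"
    let ?T' = "transfer ((C.lazy ^^ k) F) f"
    have N0: "N \<ge> 0" by (simp add: N_def)
    have TL: "?T \<in> L2 M" "?T' \<in> L2 M" using f transfer_L2 by auto
    have TN: "L2_norm M ?T \<le> s * N"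
      using transfer_norm[OF f(1), of F] F(2) by (simp add: s_def N_def)
    have "p ^ k * (L2_norm \<C> F)\<^sup>2 * N\<^sup>2 \<le> L2_inner \<C> ((C.lazy ^^ k) F) F * N\<^sup>2"
      using kl by (intro mult_right_mono) auto
    also have "\<dots> \<le> L2_inner M ?T' ?T"
      unfolding N_def using f F finite_supp_lazy_pow lazy_pow_coset_nonneg
      by (intro transfer_inner_lower) auto
    also have "\<dots> = L2_inner M ((X.lazy ^^ k) ?T) ?T
        - L2_inner M (\<lambda>x. (X.lazy ^^ k) ?T x - ?T' x) ?T"
      using TL by (simp add: L2_inner_diff_left X.lazy_pow_L2)
    also have "\<dots> \<le> (q ^ k * (s * N)\<^sup>2 + s\<^sup>2 * J\<^sup>2) + K * (e * N) * (s * N)"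
    proof -
      have "L2_inner M ((X.lazy ^^ k) ?T) ?T \<le> q ^ k * (L2_norm M ?T)\<^sup>2 + (LINT x|M. ?T x)\<^sup>2"
        by (rule lazy_pow_inner_upper[OF qp(1) upper TL(1)])
      also have "\<dots> \<le> q ^ k * (s * N)\<^sup>2 + s\<^sup>2 * J\<^sup>2"
        using TN qp(1) transfer_integral[OF f(1), of F]
        by (intro add_mono mult_left_mono power_mono) (auto simp: s_def J_def power_mult_distrib)
      finally have 1: "L2_inner M ((X.lazy ^^ k) ?T) ?T \<le> q ^ k * (s * N)\<^sup>2 + s\<^sup>2 * J\<^sup>2" .
      have "- L2_inner M (\<lambda>x. (X.lazy ^^ k) ?T x - ?T' x) ?T
         \<le> L2_norm M (\<lambda>x. (X.lazy ^^ k) ?T x - ?T' x) * L2_norm M ?T"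
        using L2_Cauchy_Schwarz[OF L2_diff[OF X.lazy_pow_L2[OF TL(1), of k] TL(2)] TL(1)]
        by linarith
      also have "\<dots> \<le> K * (e * N) * (s * N)"
        using Q(4)[OF f(1) _ inv] TN e N0 Q(3) by (intro mult_mono) (auto simp: N_def)
      finally show ?thesis using 1 by linarith
    qed
    finally have "D * N\<^sup>2 \<le> s\<^sup>2 * J\<^sup>2 + K * s * e * N\<^sup>2"
      by (simp add: D_def algebra_simps power_mult_distrib power2_eq_square)
    also have "\<dots> \<le> s\<^sup>2 * J\<^sup>2 + D / 2 * N\<^sup>2"
      by (intro add_left_mono mult_right_mono eK) auto
    finally have "D / 2 * N\<^sup>2 \<le> s\<^sup>2 * J\<^sup>2" by (simp add: algebra_simps)
    also have "\<dots> \<le> (s\<^sup>2 + 1) * J\<^sup>2" by (intro mult_right_mono) auto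
    finally have "D / 2 * N\<^sup>2 / (s\<^sup>2 + 1) \<le> J\<^sup>2"
      unfolding pos_divide_le_eq[OF sp] by (simp only: mult.commute)
    moreover have "d * N\<^sup>2 = D / 2 * N\<^sup>2 / (s\<^sup>2 + 1)" by (simp add: d_def)
    ultimately show "d * (L2_norm M f)\<^sup>2 \<le> (LINT x|M. f x)\<^sup>2"
      unfolding N_def J_def by linarith
  qed (use Q e d in auto)
qed

end

section \<open>The mean ergodic theorem\<close>

text \<open>Fatou's lemma for the squares, applied to the extended nonnegative integral so that
  square integrability of w comes out of it.\<close>

lemma L2_Fatou:
  assumes u: "\<And>k. u k \<in> L2 M" and w: "w \<in> borel_measurable M"
    and lim: "AE x in M. (\<lambda>k. u k x) \<longlonglongrightarrow> w x"
    and c: "eventually (\<lambda>k::nat. L2_norm M (u k) \<le> c) sequentially"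
  shows "w \<in> L2 M" "L2_norm M w \<le> c"
proof -
  have c0: "c \<ge> 0"
    using eventually_happens'[OF sequentially_bot c] by (meson L2_norm_nonneg order_trans)
  have um: "u k \<in> borel_measurable M" for k by (rule L2_measurable[OF u])
  have nn: "(\<integral>\<^sup>+x. ennreal ((u k x)\<^sup>2) \<partial>M) = ennreal ((L2_norm M (u k))\<^sup>2)" for k
  proof -
    have "integrable M (\<lambda>x. (u k x)\<^sup>2)" using u[of k] by (simp add: L2_def)
    from nn_integral_eq_integral[OF this] show ?thesis
      unfolding L2_norm_power2 L2_inner_def by (simp add: power2_eq_square)
  qed
  have "(\<integral>\<^sup>+x. ennreal ((w x)\<^sup>2) \<partial>M) = (\<integral>\<^sup>+x. liminf (\<lambda>k. ennreal ((u k x)\<^sup>2)) \<partial>M)"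
  proof (rule nn_integral_cong_AE, use lim in eventually_elim)
    fix x assume "(\<lambda>k. u k x) \<longlonglongrightarrow> w x"
    then have "(\<lambda>k. ennreal ((u k x)\<^sup>2)) \<longlonglongrightarrow> ennreal ((w x)\<^sup>2)"
      by (intro tendsto_ennrealI tendsto_power)
    then show "ennreal ((w x)\<^sup>2) = liminf (\<lambda>k. ennreal ((u k x)\<^sup>2))"
      using lim_imp_Liminf sequentially_bot by metis
  qed
  also have "\<dots> \<le> liminf (\<lambda>k. \<integral>\<^sup>+x. ennreal ((u k x)\<^sup>2) \<partial>M)"
    using um by (intro nn_integral_liminf) auto
  also have "\<dots> \<le> ennreal (c\<^sup>2)"
    unfolding nn
  proof (rule Liminf_le)
    show "eventually (\<lambda>k. ennreal ((L2_norm M (u k))\<^sup>2) \<le> ennreal (c\<^sup>2)) sequentially"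
      using c by eventually_elim (auto intro!: ennreal_leI power_mono)
  qed simp
  finally have le: "(\<integral>\<^sup>+x. ennreal ((w x)\<^sup>2) \<partial>M) \<le> ennreal (c\<^sup>2)" .
  have int: "integrable M (\<lambda>x. (w x)\<^sup>2)"
    using w le by (intro integrableI_nonneg) (auto intro: le_less_trans)
  then show "w \<in> L2 M" using w by (simp add: L2_def)
  have "ennreal ((L2_norm M w)\<^sup>2) \<le> ennreal (c\<^sup>2)"
    using le nn_integral_eq_integral[OF int]
    unfolding L2_norm_power2 L2_inner_def by (simp add: power2_eq_square)
  then have "(L2_norm M w)\<^sup>2 \<le> c\<^sup>2" by (simp add: ennreal_le_iff)
  then show "L2_norm M w \<le> c" by (rule power2_le_imp_le[OF _ c0])
qed

text \<open>The Riesz-Fischer theorem. Almost everywhere convergence along a subsequence is kept in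
  the conclusion, because it shows later that the limit vanishes where the approximants do.\<close>

lemma (in prob_space) L2_complete:
  assumes v: "\<And>n. v n \<in> L2 M"
    and Cauchy: "\<And>e. e > 0 \<Longrightarrow> \<exists>N. \<forall>m\<ge>N. \<forall>n\<ge>N. L2_norm M (\<lambda>x. v m x - v n x) \<le> e"
  shows "\<exists>(r :: nat \<Rightarrow> nat) w. w \<in> L2 M \<and> (AE x in M. (\<lambda>k. v (r k) x) \<longlonglongrightarrow> w x) \<and>
    (\<lambda>n. L2_norm M (\<lambda>x. v n x - w x)) \<longlonglongrightarrow> 0"
proof -
  have vm: "v n \<in> borel_measurable M" for n by (rule L2_measurable[OF v])
  have "\<forall>k. \<exists>N. \<forall>m\<ge>N. \<forall>n\<ge>N. L2_norm M (\<lambda>x. v m x - v n x) \<le> (1/2) ^ k"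
    using Cauchy by simp
  then obtain R where R: "\<And>k m n. m \<ge> R k \<Longrightarrow> n \<ge> R k \<Longrightarrow> L2_norm M (\<lambda>x. v m x - v n x) \<le> (1/2) ^ k"
    by metis
  \<comment> \<open>The sum makes r k at least R k and r monotone at once, and the summand k makes r
    unbounded.\<close>
  define r where "r k = k + (\<Sum>i\<le>k. R i)" for k
  have rR: "r k \<ge> R k" for k
    unfolding r_def by (rule trans_le_add2) (rule member_le_sum, auto)
  have rk: "r k \<ge> k" for k by (simp add: r_def)
  have rS: "r (Suc k) \<ge> r k" for k by (simp add: r_def)
  define u where "u k x = v (r (Suc k)) x - v (r k) x" for k x
  have uL: "u k \<in> L2 M" for k unfolding u_def[abs_def] by (intro L2_diff v)
  \<comment> \<open>On a probability space the L1 norm is at most the L2 norm, so the increments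
    along r have summable L1 norms and their series converges absolutely almost everywhere.\<close>
  have L1: "integrable M f \<and> (LINT x|M. \<bar>f x\<bar>) \<le> L2_norm M f" if "f \<in> L2 M" for f
  proof
    have one: "(\<lambda>x. 1) \<in> L2 M" by (simp add: L2_def)
    show "integrable M f" using L2_integrable_mult[OF that one] by simp
    show "(LINT x|M. \<bar>f x\<bar>) \<le> L2_norm M f"
      using L2_Cauchy_Schwarz[OF L2_abs[OF that] one]
      by (simp add: L2_inner_def L2_norm_def prob_space)
  qed
  have un: "(\<integral>\<^sup>+x. ennreal \<bar>u k x\<bar> \<partial>M) \<le> ennreal ((1/2) ^ k)" for k
  proof -
    have "(\<integral>\<^sup>+x. ennreal \<bar>u k x\<bar> \<partial>M) = ennreal (LINT x|M. \<bar>u k x\<bar>)"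
      using L1[OF uL, of k] by (intro nn_integral_eq_integral) auto
    also have "\<dots> \<le> ennreal ((1/2) ^ k)"
      using L1[OF uL, of k] R[of k "r (Suc k)" "r k"] rR[of k] rS[of k]
      unfolding u_def[abs_def] by (intro ennreal_leI) linarith
    finally show ?thesis .
  qed
  have "(\<integral>\<^sup>+x. (\<Sum>k. ennreal \<bar>u k x\<bar>) \<partial>M) = (\<Sum>k. \<integral>\<^sup>+x. ennreal \<bar>u k x\<bar> \<partial>M)"
    using L2_measurable[OF uL] by (intro nn_integral_suminf) auto
  also have "\<dots> \<le> (\<Sum>k. ennreal ((1/2) ^ k))"
    by (intro suminf_le un) auto
  also have "\<dots> < \<infinity>"
  proof -
    have "summable (\<lambda>k. (1/2 :: real) ^ k)" by (intro summable_geometric) simp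
    then show ?thesis by (subst suminf_ennreal2) auto
  qed
  finally have "AE x in M. (\<Sum>k. ennreal \<bar>u k x\<bar>) \<noteq> \<infinity>"
    using L2_measurable[OF uL] by (intro nn_integral_noteq_infinite) auto
  then have conv: "AE x in M. convergent (\<lambda>k. v (r k) x)"
  proof eventually_elim
    case (elim x)
    then have "summable (\<lambda>k. \<bar>u k x\<bar>)"
      by (intro summable_suminf_not_top) auto
    then have "summable (\<lambda>k. u k x)" by (rule summable_rabs_cancel)
    then have "convergent (\<lambda>n. \<Sum>k<n. u k x)" by (simp add: summable_iff_convergent)
    moreover have "(\<Sum>k<n. u k x) = v (r n) x - v (r 0) x" for n
      unfolding u_def by (rule sum_lessThan_telescope)
    ultimately have "convergent (\<lambda>n. (v (r n) x - v (r 0) x) + v (r 0) x)"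
      by (intro convergent_add convergent_const) simp
    then show ?case by simp
  qed
  define w where "w x = lim (\<lambda>k. v (r k) x)" for x
  have wm: "w \<in> borel_measurable M"
    unfolding w_def[abs_def] by (intro borel_measurable_lim_metric vm)
  have lim: "AE x in M. (\<lambda>k. v (r k) x) \<longlonglongrightarrow> w x"
    using conv by eventually_elim (simp add: w_def convergent_LIMSEQ_iff)
  \<comment> \<open>Fatou along the subsequence turns the Cauchy estimate between \<open>v n\<close>
    and \<open>v (r k)\<close> into one between \<open>v n\<close> and w.\<close>
  have F: "(\<lambda>x. v n x - w x) \<in> L2 M \<and> L2_norm M (\<lambda>x. v n x - w x) \<le> e"
    if "\<forall>m\<ge>N. \<forall>n\<ge>N. L2_norm M (\<lambda>x. v m x - v n x) \<le> e" "n \<ge> N" for n N e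
  proof -
    have a: "\<And>k. (\<lambda>x. v n x - v (r k) x) \<in> L2 M" by (intro L2_diff v)
    have b: "(\<lambda>x. v n x - w x) \<in> borel_measurable M" using vm wm by auto
    have c: "AE x in M. (\<lambda>k. v n x - v (r k) x) \<longlonglongrightarrow> v n x - w x"
      using lim by eventually_elim (intro tendsto_diff tendsto_const)
    have d: "eventually (\<lambda>k. L2_norm M (\<lambda>x. v n x - v (r k) x) \<le> e) sequentially"
      using eventually_ge_at_top[of N]
      by eventually_elim (use that rk order_trans in blast)
    show ?thesis using L2_Fatou[OF a b c d] by simp
  qed
  have "w \<in> L2 M"
  proof -
    obtain N where "\<forall>m\<ge>N. \<forall>n\<ge>N. L2_norm M (\<lambda>x. v m x - v n x) \<le> 1" using Cauchy[of 1] by auto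
    then have "(\<lambda>x. v N x - w x) \<in> L2 M" using F by blast
    from L2_diff[OF v[of N] this] show ?thesis by simp
  qed
  moreover have "(\<lambda>n. L2_norm M (\<lambda>x. v n x - w x)) \<longlonglongrightarrow> 0"
  proof (rule LIMSEQ_I)
    fix e :: real assume "e > 0"
    then obtain N where "\<forall>m\<ge>N. \<forall>n\<ge>N. L2_norm M (\<lambda>x. v m x - v n x) \<le> e / 2"
      using Cauchy[of "e/2"] by auto
    then have "\<forall>n\<ge>N. L2_norm M (\<lambda>x. v n x - w x) \<le> e / 2" using F by blast
    then show "\<exists>N. \<forall>n\<ge>N. norm (L2_norm M (\<lambda>x. v n x - w x) - 0) < e"
      using \<open>e > 0\<close> by (intro exI[of _ N]) (force intro: le_less_trans)
  qed
  ultimately show ?thesis using lim by blast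
qed

section \<open>Sets that are invariant up to null sets\<close>

context pmp_group_action
begin

text \<open>The image is the preimage under the inverse map, whose measurability is part of
  \<open>Aut\<close>.\<close>

lemma action_image_measure:
  assumes h: "h \<in> carrier G" and Z: "Z \<in> sets M"
  shows "\<phi> h ` Z \<in> sets M" "emeasure M (\<phi> h ` Z) = emeasure M Z"
proof -
  have a: "bij_betw (\<phi> h) (space M) (space M)" "\<phi> h \<in> measurable M M"
    "inv_into (space M) (\<phi> h) \<in> measurable M M" "distr M M (\<phi> h) = M"
    using action h by (auto simp: pmp_action_def Aut_def)
  have Zs: "Z \<subseteq> space M" using sets.sets_into_space[OF Z] .
  have "\<phi> h ` Z = inv_into (space M) (\<phi> h) -` Z \<inter> space M"
    using a(1) Zs by (auto simp: bij_betw_def f_inv_into_f image_iff subset_iff)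
      (metis f_inv_into_f)
  then show s: "\<phi> h ` Z \<in> sets M" using a(3) Z by (simp add: measurable_sets)
  have "emeasure M (\<phi> h ` Z) = emeasure (distr M M (\<phi> h)) (\<phi> h ` Z)" by (simp add: a)
  also have "\<dots> = emeasure M (\<phi> h -` (\<phi> h ` Z) \<inter> space M)"
    by (rule emeasure_distr[OF a(2) s])
  also have "\<phi> h -` (\<phi> h ` Z) \<inter> space M = Z"
    using a(1) Zs by (auto simp: bij_betw_def dest: inj_onD)
  finally show "emeasure M (\<phi> h ` Z) = emeasure M Z" .
qed

lemma action_vimage_measure:
  assumes h: "h \<in> carrier G" and Z: "Z \<in> sets M"
  shows "\<phi> h -` Z \<inter> space M \<in> sets M" "emeasure M (\<phi> h -` Z \<inter> space M) = emeasure M Z"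
proof -
  have a: "\<phi> h \<in> measurable M M" "distr M M (\<phi> h) = M"
    using action h by (auto simp: pmp_action_def Aut_def)
  show "\<phi> h -` Z \<inter> space M \<in> sets M" using a Z by (simp add: measurable_sets)
  show "emeasure M (\<phi> h -` Z \<inter> space M) = emeasure M Z"
    using emeasure_distr[OF a(1) Z] a(2) by simp
qed

text \<open>Injectivity of the maps on the space gives the pointwise form, surjectivity leads
  back.\<close>

lemma invariant_set_iff:
  assumes K: "K \<subseteq> carrier G" and A: "A \<subseteq> space M"
  shows "invariant_set \<phi> K A \<longleftrightarrow> (\<forall>h\<in>K. \<forall>x\<in>space M. \<phi> h x \<in> A \<longleftrightarrow> x \<in> A)"
proof
  assume inv: "invariant_set \<phi> K A"
  show "\<forall>h\<in>K. \<forall>x\<in>space M. \<phi> h x \<in> A \<longleftrightarrow> x \<in> A"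
  proof (intro ballI)
    fix h x assume h: "h \<in> K" and x: "x \<in> space M"
    have "inj_on (\<phi> h) (space M)" using action_bij[of h] K h by (auto simp: bij_betw_def)
    from inj_on_image_mem_iff[OF this x A] show "\<phi> h x \<in> A \<longleftrightarrow> x \<in> A"
      using inv h by (simp add: invariant_set_def)
  qed
next
  assume iff: "\<forall>h\<in>K. \<forall>x\<in>space M. \<phi> h x \<in> A \<longleftrightarrow> x \<in> A"
  show "invariant_set \<phi> K A"
    unfolding invariant_set_def
  proof
    fix h assume h: "h \<in> K"
    have surj: "\<phi> h ` space M = space M" using action_bij[of h] K h by (auto simp: bij_betw_def)
    show "\<phi> h ` A = A"
    proof
      show "\<phi> h ` A \<subseteq> A" using iff h A by auto
      show "A \<subseteq> \<phi> h ` A"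
      proof
        fix y assume "y \<in> A"
        then obtain x where "x \<in> space M" "y = \<phi> h x" using A surj by (metis image_iff subsetD)
        then show "y \<in> \<phi> h ` A" using iff h \<open>y \<in> A\<close> by auto
      qed
    qed
  qed
qed

text \<open>The maps compose only almost everywhere, so the union of the images of N under K need
  not be invariant. Images and preimages are therefore added again and again; countability of K
  keeps every stage null.\<close>

lemma null_saturation:
  assumes K: "countable K" "K \<subseteq> carrier G" and N: "N \<in> null_sets M"
  shows "\<exists>N'\<in>null_sets M. N \<subseteq> N' \<and> invariant_set \<phi> K N'"
proof -
  define step where "step Z = Z \<union> (\<Union>h\<in>K. \<phi> h ` Z) \<union> (\<Union>h\<in>K. \<phi> h -` Z \<inter> space M)" for Z
  have step: "step Z \<in> null_sets M" if Z: "Z \<in> null_sets M" for Z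
    unfolding step_def
  proof (intro null_sets.Un null_sets_UN' K Z)
    show "\<phi> h ` Z \<in> null_sets M" if "h \<in> K" for h
      using action_image_measure[of h Z] that K Z by (auto simp: null_sets_def)
    show "\<phi> h -` Z \<inter> space M \<in> null_sets M" if "h \<in> K" for h
      using action_vimage_measure[of h Z] that K Z by (auto simp: null_sets_def)
  qed
  have pow: "(step ^^ n) N \<in> null_sets M" for n
    by (induction n) (auto intro: step N)
  define N' where "N' = (\<Union>n. (step ^^ n) N)"
  have N': "N' \<in> null_sets M" unfolding N'_def using pow by (intro null_sets_UN)
  have "N \<subseteq> N'" unfolding N'_def using UN_upper[of 0 UNIV "\<lambda>n. (step ^^ n) N"] by simp
  moreover have "invariant_set \<phi> K N'"
  proof (subst invariant_set_iff[OF K(2)])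
    show "N' \<subseteq> space M" using N' sets.sets_into_space by blast
    have st: "step ((step ^^ n) N) \<subseteq> N'" for n
      unfolding N'_def using UN_upper[of "Suc n" UNIV "\<lambda>n. (step ^^ n) N"] by simp
    show "\<forall>h\<in>K. \<forall>x\<in>space M. \<phi> h x \<in> N' \<longleftrightarrow> x \<in> N'"
    proof (intro ballI iffI)
      fix h x assume h: "h \<in> K" and x: "x \<in> space M"
      { assume "\<phi> h x \<in> N'"
        then obtain n where "\<phi> h x \<in> (step ^^ n) N" by (auto simp: N'_def)
        then have "x \<in> step ((step ^^ n) N)" using h x by (auto simp: step_def)
        then show "x \<in> N'" using st by blast }
      { assume "x \<in> N'"
        then obtain n where "x \<in> (step ^^ n) N" by (auto simp: N'_def)
        then have "\<phi> h x \<in> step ((step ^^ n) N)" using h x by (auto simp: step_def)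
        then show "\<phi> h x \<in> N'" using st by blast }
    qed
  qed
  ultimately show ?thesis using N' by blast
qed

text \<open>\<open>ergodic_on\<close> speaks of exactly invariant sets. The points where invariance
  of A fails for some h in K form a null set, and removing an invariant null set around them leaves
  an exactly invariant part of A.\<close>

lemma AE_invariant_imp_invariant:
  assumes K: "countable K" "K \<subseteq> carrier G" and A: "A \<in> sets M"
    and inv: "\<And>h. h \<in> K \<Longrightarrow> AE x in M. \<phi> h x \<in> A \<longleftrightarrow> x \<in> A"
  shows "\<exists>A'\<in>sets M. A' \<subseteq> A \<and> A - A' \<in> null_sets M \<and> invariant_set \<phi> K A'"
proof -
  have "AE x in M. \<forall>h\<in>K. \<phi> h x \<in> A \<longleftrightarrow> x \<in> A"
    using inv K(1) by (simp add: AE_ball_countable)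
  then obtain N0 where N0: "{x\<in>space M. \<not> (\<forall>h\<in>K. \<phi> h x \<in> A \<longleftrightarrow> x \<in> A)} \<subseteq> N0" "N0 \<in> null_sets M"
    by (auto simp: eventually_ae_filter)
  obtain N where N: "N \<in> null_sets M" "N0 \<subseteq> N" "invariant_set \<phi> K N"
    using null_saturation[OF K N0(2)] by blast
  have Ns: "N \<subseteq> space M" "A \<subseteq> space M" using N(1) A sets.sets_into_space by blast+
  show ?thesis
  proof (intro bexI conjI)
    show "A - N \<in> sets M" using A N by auto
    show "A - (A - N) \<in> null_sets M" using N(1) A by (intro null_sets_subset[OF N(1)]) auto
    show "invariant_set \<phi> K (A - N)"
      using N(3) N(2) N0(1) Ns by (subst invariant_set_iff[OF K(2)]) (auto simp: invariant_set_iff[OF K(2)])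
  qed auto
qed

end

section \<open>Decay of averages on an ergodic component\<close>

locale ergodic_component = pmp_group_action G M \<phi>
  for G :: "('g, 'r) monoid_scheme" (structure) and M :: "'x measure"
    and \<phi> :: "'g \<Rightarrow> 'x \<Rightarrow> 'x" +
  fixes K T :: "'g set" and Y :: "'x set"
  assumes T: "sym_gen_set G K T"
    and Y: "Y \<in> sets M" "invariant_set \<phi> K Y" "ergodic_on M \<phi> K Y"
begin

lemma T_props: "finite T" "T \<noteq> {}" "T \<subseteq> carrier G" "m_inv G ` T = T" "generate G T = K"
  using T by (auto simp: sym_gen_set_def)

sublocale X: symmetric_family M T \<phi> "m_inv G"
  by (rule action_family[OF T_props(1-4)])

lemma K_carrier: "K \<subseteq> carrier G"
  using T_props generate_incl by metis

lemma T_sub_K: "T \<subseteq> K"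
  using T_props generate.incl by (metis subsetI)

lemma K_countable: "countable K"
  using countable_generate[of T] T_props by (simp add: countable_finite)

lemma Y_space: "Y \<subseteq> space M"
  using Y sets.sets_into_space by blast

lemma Y_iff: "h \<in> K \<Longrightarrow> x \<in> space M \<Longrightarrow> \<phi> h x \<in> Y \<longleftrightarrow> x \<in> Y"
  using invariant_set_iff[OF K_carrier Y_space] Y by simp

text \<open>The part of Y where v is positive is invariant up to null sets, hence null or conull in
  Y. Either way v has one sign almost everywhere, and such a function with integral 0
  vanishes.\<close>

lemma ergodic_zero:
  assumes v: "v \<in> L2_0 M" and off: "AE x in M. x \<notin> Y \<longrightarrow> v x = 0"
    and inv: "\<And>t. t \<in> T \<Longrightarrow> disp t v = 0"
  shows "AE x in M. v x = 0"
proof -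
  have vL: "v \<in> L2 M" and v0: "(LINT x|M. v x) = 0" using v by (auto simp: L2_0_def)
  have vm: "v \<in> borel_measurable M" by (rule L2_measurable[OF vL])
  have vi: "integrable M v" by (rule L2_integrable[OF vL])
  have inv': "AE x in M. v (\<phi> h x) = v x" if h: "h \<in> K" for h
  proof -
    have hc: "h \<in> carrier G" using h K_carrier by blast
    \<comment> \<open>The word bound with e = 0 passes invariance from T to all of K.\<close>
    obtain C where "disp h v \<le> C * 0"
      using disp_generate[OF T_props(3), of h] h T_props(5) vL inv by (metis order_refl)
    then have "disp h v = 0" using disp_nonneg[of h v] by simp
    then have "L2_inner M (\<lambda>x. v (\<phi> h x) - v x) (\<lambda>x. v (\<phi> h x) - v x) = 0"
      unfolding disp_def by (simp flip: L2_norm_power2)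
    then show ?thesis
      using L2_inner_eq_0_iff[OF L2_diff[OF compose_L2[OF hc vL] vL]] by simp
  qed
  define A where "A = {x \<in> space M. v x > 0} \<inter> Y"
  have A: "A \<in> sets M" unfolding A_def using vm Y by auto
  have "AE x in M. \<phi> h x \<in> A \<longleftrightarrow> x \<in> A" if h: "h \<in> K" for h
    using inv'[OF h] AE_space
    by eventually_elim (use h K_carrier Y_iff action_space in \<open>auto simp: A_def\<close>)
  from AE_invariant_imp_invariant[OF K_countable K_carrier A this]
  obtain A' where A': "A' \<in> sets M" "A' \<subseteq> A" "A - A' \<in> null_sets M" "invariant_set \<phi> K A'"
    by auto
  have "emeasure M A' = 0 \<or> emeasure M (Y - A') = 0"
    using Y(3) A' by (auto simp: ergodic_on_def A_def)
  then show ?thesis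
  proof
    assume "emeasure M A' = 0"
    then have "A' \<in> null_sets M" using A' by (auto simp: null_sets_def)
    from AE_not_in[OF this] AE_not_in[OF A'(3)] off AE_space
    have le: "AE x in M. 0 \<le> - v x"
      by eventually_elim (auto simp: A_def)
    from integral_nonneg_eq_0_iff_AE[OF integrable_minus[OF vi] this] v0
    show ?thesis by simp
  next
    assume "emeasure M (Y - A') = 0"
    then have "Y - A' \<in> null_sets M" using A' Y by (auto simp: null_sets_def)
    from AE_not_in[OF this] off AE_space
    have ge: "AE x in M. 0 \<le> v x"
    proof eventually_elim
      case (elim x)
      show ?case
      proof (cases "x \<in> Y")
        case True
        then have "x \<in> A" using elim A'(2) by blast
        then show ?thesis by (simp add: A_def)
      qed (use elim in simp)
    qed
    from integral_nonneg_eq_0_iff_AE[OF vi this] v0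
    show ?thesis by simp
  qed
qed

text \<open>Extensions by zero of mean-zero functions of the component. They vanish at every point
  of the space outside Y, which \<open>lazy\<close> respects because Y is exactly invariant.\<close>

definition on_Y :: "('x \<Rightarrow> real) set" where
  "on_Y = {f \<in> L2_0 M. \<forall>x\<in>space M - Y. f x = 0}"

lemma on_Y_L2: "f \<in> on_Y \<Longrightarrow> f \<in> L2 M"
  by (simp add: on_Y_def L2_0_def)

lemma lazy_on_Y:
  assumes "f \<in> on_Y"
  shows "X.lazy f \<in> on_Y"
proof -
  have "X.lazy f \<in> L2_0 M"
    using X.lazy_L2_0[OF finite_measure_axioms] assms by (simp add: on_Y_def)
  moreover have "X.lazy f x = 0" if x: "x \<in> space M - Y" for x
  proof -
    have "f (\<phi> t x) = 0" if "t \<in> T" for t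
    proof -
      have "t \<in> K" "t \<in> carrier G" using that T_sub_K T_props(3) by auto
      then have "\<phi> t x \<in> space M - Y" using Y_iff[of t x] action_space[of t x] x by simp
      then show ?thesis using assms by (simp add: on_Y_def)
    qed
    then show ?thesis using x assms by (simp add: X.lazy_def X.avg_def on_Y_def)
  qed
  ultimately show ?thesis by (simp add: on_Y_def)
qed

lemma lazy_pow_on_Y: "f \<in> on_Y \<Longrightarrow> (X.lazy ^^ n) f \<in> on_Y"
  by (induction n) (auto intro: lazy_on_Y)

text \<open>As L = lazy is self-adjoint, <L^i g, L^j g> depends on i + j only, and the squared norms
  b n decrease to a limit. For v n = L^(2n) g the squared distance of v m and v n is b(2m) + b(2n) -
  2 b(m + n), so v is Cauchy. Its limit is invariant under T, has mean zero and vanishes off Y, so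
  ergodicity makes it zero.\<close>

lemma mean_ergodic:
  assumes g: "g \<in> on_Y"
  shows "(\<lambda>n. L2_norm M ((X.lazy ^^ n) g)) \<longlonglongrightarrow> 0"
proof -
  have gL: "g \<in> L2 M" by (rule on_Y_L2[OF g])
  note pL = X.lazy_pow_L2[OF gL]
  define b where "b n = (L2_norm M ((X.lazy ^^ n) g))\<^sup>2" for n
  have dec: "L2_norm M ((X.lazy ^^ Suc n) g) \<le> L2_norm M ((X.lazy ^^ n) g)" for n
    using X.lazy_contraction[OF pL] by simp
  have bdec: "decseq b"
    unfolding b_def by (intro decseq_SucI power_mono dec) auto
  have b0: "b n \<ge> 0" for n by (simp add: b_def)
  obtain \<beta> where \<beta>: "b \<longlonglongrightarrow> \<beta>"
    using decseq_convergent[OF bdec, of 0] b0 by blast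
  have b_le: "b n \<ge> \<beta>" for n
    using decseq_ge[OF bdec \<beta>] .
  \<comment> \<open>Even exponents make the inner product of any two of these functions a value of
    b.\<close>
  define v where "v n = (X.lazy ^^ (2 * n)) g" for n
  have vL: "v n \<in> L2 M" for n unfolding v_def by (rule pL)
  have inner: "L2_inner M ((X.lazy ^^ i) g) ((X.lazy ^^ j) g) = L2_inner M ((X.lazy ^^ (i + j)) g) g" for i j
    using X.lazy_pow_adjoint[OF pL gL, of j i]
    by (simp add: funpow_add add.commute[of i j])
  have vv: "L2_inner M (v m) (v n) = b (m + n)" for m n
  proof -
    have "2 * m + 2 * n = (m + n) + (m + n)" by simp
    then show ?thesis unfolding v_def b_def L2_norm_power2 inner by (simp only:)
  qed
  have dist: "(L2_norm M (\<lambda>x. v m x - v n x))\<^sup>2 = b (2 * m) + b (2 * n) - 2 * b (m + n)" for m n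
    using vL by (simp add: L2_norm_power2 L2_inner_diff_left L2_inner_diff_right L2_diff vv)
      (simp add: mult_2 add.commute[of n m])
  have "\<exists>w r. w \<in> L2 M \<and> (AE x in M. (\<lambda>k. v (r k) x) \<longlonglongrightarrow> w x) \<and>
      (\<lambda>n. L2_norm M (\<lambda>x. v n x - w x)) \<longlonglongrightarrow> 0"
  proof -
    have "\<exists>N. \<forall>m\<ge>N. \<forall>n\<ge>N. L2_norm M (\<lambda>x. v m x - v n x) \<le> e" if "e > 0" for e
    proof -
      have "\<beta> < \<beta> + e\<^sup>2 / 2" using that by simp
      from order_tendstoD(2)[OF \<beta> this] obtain N where N: "\<And>n. n \<ge> N \<Longrightarrow> b n < \<beta> + e\<^sup>2 / 2"
        by (auto simp: eventually_sequentially)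
      show ?thesis
      proof (intro exI allI impI)
        fix m n assume "N \<le> m" "N \<le> n"
        then have "(L2_norm M (\<lambda>x. v m x - v n x))\<^sup>2 \<le> e\<^sup>2"
          using N[of "2 * m"] N[of "2 * n"] b_le[of "m + n"] unfolding dist by simp
        then show "L2_norm M (\<lambda>x. v m x - v n x) \<le> e"
          by (rule power2_le_imp_le) (use that in simp)
      qed
    qed
    from L2_complete[OF vL this] show ?thesis by blast
  qed
  then obtain w r where w: "w \<in> L2 M" "AE x in M. (\<lambda>k. v (r k) x) \<longlonglongrightarrow> w x"
    "(\<lambda>n. L2_norm M (\<lambda>x. v n x - w x)) \<longlonglongrightarrow> 0" by blast
  have von: "v n \<in> on_Y" for n unfolding v_def by (rule lazy_pow_on_Y[OF g])
  have off: "AE x in M. x \<notin> Y \<longrightarrow> w x = 0"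
    using w(2) AE_space
  proof eventually_elim
    case (elim x)
    show ?case
    proof
      assume "x \<notin> Y"
      then have "v (r k) x = 0" for k using von[of "r k"] elim by (simp add: on_Y_def)
      then show "w x = 0" using elim(1) LIMSEQ_unique[OF elim(1)] by (simp add: tendsto_const_iff)
    qed
  qed
  have "\<bar>LINT x|M. w x\<bar> \<le> L2_norm M (\<lambda>x. v n x - w x)" for n
  proof -
    have "(LINT x|M. v n x - w x) = - (LINT x|M. w x)"
      using von[of n] L2_integrable[OF vL[of n]] L2_integrable[OF w(1)]
      by (simp add: on_Y_def L2_0_def)
    then have "(LINT x|M. w x)\<^sup>2 \<le> (L2_norm M (\<lambda>x. v n x - w x))\<^sup>2"
      using integral_square_le[OF L2_diff[OF vL[of n] w(1)]] by simp
    then show ?thesis using abs_le_square_iff[of "LINT x|M. w x" "L2_norm M (\<lambda>x. v n x - w x)"] by simp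
  qed
  then have "\<bar>LINT x|M. w x\<bar> \<le> 0"
    by (intro LIMSEQ_le_const[OF w(3)]) auto
  then have w0: "w \<in> L2_0 M" using w(1) by (simp add: L2_0_def)
  have inv: "disp t w = 0" if t: "t \<in> T" for t
  proof -
    have tc: "t \<in> carrier G" using t T_props by blast
    \<comment> \<open>The displacement is controlled by the drop of b, since <L v, v> >= |L v|^2,
      and the drops tend to 0.\<close>
    have small: "(disp t (v n))\<^sup>2 \<le> 4 * card T * (b (2 * n) - b (2 * n + 1))" for n
    proof -
      have "(disp t (v n))\<^sup>2 \<le> 4 * card T * ((L2_norm M (v n))\<^sup>2 - L2_inner M (X.lazy (v n)) (v n))"
        unfolding disp_def by (rule X.displacement_le[OF vL t])
      also have "\<dots> \<le> 4 * card T * (b (2 * n) - b (2 * n + 1))"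
        using X.lazy_norm_le_inner[OF vL, of n] by (intro mult_left_mono) (auto simp: b_def v_def)
      finally show ?thesis .
    qed
    have "(\<lambda>n. 4 * card T * (b (2 * n) - b (2 * n + 1))) \<longlonglongrightarrow> 4 * card T * (\<beta> - \<beta>)"
      by (intro tendsto_intros LIMSEQ_subseq_LIMSEQ[OF \<beta>, unfolded comp_def])
        (auto simp: strict_mono_def)
    then have l: "(\<lambda>n. 4 * card T * (b (2 * n) - b (2 * n + 1))) \<longlonglongrightarrow> 0" by simp
    have "(\<lambda>n. (disp t (v n))\<^sup>2) \<longlonglongrightarrow> 0"
      by (rule tendsto_sandwich[OF _ _ tendsto_const l]) (use small in auto)
    then have d0: "(\<lambda>n. disp t (v n)) \<longlonglongrightarrow> 0"
      using tendsto_real_sqrt[of "\<lambda>n. (disp t (v n))\<^sup>2" 0] by (simp add: disp_nonneg)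
    have "disp t w \<le> 2 * L2_norm M (\<lambda>x. v n x - w x) + disp t (v n)" for n
    proof -
      have "disp t w \<le> L2_norm M (\<lambda>x. w (\<phi> t x) - v n (\<phi> t x)) + L2_norm M (\<lambda>x. v n (\<phi> t x) - w x)"
        unfolding disp_def using compose_L2[OF tc w(1)] compose_L2[OF tc vL[of n]] w(1)
        by (rule L2_norm_triangle_diff)
      also have "L2_norm M (\<lambda>x. v n (\<phi> t x) - w x) \<le> disp t (v n) + L2_norm M (\<lambda>x. v n x - w x)"
        unfolding disp_def using compose_L2[OF tc vL[of n]] vL[of n] w(1)
        by (rule L2_norm_triangle_diff)
      also have "L2_norm M (\<lambda>x. w (\<phi> t x) - v n (\<phi> t x)) = L2_norm M (\<lambda>x. w x - v n x)"
        using L2_norm_compose[OF action_mp[OF tc] L2_diff[OF w(1) vL[of n]]] .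
      finally show ?thesis by (simp add: L2_norm_minus_commute[of M w])
    qed
    moreover have "(\<lambda>n. 2 * L2_norm M (\<lambda>x. v n x - w x) + disp t (v n)) \<longlonglongrightarrow> 2 * 0 + 0"
      by (intro tendsto_intros w(3) d0)
    ultimately have "disp t w \<le> 2 * 0 + 0"
      by (intro LIMSEQ_le_const) auto
    then show ?thesis using disp_nonneg[of t w] by simp
  qed
  have wz: "AE x in M. w x = 0" by (rule ergodic_zero[OF w0 off inv])
  have "L2_norm M (\<lambda>x. v n x - w x) = L2_norm M (v n)" for n
  proof (rule L2_norm_cong_AE)
    show "AE x in M. v n x - w x = v n x" using wz by eventually_elim simp
  qed (use L2_measurable[OF vL] L2_measurable[OF w(1)] in auto)
  with w(3) have v0: "(\<lambda>n. L2_norm M (v n)) \<longlonglongrightarrow> 0" by simp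
  show ?thesis
  proof (rule LIMSEQ_I)
    fix e :: real assume "e > 0"
    from LIMSEQ_D[OF v0 this] obtain N where N: "\<And>n. n \<ge> N \<Longrightarrow> L2_norm M (v n) < e" by auto
    have mono: "L2_norm M ((X.lazy ^^ n) g) \<le> L2_norm M (v N)" if "n \<ge> 2 * N" for n
      unfolding v_def using lift_Suc_antimono_le[of "\<lambda>n. L2_norm M ((X.lazy ^^ n) g)", OF dec that] .
    show "\<exists>N. \<forall>n\<ge>N. norm (L2_norm M ((X.lazy ^^ n) g) - 0) < e"
      by (intro exI[of _ "2 * N"]) (use mono N[of N] in \<open>force intro: le_less_trans\<close>)
  qed
qed

text \<open>States that 1 is an approximate eigenvalue of \<open>lazy\<close> on the mean-zero
  functions of the component.\<close>

definition no_gap :: bool where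
  "no_gap \<longleftrightarrow> (\<forall>\<eta>>0. \<exists>f\<in>on_Y. L2_norm M f = 1 \<and> L2_inner M (X.lazy f) f \<ge> 1 - \<eta>)"

text \<open>Mean ergodicity supplies n with L^n (f i) small for the functions already found, and a
  new h is taken so invariant that L^n h is close to h. Then <f i, h> = <L^n (f i), h> - <f i, L^n h
  - h> is small.\<close>

lemma almost_orthonormal_family:
  assumes "no_gap" and \<eta>: "\<eta> > 0" and \<tau>: "\<tau> > 0"
  shows "\<exists>f :: nat \<Rightarrow> 'x \<Rightarrow> real. (\<forall>i<N. f i \<in> on_Y \<and> L2_norm M (f i) = 1 \<and> L2_inner M (X.lazy (f i)) (f i) \<ge> 1 - \<eta>)
    \<and> (\<forall>i<N. \<forall>j<N. i \<noteq> j \<longrightarrow> \<bar>L2_inner M (f i) (f j)\<bar> \<le> \<tau>)"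
proof (induction N)
  case (Suc N)
  then obtain f :: "nat \<Rightarrow> 'x \<Rightarrow> real" where f: "\<And>i. i < N \<Longrightarrow> f i \<in> on_Y"
    "\<And>i. i < N \<Longrightarrow> L2_norm M (f i) = 1" "\<And>i. i < N \<Longrightarrow> L2_inner M (X.lazy (f i)) (f i) \<ge> 1 - \<eta>"
    "\<And>i j. i < N \<Longrightarrow> j < N \<Longrightarrow> i \<noteq> j \<Longrightarrow> \<bar>L2_inner M (f i) (f j)\<bar> \<le> \<tau>" by blast
  have "eventually (\<lambda>n. \<forall>i\<in>{..<N}. L2_norm M ((X.lazy ^^ n) (f i)) < \<tau> / 2) sequentially"
    using order_tendstoD(2)[OF mean_ergodic[OF f(1)], of _ "\<tau> / 2"] \<tau>
    by (intro eventually_ball_finite) auto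
  then obtain n where n: "\<And>i. i < N \<Longrightarrow> L2_norm M ((X.lazy ^^ n) (f i)) < \<tau> / 2"
    using eventually_happens'[OF sequentially_bot] by blast
  \<comment> \<open>n is fixed before h, so a one-step displacement \<theta> costs at most n
    \<theta> \<le> \<tau>/2 over n steps; the added 1 covers n = 0.\<close>
  define \<theta> where "\<theta> = \<tau> / (2 * (real n + 1))"
  have \<theta>: "\<theta> > 0" "real n * \<theta> \<le> \<tau> / 2" using \<tau> by (auto simp: \<theta>_def field_simps)
  \<comment> \<open>\<eta> is what the family demands of the new function, the square of \<theta>
    controls its displacement through \<open>lazy_displacement\<close>.\<close>
  have "min \<eta> (\<theta>\<^sup>2) > 0" using \<eta> \<theta> by simp
  then obtain h where h: "h \<in> on_Y" "L2_norm M h = 1" "L2_inner M (X.lazy h) h \<ge> 1 - min \<eta> (\<theta>\<^sup>2)"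
    using assms(1) unfolding no_gap_def by blast
  have hL: "h \<in> L2 M" by (rule on_Y_L2[OF h(1)])
  have "(L2_norm M (\<lambda>x. X.lazy h x - h x))\<^sup>2 \<le> \<theta>\<^sup>2"
    using X.lazy_displacement[OF hL] h by simp
  then have dh: "L2_norm M (\<lambda>x. X.lazy h x - h x) \<le> \<theta>"
    by (rule power2_le_imp_le) (use \<theta> in simp)
  have small: "\<bar>L2_inner M (f i) h\<bar> \<le> \<tau>" if i: "i < N" for i
  proof -
    have fL: "f i \<in> L2 M" by (rule on_Y_L2[OF f(1)[OF i]])
    let ?d = "\<lambda>x. (X.lazy ^^ n) h x - h x"
    have dL: "?d \<in> L2 M" by (intro L2_diff X.lazy_pow_L2 hL)
    have "L2_inner M (f i) h = L2_inner M ((X.lazy ^^ n) (f i)) h - L2_inner M (f i) ?d"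
      using X.lazy_pow_adjoint[OF fL hL, of n] fL hL by (simp add: L2_inner_diff_right X.lazy_pow_L2)
    moreover have "\<bar>L2_inner M ((X.lazy ^^ n) (f i)) h\<bar> \<le> \<tau> / 2"
      using L2_Cauchy_Schwarz[OF X.lazy_pow_L2[OF fL] hL, of n] n[OF i] h(2) by simp
    moreover have "\<bar>L2_inner M (f i) ?d\<bar> \<le> \<tau> / 2"
    proof -
      have "\<bar>L2_inner M (f i) ?d\<bar> \<le> L2_norm M ?d"
        using L2_Cauchy_Schwarz[OF fL dL] f(2)[OF i] by simp
      also have "\<dots> \<le> real n * L2_norm M (\<lambda>x. X.lazy h x - h x)"
        by (rule X.lazy_pow_displacement[OF hL])
      also have "\<dots> \<le> real n * \<theta>" by (intro mult_left_mono dh) simp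
      finally show ?thesis using \<theta>(2) by simp
    qed
    ultimately show ?thesis by linarith
  qed
  define f' where "f' = f(N := h)"
  show ?case
  proof (intro exI[of _ f'] conjI allI impI)
    fix i assume "i < Suc N"
    then show "f' i \<in> on_Y" "L2_norm M (f' i) = 1" "L2_inner M (X.lazy (f' i)) (f' i) \<ge> 1 - \<eta>"
      using f h by (auto simp: f'_def less_Suc_eq)
  next
    fix i j assume "i < Suc N" "j < Suc N" "i \<noteq> j"
    then show "\<bar>L2_inner M (f' i) (f' j)\<bar> \<le> \<tau>"
      using f(4) small by (auto simp: f'_def less_Suc_eq L2_inner_commute[of M h])
  qed
qed simp

end

section \<open>Spectral gap on ergodic components\<close>

text \<open>The unit vector along u is rounded to the grid of mesh 1/J, so finitely many coefficient
  vectors serve all u. Each of the N roundings costs at most 1/J, and N/J = 1/10: the pairing with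
  the unit vector is at least 9/10, whose square exceeds 2/3, and the squared length is at most 1 +
  3/10.\<close>

lemma grid_vector:
  fixes u :: "nat \<Rightarrow> real" and N J :: nat
  assumes N: "N \<ge> 1" and J: "J = 10 * N"
  shows "\<exists>z\<in>PiE {..<N} (\<lambda>_. {- int J..int J}).
    (\<Sum>i<N. (z i / J)\<^sup>2) \<le> 2 \<and> 2 / 3 * (\<Sum>i<N. (u i)\<^sup>2) \<le> (\<Sum>i<N. z i / J * u i)\<^sup>2"
proof (cases "(\<Sum>i<N. (u i)\<^sup>2) = 0")
  case True
  have "(\<lambda>i\<in>{..<N}. 0) \<in> PiE {..<N} (\<lambda>_. {- int J..int J})" by auto
  then show ?thesis using True by (intro bexI[of _ "\<lambda>i\<in>{..<N}. 0"]) auto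
next
  case False
  define s where "s = sqrt (\<Sum>i<N. (u i)\<^sup>2)"
  have sum0: "(\<Sum>i<N. (u i)\<^sup>2) \<ge> 0" by (intro sum_nonneg) auto
  then have s: "s > 0" "s\<^sup>2 = (\<Sum>i<N. (u i)\<^sup>2)" using False by (auto simp: s_def)
  define y where "y i = u i / s" for i
  have y1: "(\<Sum>i<N. (y i)\<^sup>2) = 1"
    unfolding y_def power_divide sum_divide_distrib[symmetric] s(2)[symmetric] using s(1) by simp
  have yb: "\<bar>y i\<bar> \<le> 1" if "i < N" for i
  proof -
    have "(y i)\<^sup>2 \<le> (\<Sum>i<N. (y i)\<^sup>2)" using that by (intro member_le_sum) auto
    then show ?thesis using y1 by (simp add: abs_square_le_1)
  qed
  have Jp: "real J > 0" using N J by simp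
  define z where "z = (\<lambda>i\<in>{..<N}. \<lfloor>J * y i\<rfloor>)"
  have zi: "z i = \<lfloor>J * y i\<rfloor>" if "i < N" for i using that by (simp add: z_def)
  have diff: "\<bar>z i / J - y i\<bar> \<le> 1 / J" if i: "i < N" for i
  proof -
    have "\<bar>real_of_int (z i) - J * y i\<bar> \<le> 1" unfolding zi[OF i] by linarith
    then have "\<bar>real_of_int (z i) - J * y i\<bar> / J \<le> 1 / J" using Jp by (intro divide_right_mono) auto
    moreover have "\<bar>real_of_int (z i) - J * y i\<bar> / J = \<bar>z i / J - y i\<bar>"
      using Jp by (simp add: field_simps abs_divide[symmetric])
    ultimately show ?thesis by simp
  qed
  have "z \<in> PiE {..<N} (\<lambda>_. {- int J..int J})"
  proof
    fix i assume "i \<in> {..<N}"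
    then have "- (real J) \<le> J * y i" "J * y i \<le> J"
      using yb[of i] Jp mult_left_mono[of "y i" 1 "real J"] mult_left_mono[of "-1" "y i" "real J"]
      by (auto simp: abs_le_iff)
    then show "z i \<in> {- int J..int J}"
      using \<open>i \<in> {..<N}\<close> by (auto simp: zi le_floor_iff floor_le_iff)
  qed (simp add: z_def)
  moreover have "(\<Sum>i<N. (z i / J)\<^sup>2) \<le> 2"
  proof -
    have "(z i / J)\<^sup>2 \<le> (y i)\<^sup>2 + 3 / J" if i: "i < N" for i
    proof -
      define \<epsilon> where "\<epsilon> = z i / J - y i"
      have e: "\<bar>\<epsilon>\<bar> \<le> 1 / J" using diff[OF i] by (simp add: \<epsilon>_def)
      have J1: "1 / real J \<le> 1" using N J by simp
      have "(z i / J)\<^sup>2 = (y i)\<^sup>2 + 2 * (y i * \<epsilon>) + \<epsilon> * \<epsilon>"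
        by (simp add: \<epsilon>_def power2_eq_square algebra_simps)
      moreover have "y i * \<epsilon> \<le> 1 / J"
        using mult_mono[OF yb[OF i] e] by (simp flip: abs_mult)
      moreover have "\<epsilon> * \<epsilon> \<le> 1 / J"
        using mult_mono[of "\<bar>\<epsilon>\<bar>" 1 "\<bar>\<epsilon>\<bar>" "1 / J"] e J1 by (simp flip: abs_mult)
      ultimately show ?thesis by (simp add: add_divide_distrib)
    qed
    then have "(\<Sum>i<N. (z i / J)\<^sup>2) \<le> (\<Sum>i<N. (y i)\<^sup>2 + 3 / J)" by (intro sum_mono) auto
    also have "\<dots> = 1 + N * 3 / J" by (simp add: sum.distrib y1)
    also have "\<dots> \<le> 2" using N J by simp
    finally show ?thesis .
  qed
  moreover have "2 / 3 * (\<Sum>i<N. (u i)\<^sup>2) \<le> (\<Sum>i<N. z i / J * u i)\<^sup>2"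
  proof -
    have "(y i)\<^sup>2 - 1 / J \<le> z i / J * y i" if i: "i < N" for i
    proof -
      have "\<bar>(z i / J - y i) * y i\<bar> \<le> 1 / J * 1"
        unfolding abs_mult by (intro mult_mono diff yb i) auto
      then show ?thesis by (simp add: algebra_simps power2_eq_square abs_le_iff)
    qed
    then have "(\<Sum>i<N. (y i)\<^sup>2 - 1 / J) \<le> (\<Sum>i<N. z i / J * y i)" by (intro sum_mono) auto
    moreover have "(\<Sum>i<N. (y i)\<^sup>2 - 1 / J) = 9 / 10"
      using N J by (simp add: sum_subtractf y1)
    ultimately have 9: "9 / 10 \<le> (\<Sum>i<N. z i / J * y i)" by simp
    have "(\<Sum>i<N. z i / J * u i) = s * (\<Sum>i<N. z i / J * y i)"
      using s(1) by (simp add: y_def sum_distrib_left)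
    then have "(\<Sum>i<N. z i / J * u i)\<^sup>2 = s\<^sup>2 * (\<Sum>i<N. z i / J * y i)\<^sup>2"
      by (simp add: power_mult_distrib)
    also have "\<dots> \<ge> s\<^sup>2 * (9 / 10)\<^sup>2"
      using 9 by (intro mult_left_mono power_mono) auto
    also have "s\<^sup>2 * (9 / 10)\<^sup>2 \<ge> 2 / 3 * s\<^sup>2" by (simp add: power2_eq_square)
    finally show ?thesis using s(2) by simp
  qed
  ultimately show ?thesis by blast
qed

context ergodic_component
begin

text \<open>Among the normalized combinations of \<^term>\<open>N\<close> almost orthonormal functions one is of size
  about the square root of \<^term>\<open>N\<close> on a part of the space that is not too small: at every point the
  best combination is, and finitely many combinations suffice.  Cutting it off at that height
  produces an almost invariant nonnegative function with small support.\<close>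

lemma gap_of_spread:
  assumes Q: "finite Q" "Q \<subseteq> K" and e: "e > 0" and d: "d > 0"
    and spread: "\<And>f. f \<in> L2 M \<Longrightarrow> \<forall>x. f x \<ge> 0 \<Longrightarrow> \<forall>h\<in>Q. disp h f \<le> e * L2_norm M f \<Longrightarrow>
      d * (L2_norm M f)\<^sup>2 \<le> (LINT x|M. f x)\<^sup>2"
  shows "\<not> no_gap"
proof
  assume "no_gap"
  \<comment> \<open>The function built below has squared integral at most 24/N times its squared
    norm, so N must exceed 24/d.\<close>
  obtain N0 :: nat where N0: "24 / d < N0" using reals_Archimedean2 by blast
  define N where "N = Suc N0"
  have N: "N \<ge> 1" "24 / d < N" using N0 by (auto simp: N_def)
  define J where "J = 10 * N"
  define \<Omega> where "\<Omega> = {z \<in> PiE {..<N} (\<lambda>_. {- int J..int J}). (\<Sum>i<N. (z i / J)\<^sup>2) \<le> 2}"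
  have fin: "finite \<Omega>" unfolding \<Omega>_def by (rule finite_subset[OF Collect_subset]) (auto intro: finite_PiE)
  have "\<Omega> \<noteq> {}" using grid_vector[OF N(1) J_def, of "\<lambda>_. 0"] by (auto simp: \<Omega>_def)
  then have \<Omega>0: "card \<Omega> > 0" using fin by (simp add: card_gt_0_iff)
  \<comment> \<open>Lower bound for the squared norm of the truncated function. It depends on N
    alone, so tolerances can be fixed before the functions are chosen. A total of N/6 is averaged
    over \<Omega>, and truncation costs a factor 4.\<close>
  define \<gamma> where "\<gamma> = N / (24 * card \<Omega>)"
  have \<gamma>: "\<gamma> > 0" using N \<Omega>0 by (simp add: \<gamma>_def)
  have "\<forall>h\<in>Q. \<exists>C\<ge>0. \<forall>f\<in>L2 M. \<forall>e\<ge>0. (\<forall>t\<in>T. disp t f \<le> e) \<longrightarrow> disp h f \<le> C * e"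
    using disp_generate[OF T_props(3)] Q(2) T_props(5) by blast
  then obtain C where C: "\<And>h. h \<in> Q \<Longrightarrow> C h \<ge> 0"
    "\<And>h f e. h \<in> Q \<Longrightarrow> f \<in> L2 M \<Longrightarrow> e \<ge> 0 \<Longrightarrow> \<forall>t\<in>T. disp t f \<le> e \<Longrightarrow> disp h f \<le> C h * e"
    by metis
  define D where "D = (\<Sum>h\<in>Q. C h) + 1"
  have D: "D > 0" "\<And>h. h \<in> Q \<Longrightarrow> C h \<le> D"
  proof -
    show "D > 0" unfolding D_def using C(1) by (intro add_nonneg_pos sum_nonneg) auto
    show "C h \<le> D" if "h \<in> Q" for h
      using member_le_sum[of h Q C] that C(1) Q(1) by (simp add: D_def)
  qed
  \<comment> \<open>A combination has N summands with coefficients of size at most 1, each displaced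
    by at most D \<theta> under Q. Together this is e sqrt \<gamma>, at most e times the norm of the
    truncated function.\<close>
  define \<theta> where "\<theta> = e * sqrt \<gamma> / (N * D)"
  have \<theta>: "\<theta> > 0" "N * (D * \<theta>) = e * sqrt \<gamma>" using e \<gamma> D N by (auto simp: \<theta>_def)
  \<comment> \<open>Makes 4 card T \<eta> the square of \<theta>, to match
    \<open>displacement_le\<close>.\<close>
  define \<eta> where "\<eta> = \<theta>\<^sup>2 / (4 * card T)"
  have \<eta>: "\<eta> > 0" using \<theta> X.card_I by (simp add: \<eta>_def)
  \<comment> \<open>With inner products of size at most 1/N^2 the cross terms of a combination add
    up to at most 1, so its squared norm is at most 2 + 1.\<close>
  obtain f where f: "\<And>i. i < N \<Longrightarrow> f i \<in> on_Y"
    "\<And>i. i < N \<Longrightarrow> L2_norm M (f i) = 1" "\<And>i. i < N \<Longrightarrow> L2_inner M (X.lazy (f i)) (f i) \<ge> 1 - \<eta>"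
    "\<And>i j. i < N \<Longrightarrow> j < N \<Longrightarrow> i \<noteq> j \<Longrightarrow> \<bar>L2_inner M (f i) (f j)\<bar> \<le> 1 / (real N)\<^sup>2"
    using almost_orthonormal_family[OF \<open>no_gap\<close> \<eta>, of "1 / (real N)\<^sup>2" N] N by auto
  have fL: "f i \<in> L2 M" if "i < N" for i using on_Y_L2[OF f(1)[OF that]] .
  have dQ: "disp h (f i) \<le> D * \<theta>" if h: "h \<in> Q" and i: "i < N" for h i
  proof -
    have "disp t (f i) \<le> \<theta>" if t: "t \<in> T" for t
    proof (rule power2_le_imp_le)
      have "(disp t (f i))\<^sup>2 \<le> 4 * card T * ((L2_norm M (f i))\<^sup>2 - L2_inner M (X.lazy (f i)) (f i))"
        unfolding disp_def by (rule X.displacement_le[OF fL[OF i] t])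
      also have "\<dots> \<le> 4 * card T * \<eta>"
        using f(2,3)[OF i] by (intro mult_left_mono) auto
      also have "\<dots> = \<theta>\<^sup>2" using X.card_I by (simp add: \<eta>_def)
      finally show "(disp t (f i))\<^sup>2 \<le> \<theta>\<^sup>2" .
    qed (use \<theta> in simp)
    then have "disp h (f i) \<le> C h * \<theta>" using C(2)[OF h fL[OF i]] \<theta> by simp
    also have "\<dots> \<le> D * \<theta>" using D(2)[OF h] \<theta> by simp
    finally show ?thesis .
  qed
  define F where "F z x = (\<Sum>i<N. z i / J * f i x)" for z :: "nat \<Rightarrow> int" and x
  have FL: "F z \<in> L2 M" for z unfolding F_def[abs_def] by (intro L2_sum L2_scale fL) simp
  \<comment> \<open>At every point some z in \<Omega> makes (F z)^2 at least 2/3 of the sum of the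
    squares of the f i, which has integral N. After subtraction of N/2 at least N/6 is shared among
    the members of \<Omega>, so one of them gets the average.\<close>
  have "\<exists>z\<in>\<Omega>. N / (6 * card \<Omega>) \<le> (LINT x|M. max 0 ((F z x)\<^sup>2 - N / 2))"
  proof (rule ccontr)
    assume "\<not> ?thesis"
    then have lt: "(LINT x|M. max 0 ((F z x)\<^sup>2 - N / 2)) < N / (6 * card \<Omega>)" if "z \<in> \<Omega>" for z
      using that by (auto simp: not_le)
    have int: "integrable M (\<lambda>x. max 0 ((F z x)\<^sup>2 - N / 2))" for z
      using FL[of z] by (intro Bochner_Integration.integrable_max) (auto simp: L2_def)
    have intf: "integrable M (\<lambda>x. (f i x)\<^sup>2)" if "i < N" for i
      using fL[OF that] by (simp add: L2_def)
    have "real N / 6 = 2 / 3 * (\<Sum>i<N. (L2_norm M (f i))\<^sup>2) - N / 2"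
      using f(2) by simp
    also have "\<dots> = (LINT x|M. 2 / 3 * (\<Sum>i<N. (f i x)\<^sup>2) - N / 2)"
    proof -
      have "(L2_norm M (f i))\<^sup>2 = (LINT x|M. (f i x)\<^sup>2)" for i
        unfolding L2_norm_power2 L2_inner_def by (simp add: power2_eq_square)
      moreover have "(LINT x|M. 2 / 3 * (\<Sum>i<N. (f i x)\<^sup>2) - N / 2)
          = 2 / 3 * (\<Sum>i<N. (LINT x|M. (f i x)\<^sup>2)) - N / 2"
      proof -
        have i: "integrable M (\<lambda>x. \<Sum>i<N. (f i x)\<^sup>2)"
          using intf by (intro Bochner_Integration.integrable_sum) auto
        have "(LINT x|M. 2 / 3 * (\<Sum>i<N. (f i x)\<^sup>2) - N / 2)
            = 2 / 3 * (LINT x|M. (\<Sum>i<N. (f i x)\<^sup>2)) - N / 2"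
          using i by (subst Bochner_Integration.integral_diff) (auto simp: prob_space)
        also have "(LINT x|M. (\<Sum>i<N. (f i x)\<^sup>2)) = (\<Sum>i<N. (LINT x|M. (f i x)\<^sup>2))"
          using intf by (intro Bochner_Integration.integral_sum) auto
        finally show ?thesis .
      qed
      ultimately show ?thesis by simp
    qed
    also have "\<dots> \<le> (LINT x|M. (\<Sum>z\<in>\<Omega>. max 0 ((F z x)\<^sup>2 - N / 2)))"
    proof (rule integral_mono)
      show "integrable M (\<lambda>x. 2 / 3 * (\<Sum>i<N. (f i x)\<^sup>2) - real N / 2)"
        using intf by (intro Bochner_Integration.integrable_diff integrable_mult_right
            Bochner_Integration.integrable_sum) auto
      show "integrable M (\<lambda>x. \<Sum>z\<in>\<Omega>. max 0 ((F z x)\<^sup>2 - N / 2))"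
        by (intro Bochner_Integration.integrable_sum int)
      fix x
      obtain z where z: "z \<in> \<Omega>" "2 / 3 * (\<Sum>i<N. (f i x)\<^sup>2) \<le> (F z x)\<^sup>2"
        using grid_vector[OF N(1) J_def, of "\<lambda>i. f i x"] by (auto simp: \<Omega>_def F_def)
      have "2 / 3 * (\<Sum>i<N. (f i x)\<^sup>2) - real N / 2 \<le> max 0 ((F z x)\<^sup>2 - N / 2)" using z(2) by simp
      also have "\<dots> \<le> (\<Sum>z\<in>\<Omega>. max 0 ((F z x)\<^sup>2 - N / 2))"
        using z(1) fin by (intro member_le_sum) auto
      finally show "2 / 3 * (\<Sum>i<N. (f i x)\<^sup>2) - real N / 2 \<le> (\<Sum>z\<in>\<Omega>. max 0 ((F z x)\<^sup>2 - N / 2))" .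
    qed
    also have "\<dots> = (\<Sum>z\<in>\<Omega>. (LINT x|M. max 0 ((F z x)\<^sup>2 - N / 2)))"
      by (intro Bochner_Integration.integral_sum int)
    also have "\<dots> < (\<Sum>z\<in>\<Omega>. N / (6 * card \<Omega>))"
      using lt fin \<open>\<Omega> \<noteq> {}\<close> by (intro sum_strict_mono) auto
    also have "\<dots> = real N / 6" using \<Omega>0 by simp
    finally show False by simp
  qed
  then obtain z where z: "z \<in> \<Omega>" "N / (6 * card \<Omega>) \<le> (LINT x|M. max 0 ((F z x)\<^sup>2 - N / 2))" by blast
  have r2: "(\<Sum>i<N. (z i / J)\<^sup>2) \<le> 2" using z(1) by (simp add: \<Omega>_def)
  have r1: "\<bar>z i / J\<bar> \<le> 1" if "i < N" for i
  proof -
    have "z i \<in> {- int J..int J}" using z(1) that by (auto simp: \<Omega>_def PiE_def Pi_def)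
    then have "\<bar>real_of_int (z i)\<bar> \<le> J" by auto
    then show ?thesis using N by (simp add: J_def divide_le_eq_1)
  qed
  have FN: "(L2_norm M (F z))\<^sup>2 \<le> 3"
  proof -
    have "(L2_norm M (F z))\<^sup>2 = (\<Sum>i<N. \<Sum>j<N. z i / J * (z j / J * L2_inner M (f i) (f j)))"
    proof -
      have "L2_inner M (F z) (F z) = (\<Sum>i<N. L2_inner M (\<lambda>x. z i / J * f i x) (F z))"
        unfolding F_def[abs_def] by (intro L2_inner_sum_left L2_scale L2_sum fL) auto
      also have "\<dots> = (\<Sum>i<N. z i / J * (\<Sum>j<N. L2_inner M (f i) (\<lambda>x. z j / J * f j x)))"
        unfolding L2_inner_scale_left unfolding F_def[abs_def]
        by (intro sum.cong refl arg_cong2[where f="(*)"] L2_inner_sum_right L2_scale fL) auto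
      finally show ?thesis
        unfolding L2_norm_power2 L2_inner_scale_right by (simp only: sum_distrib_left)
    qed
    also have "\<dots> \<le> (\<Sum>i<N. \<Sum>j<N. (if i = j then (z i / J)\<^sup>2 else 0) + 1 / (real N)\<^sup>2)"
    proof (intro sum_mono)
      fix i j assume "i \<in> {..<N}" "j \<in> {..<N}"
      then have ij: "i < N" "j < N" by auto
      show "z i / J * (z j / J * L2_inner M (f i) (f j)) \<le> (if i = j then (z i / J)\<^sup>2 else 0) + 1 / (real N)\<^sup>2"
      proof (cases "i = j")
        case True
        then show ?thesis using f(2)[OF ij(1)] by (simp flip: L2_norm_power2) (simp add: power2_eq_square)
      next
        case False
        have "z i / J * (z j / J * L2_inner M (f i) (f j))
          \<le> \<bar>z i / J\<bar> * (\<bar>z j / J\<bar> * \<bar>L2_inner M (f i) (f j)\<bar>)"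
          by (metis abs_ge_self abs_mult)
        also have "\<dots> \<le> 1 * (1 * (1 / (real N)\<^sup>2))"
          using r1[OF ij(1)] r1[OF ij(2)] f(4)[OF ij False] by (intro mult_mono) auto
        finally show ?thesis using False by simp
      qed
    qed
    also have "\<dots> = (\<Sum>i<N. (z i / J)\<^sup>2) + 1"
      using N by (simp add: sum.distrib sum.delta power2_eq_square)
    finally show ?thesis using r2 by simp
  qed
  \<comment> \<open>Where (F z)^2 exceeds N/2 the height |F z| is at least 2 c, so cutting off c
    loses at most half of it.\<close>
  define c where "c = sqrt (N / 8)"
  have c: "c > 0" "c\<^sup>2 = N / 8" using N by (auto simp: c_def)
  define g where "g x = max 0 (\<bar>F z x\<bar> - c)" for x
  have gL: "g \<in> L2 M"
  proof (rule L2_bound[OF FL[of z]])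
    show "g \<in> borel_measurable M"
      unfolding g_def[abs_def] using L2_measurable[OF FL[of z]] by measurable
  qed (use c in \<open>auto simp: g_def\<close>)
  have gN: "\<gamma> \<le> (L2_norm M g)\<^sup>2"
  proof -
    have "4 * \<gamma> = N / (6 * card \<Omega>)" by (simp add: \<gamma>_def)
    also note z(2)
    also have "(LINT x|M. max 0 ((F z x)\<^sup>2 - N / 2)) \<le> (LINT x|M. 4 * (g x * g x))"
    proof (rule integral_mono)
      show "integrable M (\<lambda>x. max 0 ((F z x)\<^sup>2 - N / 2))"
        using FL[of z] by (intro Bochner_Integration.integrable_max) (auto simp: L2_def)
      show "integrable M (\<lambda>x. 4 * (g x * g x))"
        by (intro integrable_mult_right L2_integrable_mult gL)
      fix x
      show "max 0 ((F z x)\<^sup>2 - N / 2) \<le> 4 * (g x * g x)"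
      proof (cases "(F z x)\<^sup>2 \<le> N / 2")
        case False
        then have "(2 * c)\<^sup>2 \<le> \<bar>F z x\<bar>\<^sup>2" using c(2) by (simp add: power_mult_distrib)
        then have "2 * c \<le> \<bar>F z x\<bar>" by (rule power2_le_imp_le) simp
        then have "\<bar>F z x\<bar> \<le> 2 * g x" "g x \<ge> 0" by (auto simp: g_def)
        then have "\<bar>F z x\<bar>\<^sup>2 \<le> (2 * g x)\<^sup>2" by (intro power_mono) auto
        then have "(F z x)\<^sup>2 \<le> 4 * (g x * g x)" by (simp add: power2_eq_square)
        moreover have "0 \<le> g x * g x" "(0::real) \<le> real N / 2" by simp_all
        ultimately show ?thesis by linarith
      qed simp
    qed
    finally show ?thesis unfolding L2_norm_power2 L2_inner_def by simp
  qed
  have g0: "\<forall>x. g x \<ge> 0" by (simp add: g_def)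
  have inv: "disp h g \<le> e * L2_norm M g" if h: "h \<in> Q" for h
  proof -
    have hc: "h \<in> carrier G" using h Q K_carrier by blast
    \<comment> \<open>The cut-off t -> max 0 (|t| - c) is 1-Lipschitz, so it does not increase
      displacements.\<close>
    have "disp h g \<le> disp h (F z)"
      unfolding disp_def
    proof (rule L2_norm_mono)
      show "\<bar>g (\<phi> h x) - g x\<bar> \<le> \<bar>F z (\<phi> h x) - F z x\<bar>" for x
        unfolding g_def by linarith
    qed (intro L2_diff compose_L2 hc FL gL)+
    also have "disp h (F z) = L2_norm M (\<lambda>x. \<Sum>i<N. z i / J * (f i (\<phi> h x) - f i x))"
      by (simp add: disp_def F_def right_diff_distrib sum_subtractf)
    also have "\<dots> \<le> (\<Sum>i<N. L2_norm M (\<lambda>x. z i / J * (f i (\<phi> h x) - f i x)))"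
    proof (rule L2_norm_sum)
      fix i assume "i \<in> {..<N}"
      then have "f i \<in> L2 M" using fL by simp
      then show "(\<lambda>x. z i / J * (f i (\<phi> h x) - f i x)) \<in> L2 M"
        by (intro L2_scale[of "\<lambda>x. f i (\<phi> h x) - f i x"] L2_diff compose_L2 hc)
    qed
    also have "\<dots> = (\<Sum>i<N. \<bar>z i / J\<bar> * disp h (f i))"
      unfolding disp_def by (intro sum.cong refl L2_norm_scale)
    also have "\<dots> \<le> (\<Sum>i<N. 1 * (D * \<theta>))"
      using r1 dQ[OF h] by (intro sum_mono mult_mono) (auto simp: disp_nonneg)
    also have "\<dots> = e * sqrt \<gamma>" using \<theta>(2) by simp
    also have "\<dots> \<le> e * L2_norm M g"
      using gN e by (intro mult_left_mono real_le_lsqrt) auto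
    finally show ?thesis .
  qed
  have "d * (L2_norm M g)\<^sup>2 \<le> (LINT x|M. g x)\<^sup>2"
    using spread[OF gL g0] inv by blast
  \<comment> \<open>Since |F z| >= c where g is nonzero, c times the integral of g is at most <g, |F
    z|>. Cauchy-Schwarz with squared norm of F z at most 3 and c^2 = N/8 gives 24/N.\<close>
  also have "\<dots> \<le> 24 / N * (L2_norm M g)\<^sup>2"
  proof -
    have "c * (LINT x|M. g x) = (LINT x|M. c * g x)" by simp
    also have "\<dots> \<le> L2_inner M g (\<lambda>x. \<bar>F z x\<bar>)"
      unfolding L2_inner_def
    proof (rule integral_mono)
      show "integrable M (\<lambda>x. c * g x)" by (intro integrable_mult_right L2_integrable gL)
      show "integrable M (\<lambda>x. g x * \<bar>F z x\<bar>)" by (intro L2_integrable_mult gL L2_abs FL)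
      fix x
      show "c * g x \<le> g x * \<bar>F z x\<bar>"
        by (cases "c \<le> \<bar>F z x\<bar>") (auto simp: g_def max_def mult.commute intro!: mult_right_mono)
    qed
    also have "\<dots> \<le> L2_norm M g * L2_norm M (F z)"
    proof -
      have "L2_norm M (\<lambda>x. \<bar>F z x\<bar>) = L2_norm M (F z)" by (simp add: L2_norm_def L2_inner_def)
      then show ?thesis using L2_Cauchy_Schwarz[OF gL L2_abs[OF FL[of z]]] by simp
    qed
    finally have 1: "c * (LINT x|M. g x) \<le> L2_norm M g * L2_norm M (F z)" .
    have "0 \<le> (LINT x|M. g x)" using g0 by (intro Bochner_Integration.integral_nonneg) simp
    then have "(c * (LINT x|M. g x))\<^sup>2 \<le> (L2_norm M g * L2_norm M (F z))\<^sup>2"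
      using 1 c(1) by (intro power_mono) auto
    then have "N / 8 * (LINT x|M. g x)\<^sup>2 \<le> (L2_norm M g)\<^sup>2 * (L2_norm M (F z))\<^sup>2"
      by (simp add: power_mult_distrib c(2))
    also have "\<dots> \<le> (L2_norm M g)\<^sup>2 * 3" by (intro mult_left_mono FN) simp
    finally show ?thesis using N(1) by (simp add: field_simps)
  qed
  finally have "d \<le> 24 / N"
  proof -
    assume "d * (L2_norm M g)\<^sup>2 \<le> 24 / N * (L2_norm M g)\<^sup>2"
    moreover have "(L2_norm M g)\<^sup>2 > 0" using gN \<gamma> by linarith
    ultimately show ?thesis by (rule mult_right_le_imp_le)
  qed
  then show False using N d by (simp add: field_simps)
qed

end

section \<open>Passage to the normalized measure on a component\<close>

lemma integral_scale_measure:
  fixes f :: "'x \<Rightarrow> real"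
  assumes "f \<in> borel_measurable M" "r \<ge> 0"
  shows "(LINT x|scale_measure (ennreal r) M. f x) = r * (LINT x|M. f x)"
proof -
  have "scale_measure (ennreal r) M = density M (\<lambda>x. ennreal r)"
    by (rule measure_eqI) (auto simp: emeasure_density_const)
  then show ?thesis using integral_density[of f M "\<lambda>x. r"] assms by simp
qed

lemma integrable_scale_measure:
  fixes f :: "'x \<Rightarrow> real"
  assumes "f \<in> borel_measurable M" "r > 0"
  shows "integrable (scale_measure (ennreal r) M) f \<longleftrightarrow> integrable M f"
proof -
  have "scale_measure (ennreal r) M = density M (\<lambda>x. ennreal r)"
    by (rule measure_eqI) (auto simp: emeasure_density_const)
  then show ?thesis using integrable_density[of f M "\<lambda>x. r"] assms by simp
qed

context ergodic_component
begin

text \<open>Extension by zero carries mean-zero functions of the component into \<open>on_Y\<close>,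
  and the normalizing factor r cancels in the Rayleigh quotient. Since avg = 2 lazy - I, the bound 1
  - \<eta> for the lazy form becomes 1 - 2 \<eta>.\<close>

lemma spectral_gap_of_not_no_gap:
  assumes pos: "emeasure M Y > 0" and gap: "\<not> no_gap"
  shows "rho_plus (normalized_restriction M Y) (pushed_uniform \<phi> T) < 1"
proof -
  obtain \<eta> where \<eta>: "\<eta> > 0"
    "\<And>f. f \<in> on_Y \<Longrightarrow> L2_norm M f = 1 \<Longrightarrow> L2_inner M (X.lazy f) f < 1 - \<eta>"
    using gap unfolding no_gap_def by (auto simp: not_le)
  define r where "r = 1 / measure M Y"
  have mpos: "measure M Y > 0" using pos by (simp add: emeasure_eq_measure)
  have r: "r > 0" using mpos by (simp add: r_def)
  have "1 / emeasure M Y = ennreal r"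
    using mpos by (simp add: r_def emeasure_eq_measure divide_ennreal flip: ennreal_1)
  then have N: "normalized_restriction M Y = scale_measure (ennreal r) (restrict_space M Y)"
    by (simp add: normalized_restriction_def)
  have Ys: "Y \<inter> space M \<in> sets M" using Y(1) by auto
  have mb: "h \<in> borel_measurable (normalized_restriction M Y) \<longleftrightarrow>
      (\<lambda>x. indicator Y x * h x) \<in> borel_measurable M" for h :: "'x \<Rightarrow> real"
    using borel_measurable_restrict_space_iff[OF Ys, of h] unfolding N
    by (simp add: measurable_cong_sets[OF sets_scale_measure refl])
  have int: "(LINT x|normalized_restriction M Y. h x) = r * (LINT x|M. indicator Y x * h x)"
    if "h \<in> borel_measurable (normalized_restriction M Y)" for h :: "'x \<Rightarrow> real"
    using that r unfolding N
    by (simp add: integral_scale_measure measurable_cong_sets[OF sets_scale_measure refl]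
        integral_restrict_space[OF Ys])
  have integ: "integrable (normalized_restriction M Y) h \<longleftrightarrow> integrable M (\<lambda>x. indicator Y x * h x)"
    if "h \<in> borel_measurable (normalized_restriction M Y)" for h :: "'x \<Rightarrow> real"
    using that r unfolding N
    by (simp add: integrable_scale_measure measurable_cong_sets[OF sets_scale_measure refl]
        integrable_restrict_space[OF Ys])
  have "ereal (L2_inner (normalized_restriction M Y) (averaging (pushed_uniform \<phi> T) f) f /
      L2_inner (normalized_restriction M Y) f f) \<le> ereal (1 - 2 * \<eta>)"
    if f: "f \<in> L2_0 (normalized_restriction M Y)"
      and nz: "\<not> (AE x in normalized_restriction M Y. f x = 0)" for f
  proof -
    let ?N = "normalized_restriction M Y"
    define F where "F x = indicator Y x * f x" for x
    have fL: "f \<in> L2 ?N" using f by (simp add: L2_0_def)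
    have fm: "f \<in> borel_measurable ?N" by (rule L2_measurable[OF fL])
    have Fm: "F \<in> borel_measurable M" using mb[of f] fm by (simp add: F_def[abs_def])
    have FF: "(\<lambda>x. indicator Y x * (f x * f x)) = (\<lambda>x. F x * F x)"
      by (auto simp: F_def fun_eq_iff indicator_def)
    have ff: "(\<lambda>x. f x * f x) \<in> borel_measurable ?N" using fm by auto
    have FL: "F \<in> L2 M"
    proof (rule L2I[OF Fm])
      show "integrable M (\<lambda>x. F x * F x)"
        using integ[OF ff] L2_integrable_mult[OF fL fL] by (simp add: FF)
    qed
    have F0: "(LINT x|M. F x) = 0"
      using int[OF fm] f r by (simp add: L2_0_def F_def)
    have "F x = 0" if "x \<in> space M - Y" for x using that by (simp add: F_def)
    then have FY: "F \<in> on_Y" using FL F0 by (simp add: on_Y_def L2_0_def)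
    have norm: "L2_inner ?N f f = r * L2_inner M F F"
      using int[OF ff] by (simp add: L2_inner_def FF)
    \<comment> \<open>Invariance of Y makes the averages of f and of its extension by zero agree on
      Y.\<close>
    have avgY: "averaging (pushed_uniform \<phi> T) f x = X.avg F x" if "x \<in> Y" for x
    proof -
      have "\<phi> t x \<in> Y" if "t \<in> T" for t
        using that \<open>x \<in> Y\<close> T_sub_K Y_iff Y_space by blast
      then show ?thesis
        using T_props by (simp add: averaging_pushed_uniform X.avg_def F_def)
    qed
    have num: "L2_inner ?N (averaging (pushed_uniform \<phi> T) f) f = r * L2_inner M (X.avg F) F"
    proof -
      have eq: "(\<lambda>x. indicator Y x * (averaging (pushed_uniform \<phi> T) f x * f x)) = (\<lambda>x. X.avg F x * F x)"
        using avgY by (auto simp: F_def fun_eq_iff indicator_def)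
      have "(\<lambda>x. X.avg F x * F x) \<in> borel_measurable M"
        using L2_integrable_mult[OF X.avg_L2[OF FL] FL] by auto
      then have "(\<lambda>x. averaging (pushed_uniform \<phi> T) f x * f x) \<in> borel_measurable ?N"
        using mb[of "\<lambda>x. averaging (pushed_uniform \<phi> T) f x * f x"] by (simp only: eq)
      from int[OF this] show ?thesis by (simp add: L2_inner_def eq)
    qed
    have "L2_inner ?N f f \<noteq> 0" using nz L2_inner_eq_0_iff[OF fL] by simp
    then have Fpos: "L2_inner M F F > 0"
      using norm L2_inner_nonneg[of M F] by auto
    define n where "n = L2_norm M F"
    have n: "n > 0" "n\<^sup>2 = L2_inner M F F"
      using Fpos by (auto simp: n_def L2_norm_def)
    define g where "g x = (1 / n) * F x" for x
    have gL: "g \<in> L2 M" unfolding g_def by (rule L2_scale[OF FL])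
    have "(LINT x|M. g x) = 0" "\<And>x. x \<in> space M - Y \<Longrightarrow> g x = 0"
      using FY by (simp_all add: g_def on_Y_def L2_0_def)
    then have gY: "g \<in> on_Y" using gL by (simp add: on_Y_def L2_0_def)
    have "L2_norm M g = \<bar>1 / n\<bar> * n" unfolding g_def n_def by (rule L2_norm_scale)
    then have "L2_norm M g = 1" using n(1) by simp
    from \<eta>(2)[OF gY this] have "L2_inner M (X.lazy g) g < 1 - \<eta>" .
    moreover have "X.lazy g = (\<lambda>x. (1 / n) * X.lazy F x)"
      unfolding g_def by (rule X.lazy_scale)
    then have "L2_inner M (X.lazy g) g = (1 / n) * ((1 / n) * L2_inner M (X.lazy F) F)"
      by (simp only: g_def[abs_def] L2_inner_scale_left L2_inner_scale_right)
    ultimately have "L2_inner M (X.lazy F) F < (1 - \<eta>) * L2_inner M F F"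
      using n(1) unfolding n(2)[symmetric] by (simp add: field_simps power2_eq_square)
    then have "L2_inner M (X.avg F) F < (1 - 2 * \<eta>) * L2_inner M F F"
      unfolding X.lazy_inner[OF FL FL] by (simp add: field_simps)
    then have "L2_inner M (X.avg F) F / L2_inner M F F \<le> 1 - 2 * \<eta>"
      using Fpos by (simp add: pos_divide_le_eq)
    then show ?thesis unfolding num norm using r by simp
  qed
  then have "rho_plus (normalized_restriction M Y) (pushed_uniform \<phi> T) \<le> ereal (1 - 2 * \<eta>)"
    unfolding rho_plus_def by (intro SUP_least) auto
  also have "\<dots> < 1" using \<eta>(1) by (simp add: one_ereal_def)
  finally show ?thesis .
qed

end

section \<open>Splitting of the space into ergodic components\<close>

context pmp_group_action
begin

lemma invariant_set_Diff:
  assumes K: "K \<subseteq> carrier G" and A: "A \<subseteq> space M" "invariant_set \<phi> K A"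
    and B: "B \<subseteq> space M" "invariant_set \<phi> K B"
  shows "invariant_set \<phi> K (A - B)"
proof -
  have "A - B \<subseteq> space M" using A by blast
  then show ?thesis
    using A(2) B(2) unfolding invariant_set_iff[OF K A(1)] invariant_set_iff[OF K B(1)]
    by (simp add: invariant_set_iff[OF K])
qed

lemma invariant_set_Union:
  assumes "\<And>A. A \<in> \<X> \<Longrightarrow> invariant_set \<phi> K A"
  shows "invariant_set \<phi> K (\<Union>\<X>)"
  using assms by (simp add: invariant_set_def image_Union)

lemma invariant_set_space: "K \<subseteq> carrier G \<Longrightarrow> invariant_set \<phi> K (space M)"
  using action_bij by (auto simp: invariant_set_def bij_betw_def)

text \<open>A disjoint family of invariant sets of positive measure with the largest number of
  members exists, because each member takes up measure at least d. Maximality does the rest: a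
  remainder of positive measure could be added to the family, and a member that is not ergodic could
  be split in two.\<close>

theorem finitely_many_components_of_spread:
  assumes Q: "finite Q" "Q \<subseteq> carrier G" and e: "e > 0" and d: "d > 0"
    and spread: "\<And>f. f \<in> L2 M \<Longrightarrow> \<forall>x. f x \<ge> 0 \<Longrightarrow> \<forall>h\<in>Q. disp h f \<le> e * L2_norm M f \<Longrightarrow>
      d * (L2_norm M f)\<^sup>2 \<le> (LINT x|M. f x)\<^sup>2"
  shows "finitely_many_components_with_gap G M \<phi> (generate G Q)"
proof -
  define K where "K = generate G Q"
  have K: "K \<subseteq> carrier G" "Q \<subseteq> K"
    using generate_incl[OF Q(2)] generate.incl[of _ Q G] by (auto simp: K_def)
  have large: "measure M A \<ge> d" if A: "A \<in> sets M" "invariant_set \<phi> K A" "emeasure M A > 0" for A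
  proof -
    let ?f = "indicator A :: 'x \<Rightarrow> real"
    have As: "A \<subseteq> space M" using A sets.sets_into_space by blast
    have fL: "?f \<in> L2 M"
      using A by (intro L2_bound[OF const_L2[of 1]]) auto
    have "disp h ?f = 0" if h: "h \<in> Q" for h
    proof -
      have "\<phi> h x \<in> A \<longleftrightarrow> x \<in> A" if "x \<in> space M" for x
        using that A(2) h K invariant_set_iff[OF K(1) As] by blast
      then have "disp h ?f \<le> L2_norm M (\<lambda>x. 0)"
        unfolding disp_def
      proof (intro L2_norm_mono L2_zero)
        have "h \<in> carrier G" using h Q by blast
        then show "(\<lambda>x. ?f (\<phi> h x) - ?f x) \<in> L2 M"
          using L2_diff[OF compose_L2[OF _ fL] fL] by blast
      qed (simp add: indicator_def)
      then show ?thesis using disp_nonneg[of h ?f] by simp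
    qed
    \<comment> \<open>For an indicator both the squared norm and the integral are the measure m of
      the set, so this says d m \<le> m^2.\<close>
    then have "d * (L2_norm M ?f)\<^sup>2 \<le> (LINT x|M. ?f x)\<^sup>2"
      using e by (intro spread fL) auto
    moreover have "(L2_norm M ?f)\<^sup>2 = measure M A"
      using A by (simp add: L2_norm_power2 L2_inner_def flip: indicator_inter_arith)
    moreover have "(LINT x|M. ?f x) = measure M A"
      using A by simp
    ultimately have "d * measure M A \<le> measure M A * measure M A"
      by (simp add: power2_eq_square)
    moreover have "measure M A > 0" using A(3) by (simp add: emeasure_eq_measure)
    ultimately show ?thesis by simp
  qed
  define P where "P \<X> \<longleftrightarrow> finite \<X> \<and> \<X> \<subseteq> sets M \<and> disjoint \<X> \<and>
      (\<forall>A\<in>\<X>. invariant_set \<phi> K A \<and> emeasure M A > 0)" for \<X>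
  have bound: "card \<X> \<le> nat \<lceil>1 / d\<rceil>" if "P \<X>" for \<X>
  proof -
    have "card \<X> * d = (\<Sum>A\<in>\<X>. d)" by simp
    also have "\<dots> \<le> (\<Sum>A\<in>\<X>. measure M A)"
      using that large by (intro sum_mono) (auto simp: P_def)
    also have "\<dots> = measure M (\<Union>\<X>)"
      using that finite_measure_finite_Union[of \<X> id]
      by (auto simp: P_def disjoint_def disjoint_family_on_def)
    also have "\<dots> \<le> 1" by simp
    finally have "card \<X> \<le> 1 / d" using d by (simp add: pos_le_divide_eq)
    then show ?thesis by linarith
  qed
  have "P {}" by (simp add: P_def)
  moreover have "\<forall>\<X>. P \<X> \<longrightarrow> card \<X> < Suc (nat \<lceil>1 / d\<rceil>)" using bound by (simp add: less_Suc_eq_le)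
  ultimately have "\<exists>\<X>. P \<X> \<and> (\<forall>\<Z>. P \<Z> \<longrightarrow> card \<Z> \<le> card \<X>)"
    by (rule ex_has_greatest_nat)
  then obtain \<X> where X: "P \<X>" "\<And>\<Z>. P \<Z> \<Longrightarrow> card \<Z> \<le> card \<X>" by metis
  have Xs: "finite \<X>" "\<X> \<subseteq> sets M" "disjoint \<X>"
    "\<And>A. A \<in> \<X> \<Longrightarrow> invariant_set \<phi> K A" "\<And>A. A \<in> \<X> \<Longrightarrow> emeasure M A > 0"
    using X(1) by (auto simp: P_def)
  have US: "\<Union>\<X> \<in> sets M" using Xs by auto
  have null: "space M - \<Union>\<X> \<in> null_sets M"
  proof (rule ccontr)
    let ?Z = "space M - \<Union>\<X>"
    assume "?Z \<notin> null_sets M"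
    then have pos: "emeasure M ?Z > 0" using US by (auto simp: null_sets_def zero_less_iff_neq_zero)
    have "invariant_set \<phi> K ?Z"
      using Xs(4) sets.sets_into_space[OF US]
      by (intro invariant_set_Diff invariant_set_Union invariant_set_space K) auto
    then have "P (insert ?Z \<X>)"
      using pos Xs US by (auto simp: P_def disjoint_def)
    moreover have "?Z \<notin> \<X>"
    proof
      assume "?Z \<in> \<X>"
      then have "?Z = {}" by blast
      then show False using pos by (simp only: emeasure_empty)
    qed
    ultimately show False using X(2)[of "insert ?Z \<X>"] Xs(1) by simp
  qed
  have erg: "ergodic_on M \<phi> K Y" if Y: "Y \<in> \<X>" for Y
    unfolding ergodic_on_def
  proof (intro ballI impI, rule ccontr)
    fix A assume A: "A \<in> sets M" "A \<subseteq> Y \<and> invariant_set \<phi> K A"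
      and n: "\<not> (emeasure M A = 0 \<or> emeasure M (Y - A) = 0)"
    let ?Z = "insert A (insert (Y - A) (\<X> - {Y}))"
    have YM: "Y \<in> sets M" using Y Xs(2) by blast
    have YA: "invariant_set \<phi> K (Y - A)" "Y - A \<in> sets M"
      using A YM Xs(4)[OF Y] sets.sets_into_space[OF A(1)] sets.sets_into_space[OF YM]
      by (auto intro: invariant_set_Diff[OF K(1)])
    have disj: "A' \<inter> Y = {}" if "A' \<in> \<X>" "A' \<noteq> Y" for A'
      using that Xs(3) Y by (auto simp: disjoint_def)
    have "P ?Z"
      unfolding P_def
    proof (intro conjI)
      show "disjoint ?Z"
        using Xs(3) disj A(2) by (auto simp: disjoint_def)
    qed (use Xs A YA n in \<open>auto simp: zero_less_iff_neq_zero\<close>)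
    moreover have "card ?Z = Suc (card \<X>)"
    proof -
      have "A \<noteq> {}" "Y - A \<noteq> {}" using n emeasure_empty by metis+
      then have "A \<notin> insert (Y - A) (\<X> - {Y})" "Y - A \<notin> \<X> - {Y}"
        using disj A(2) by blast+
      moreover have "card \<X> > 0" using Y Xs(1) by (auto simp: card_gt_0_iff)
      ultimately show ?thesis using Xs(1) Y by (simp add: card_Diff_singleton)
    qed
    ultimately show False using X(2)[of ?Z] by simp
  qed
  have gap: "spectral_gap_on G M \<phi> K Y" if Y: "Y \<in> \<X>" for Y
    unfolding spectral_gap_on_def
  proof (intro allI impI)
    fix T assume T: "sym_gen_set G K T"
    interpret E: ergodic_component G M \<phi> K T Y
      by (intro ergodic_component.intro ergodic_component_axioms.intro pmp_group_action_axioms)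
        (use T Y Xs erg in auto)
    \<comment> \<open>The gap is wanted for every generating set T, while the spread inequality
      refers to Q; the word bounds of \<open>disp_generate\<close>, used inside, mediate between the
      two.\<close>
    have "\<not> E.no_gap" by (rule E.gap_of_spread[OF Q(1) K(2) e d spread])
    then show "rho_plus (normalized_restriction M Y) (pushed_uniform \<phi> T) < 1"
      by (rule E.spectral_gap_of_not_no_gap[OF Xs(5)[OF Y]])
  qed
  show ?thesis
    unfolding finitely_many_components_with_gap_def K_def[symmetric]
  proof (intro exI[of _ \<X>] conjI ballI)
    show "space M - \<Union>\<X> \<in> null_sets M" by (rule null)
  qed (use Xs erg gap in auto)
qed

end

theorem theorem1:
  fixes \<Gamma> :: "('g, 'r) monoid_scheme" and S :: "'g set"
    and M :: "'x measure" and \<phi> :: "'g \<Rightarrow> 'x \<Rightarrow> 'x"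
  assumes "group \<Gamma>"
    and "sym_gen_set \<Gamma> (carrier \<Gamma>) S"
    and "prob_space M" and "standard_borel M"
    and "pmp_action \<Gamma> M \<phi>"
  shows "\<forall>H. subgroup H \<Gamma> \<and>
             rel_spectral_radius \<Gamma> H (pmf_of_set S) > rho_plus M (pushed_uniform \<phi> S) \<longrightarrow>
           (\<exists>H'. subgroup H' \<Gamma> \<and> H' \<subseteq> H \<and> fin_gen \<Gamma> H' \<and>
                 finitely_many_components_with_gap \<Gamma> M \<phi> H')"
proof (intro allI impI, elim conjE)
  fix H
  assume H: "subgroup H \<Gamma>"
    and gt: "rel_spectral_radius \<Gamma> H (pmf_of_set S) > rho_plus M (pushed_uniform \<phi> S)"
  have fin_S: "finite S" "S \<noteq> {}" "S \<subseteq> carrier \<Gamma>" "m_inv \<Gamma> ` S = S" "generate \<Gamma> S = carrier \<Gamma>"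
    using assms(2) by (auto simp: sym_gen_set_def)
  interpret group \<Gamma> by fact
  interpret prob_space M by fact
  interpret coset_transfer \<Gamma> M \<phi> H S
    using assms(5) H fin_S by (intro coset_transfer.intro pmp_group_action.intro coset_transfer_axioms.intro
        pmp_group_action_axioms.intro group_axioms prob_space_axioms)
  \<comment> \<open>Finite generation makes the group and hence the coset space countable, as the
    approximation by finitely supported functions requires.\<close>
  have "countable (carrier \<Gamma>)"
    using countable_generate[of S] fin_S(1,3) unfolding fin_S(5) by (simp add: countable_finite)
  from almost_invariant_spread[OF this gt] obtain Q e d where Q: "finite Q" "Q \<subseteq> H" "e > 0" "d > 0"
    "\<And>f. f \<in> L2 M \<Longrightarrow> \<forall>x. f x \<ge> 0 \<Longrightarrow> \<forall>h\<in>Q. disp h f \<le> e * L2_norm M f \<Longrightarrow>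
      d * (L2_norm M f)\<^sup>2 \<le> (LINT x|M. f x)\<^sup>2"
    by blast
  have QG: "Q \<subseteq> carrier \<Gamma>" using Q(2) subgroup.subset[OF H] by blast
  show "\<exists>H'. subgroup H' \<Gamma> \<and> H' \<subseteq> H \<and> fin_gen \<Gamma> H' \<and>
      finitely_many_components_with_gap \<Gamma> M \<phi> H'"
  proof (intro exI conjI)
    show "subgroup (generate \<Gamma> Q) \<Gamma>" by (rule generate_is_subgroup[OF QG])
    show "generate \<Gamma> Q \<subseteq> H" by (rule generate_subgroup_incl[OF Q(2) H])
    show "fin_gen \<Gamma> (generate \<Gamma> Q)" using Q(1) QG by (auto simp: fin_gen_def)
    show "finitely_many_components_with_gap \<Gamma> M \<phi> (generate \<Gamma> Q)"
      by (rule finitely_many_components_of_spread[OF Q(1) QG Q(3,4,5)])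
  qed
qed

end
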